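(* Let $r>0$, $T>0$, and let $D\in\mathrm{Op}_{\hbar\mathbb{Z}^n}S^r_{1,0}(\hbar\mathbb{Z}^n\times\mathbb{T}^n)$ be a semi-classical pseudo-differential operator. Assume that there exist $C_0>0$ and $R>0$ such that for all $\theta\in\mathbb{T}^n$, $$-\sigma_{\hbar,D}(k,\theta)\ge C_0|k|^r\qquad\text{for }|k|\ge R.$$ If $w_0\in\ell^2(\hbar\mathbb{Z}^n)$ and $g\in L^1([0,T],\ell^2(\hbar\mathbb{Z}^n))$, then the Cauchy problem $$\frac{\partial w}{\partial t}-Dw=g,\quad t\in[0,T],\qquad w(0)=w_0,$$ has a unique solution $w\in C([0,T],\ell^2(\hbar\mathbb{Z}^n))$, and it satisfies the estimate $$\|w(t)\|^2_{\ell^2(\hbar\mathbb{Z}^n)}\le C\Big(\|w_0\|^2_{\ell^2(\hbar\mathbb{Z}^n)}+\int_0^t\|g(s)\|^2_{\ell^2(\hbar\mathbb{Z}^n)}\,ds\Big)$$ for some $C>0$ and for all $t\in[0,T]$.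
   Context: Fix $n\ge1$ and $\hbar\in(0,1]$. $\hbar\mathbb{Z}^n=\{\hbar\bar k:\bar k\in\mathbb{Z}^n\}\subset\mathbb{R}^n$, $|k|$ is the Euclidean norm, $\mathbb{T}^n=\mathbb{R}^n/\mathbb{Z}^n$ with normalized Haar measure, $k\cdot\theta=\sum_jk_j\theta_j$. Semi-classical Fourier transform: $\widehat f(\theta)=\sum_{k\in\hbar\mathbb{Z}^n}e^{-2\pi\frac{i}{\hbar}k\cdot\theta}f(k)$. Quantization: $\mathrm{Op}_{\hbar\mathbb{Z}^n}(\sigma_\hbar)f(k)=\int_{\mathbb{T}^n}e^{2\pi\frac{i}{\hbar}k\cdot\theta}\sigma_\hbar(k,\theta)\widehat f(\theta)\,d\theta$; $\sigma_{\hbar,D}$ denotes the symbol of $D$ (the hypothesis includes that it is real for $|k|\ge R$). Difference operators: with $v_j$ the $j$-th standard unit vector, $\Delta_{\hbar,j}g(k)=\frac{g(k+\hbar v_j)-g(k)}{\hbar}$, $\Delta_\hbar^\alpha=\Delta_{\hbar,1}^{\alpha_1}\cdots\Delta_{\hbar,n}^{\alpha_n}$. Toroidal operators: $D_{\hbar,\theta}^{(\beta)}=\hbar^{|\beta|}\prod_{j=1}^n\prod_{\ell=0}^{\beta_j-1}\big(\frac{1}{2\pi i}\frac{\partial}{\partial\theta_j}-\ell\big)$. $S^r_{1,0}(\hbar\mathbb{Z}^n\times\mathbb{T}^n)$ is the set of $\sigma_\hbar:\hbar\mathbb{Z}^n\times\mathbb{T}^n\to\mathbb{C}$, smooth in $\theta$,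 such that for all $\alpha,\beta\in\mathbb{N}_0^n$ there is $C_{\alpha,\beta}$ with $|D^{(\beta)}_{\hbar,\theta}\Delta^\alpha_{\hbar,k}\sigma_\hbar(k,\theta)|\le C_{\alpha,\beta}(1+|k|)^{r-|\alpha|}$ for all $(k,\theta)$. A solution $w\in C([0,T],\ell^2(\hbar\mathbb{Z}^n))$ is understood in the integrated sense: $w(t)(k)=w_0(k)+\int_0^t\big[(Dw(s))(k)+g(s)(k)\big]ds$ for all $t\in[0,T]$ and $k\in\hbar\mathbb{Z}^n$. The constant $C$ may depend on $T$ and $D$ but not on $w_0,g,t$; the right-hand side of the estimate is $+\infty$ if $g$ is not square integrable in time. *)

theory Defs
  imports "HOL-Analysis.Analysis"
begin

(* The dimension n is CARD('n).  A function on the lattice h Z^n is a function on real^'n of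
   which only the values at lattice points matter; a function on the torus R^n / Z^n is a
   Z^n-periodic function on real^'n, integrated over the unit cube. *)

definition scaled_lattice :: "real \<Rightarrow> (real^'n) set" where
  "scaled_lattice h = {k. \<exists>m::int^'n. k = h *\<^sub>R (\<chi> j. of_int (m $ j))}"

definition torus_measure :: "(real^'n) measure" where
  "torus_measure = lebesgue_on (cbox 0 1)"

definition torus_periodic :: "(real^'n \<Rightarrow> complex) \<Rightarrow> bool" where
  "torus_periodic f \<longleftrightarrow> (\<forall>(m::int^'n) \<theta>. f (\<theta> + (\<chi> j. of_int (m $ j))) = f \<theta>)"

(* Elements vanish off the lattice, so that equality in the space is equality of functions. *)

definition ell2 :: "real \<Rightarrow> (real^'n \<Rightarrow> complex) set" where
  "ell2 h = {f. (\<forall>k. k \<notin> scaled_lattice h \<longrightarrow> f k = 0) \<and>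
                (\<lambda>k. (cmod (f k))\<^sup>2) summable_on scaled_lattice h}"

definition ell2_norm :: "real \<Rightarrow> (real^'n \<Rightarrow> complex) \<Rightarrow> real" where
  "ell2_norm h f = sqrt (\<Sum>\<^sub>\<infinity>k\<in>scaled_lattice h. (cmod (f k))\<^sup>2)"

definition continuous_ell2 :: "real \<Rightarrow> real \<Rightarrow> (real \<Rightarrow> real^'n \<Rightarrow> complex) \<Rightarrow> bool" where
  "continuous_ell2 h T w \<longleftrightarrow>
     (\<forall>t\<in>{0..T}. w t \<in> ell2 h) \<and>
     (\<forall>t\<in>{0..T}. ((\<lambda>s. ell2_norm h (\<lambda>k. w s k - w t k)) \<longlongrightarrow> 0) (at t within {0..T}))"

(* The Bochner space L^1([0,T], ell2): almost everywhere limits, in norm, of simple functions,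
   with integrable norm. *)

definition L1_ell2 :: "real \<Rightarrow> real \<Rightarrow> (real \<Rightarrow> real^'n \<Rightarrow> complex) \<Rightarrow> bool" where
  "L1_ell2 h T g \<longleftrightarrow>
     (\<forall>s\<in>{0..T}. g s \<in> ell2 h) \<and>
     (\<exists>G. (\<forall>m::nat. simple_function (lebesgue_on {0..T}) (G m) \<and> (\<forall>s\<in>{0..T}. G m s \<in> ell2 h)) \<and>
          (AE s in lebesgue_on {0..T}. (\<lambda>m. ell2_norm h (\<lambda>k. G m s k - g s k)) \<longlonglongrightarrow> 0)) \<and>
     (\<integral>\<^sup>+s. ennreal (ell2_norm h (g s)) \<partial>lebesgue_on {0..T}) < \<infinity>"

definition semiclassical_character :: "real \<Rightarrow> real^'n \<Rightarrow> real^'n \<Rightarrow> complex" where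
  "semiclassical_character h k \<theta> =
     exp (2 * complex_of_real pi * (\<i> / complex_of_real h) * complex_of_real (k \<bullet> \<theta>))"

(* For square summable f the series defining the Fourier transform converges in L^2 of the
   torus, in general not pointwise.  The transform is therefore an L^2 class; any two
   representatives agree almost everywhere, so the choice below does not affect integrals. *)

definition is_semiclassical_fourier ::
    "real \<Rightarrow> (real^'n \<Rightarrow> complex) \<Rightarrow> (real^'n \<Rightarrow> complex) \<Rightarrow> bool" where
  "is_semiclassical_fourier h f F \<longleftrightarrow>
     F \<in> borel_measurable torus_measure \<and>
     ((\<lambda>A. \<integral>\<^sup>+\<theta>. ennreal ((cmod (F \<theta> - (\<Sum>k\<in>A. semiclassical_character h (- k) \<theta> * f k)))\<^sup>2)
            \<partial>torus_measure) \<longlongrightarrow> 0) (finite_subsets_at_top (scaled_lattice h))"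

definition semiclassical_fourier ::
    "real \<Rightarrow> (real^'n \<Rightarrow> complex) \<Rightarrow> real^'n \<Rightarrow> complex" where
  "semiclassical_fourier h f = (SOME F. is_semiclassical_fourier h f F)"

definition Op :: "real \<Rightarrow> (real^'n \<Rightarrow> real^'n \<Rightarrow> complex) \<Rightarrow>
    (real^'n \<Rightarrow> complex) \<Rightarrow> real^'n \<Rightarrow> complex" where
  "Op h \<sigma> f k =
     (LINT \<theta>|torus_measure. semiclassical_character h k \<theta> * \<sigma> k \<theta> * semiclassical_fourier h f \<theta>)"

definition partial_deriv :: "'n \<Rightarrow> (real^'n \<Rightarrow> complex) \<Rightarrow> real^'n \<Rightarrow> complex" where
  "partial_deriv j f \<theta> = vector_derivative (\<lambda>t. f (\<theta> + t *\<^sub>R axis j 1)) (at 0)"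

primrec C_diff :: "nat \<Rightarrow> (real^'n \<Rightarrow> complex) \<Rightarrow> bool" where
  "C_diff 0 f \<longleftrightarrow> continuous_on UNIV f"
| "C_diff (Suc m) f \<longleftrightarrow> continuous_on UNIV f \<and>
     (\<forall>j. (\<forall>\<theta>. (\<lambda>t. f (\<theta> + t *\<^sub>R axis j 1)) differentiable at 0) \<and> C_diff m (partial_deriv j f))"

definition smooth :: "(real^'n \<Rightarrow> complex) \<Rightarrow> bool" where
  "smooth f \<longleftrightarrow> (\<forall>m. C_diff m f)"

(* An arbitrary enumeration of the coordinates.  The operators composed along it below commute
   (the derivatives do so on smooth functions), so its order is immaterial. *)

definition coords :: "'n::finite list" where
  "coords = (SOME js. distinct js \<and> set js = UNIV)"

definition difference :: "real \<Rightarrow> 'n \<Rightarrow> (real^'n \<Rightarrow> complex) \<Rightarrow> real^'n \<Rightarrow> complex" where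
  "difference h j g k = (g (k + h *\<^sub>R axis j 1) - g k) / complex_of_real h"

definition multi_difference ::
    "real \<Rightarrow> ('n \<Rightarrow> nat) \<Rightarrow> (real^'n \<Rightarrow> complex) \<Rightarrow> real^'n \<Rightarrow> complex" where
  "multi_difference h \<alpha> g = foldr (\<lambda>j. difference h j ^^ \<alpha> j) coords g"

definition toroidal_factor :: "'n \<Rightarrow> nat \<Rightarrow> (real^'n \<Rightarrow> complex) \<Rightarrow> real^'n \<Rightarrow> complex" where
  "toroidal_factor j l f \<theta> =
     1 / (2 * complex_of_real pi * \<i>) * partial_deriv j f \<theta> - of_nat l * f \<theta>"

definition toroidal_deriv ::
    "real \<Rightarrow> ('n \<Rightarrow> nat) \<Rightarrow> (real^'n \<Rightarrow> complex) \<Rightarrow> real^'n \<Rightarrow> complex" where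
  "toroidal_deriv h \<beta> f \<theta> = complex_of_real h ^ (\<Sum>j\<in>UNIV. \<beta> j) *
     foldr (\<lambda>j. foldr (toroidal_factor j) [0..<\<beta> j]) coords f \<theta>"

definition symbol_class :: "real \<Rightarrow> real \<Rightarrow> (real^'n \<Rightarrow> real^'n \<Rightarrow> complex) set" where
  "symbol_class h r = {\<sigma>.
     (\<forall>k\<in>scaled_lattice h. torus_periodic (\<sigma> k) \<and> smooth (\<sigma> k)) \<and>
     (\<forall>\<alpha> \<beta>. \<exists>C. \<forall>k\<in>scaled_lattice h. \<forall>\<theta>.
        cmod (toroidal_deriv h \<beta> (\<lambda>\<theta>'. multi_difference h \<alpha> (\<lambda>k'. \<sigma> k' \<theta>') k) \<theta>)
          \<le> C * (1 + norm k) powr (r - real (\<Sum>j\<in>UNIV. \<alpha> j)))}"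

definition cauchy_solution :: "real \<Rightarrow> real \<Rightarrow> ((real^'n \<Rightarrow> complex) \<Rightarrow> real^'n \<Rightarrow> complex) \<Rightarrow>
    (real^'n \<Rightarrow> complex) \<Rightarrow> (real \<Rightarrow> real^'n \<Rightarrow> complex) \<Rightarrow> (real \<Rightarrow> real^'n \<Rightarrow> complex) \<Rightarrow> bool" where
  "cauchy_solution h T D w0 g w \<longleftrightarrow>
     continuous_ell2 h T w \<and>
     (\<forall>t\<in>{0..T}. \<forall>k\<in>scaled_lattice h.
        set_integrable lebesgue {0..t} (\<lambda>s. D (w s) k + g s k) \<and>
        w t k = w0 k + (LINT s:{0..t}|lebesgue. D (w s) k + g s k))"

end

(* In Fourier coordinates D is the lattice operator with kernel
   A(k, m) = integral of sigma(k, theta) exp(2 pi i (k - m) . theta / h), which has order r in k and decays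
   faster than every power of |k - m|.  Garding's inequality holds for D, and also in every weighted space
   with weight (1 + |k|)^q, because conjugating by the weight changes A by an operator of order r - 1.
   Hence the truncations of the system to finite sets of lattice points satisfy weighted energy estimates
   that do not depend on the truncation.

   For finitely supported data, continuous in time, the estimate with weight q = r + 1 bounds the truncated
   solutions so strongly that they form a Cauchy sequence in C([0,T], ell2); general data are reached by density.
   For uniqueness, a truncation of a solution of the homogeneous problem solves the truncated system up
   to a forcing which tends to 0 in the space with weight q = - (r + 1). *)

theory Submission
  imports Defs
begin

section \<open>Square summable functions on the lattice\<close>

text \<open>The hypothesis bounds the symbol, not the operator: D need not be self-adjoint, and its
  quadratic form mixes values of the symbol at different k. As h is fixed, Garding's inequality has
  no small parameter to rely on; what helps is that a difference in k lowers the order by one, so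
  that the symbol may be frozen on cubes of a fixed large side, and that terms of order r - 1 are
  small against \<open>bracket k powr r\<close> for large k. D is unbounded, and a solution is only
  known to be continuous with values in ell2, so that Dw need not be square summable and pairing the
  equation with w is meaningless. Energy estimates are therefore applied to finite systems only.
  Cutting at radius n leaves a defect, in which D links the inside of the ball to the outside;
  making it of size 1/n costs one power of \<open>bracket\<close> on top of the r powers that D
  costs, whence the weights r + 1 and - (r + 1). Existence affords the positive weight because the
  data are first made finitely supported; uniqueness starts from ell2 and has to pay with the
  negative one.\<close>

lemma ell2_iff_bounded_sections:
  "f \<in> ell2 h \<longleftrightarrow> (\<forall>k. k \<notin> scaled_lattice h \<longrightarrow> f k = 0) \<and>
     (\<exists>B. \<forall>F. finite F \<and> F \<subseteq> scaled_lattice h \<longrightarrow> L2_set (\<lambda>k. cmod (f k)) F \<le> B)"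
proof -
  have "(\<lambda>k. (cmod (f k))\<^sup>2) summable_on scaled_lattice h \<longleftrightarrow>
     (\<exists>B. \<forall>F. finite F \<and> F \<subseteq> scaled_lattice h \<longrightarrow> L2_set (\<lambda>k. cmod (f k)) F \<le> B)"
  proof
    assume *: "(\<lambda>k. (cmod (f k))\<^sup>2) summable_on scaled_lattice h"
    show "\<exists>B. \<forall>F. finite F \<and> F \<subseteq> scaled_lattice h \<longrightarrow> L2_set (\<lambda>k. cmod (f k)) F \<le> B"
      unfolding L2_set_def
      by (rule exI[of _ "sqrt (infsum (\<lambda>k. (cmod (f k))\<^sup>2) (scaled_lattice h))"])
        (auto intro!: finite_sum_le_infsum *)
  next
    assume "\<exists>B. \<forall>F. finite F \<and> F \<subseteq> scaled_lattice h \<longrightarrow> L2_set (\<lambda>k. cmod (f k)) F \<le> B"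
    then obtain B where B: "\<And>F. finite F \<Longrightarrow> F \<subseteq> scaled_lattice h \<Longrightarrow> L2_set (\<lambda>k. cmod (f k)) F \<le> B"
      by blast
    show "(\<lambda>k. (cmod (f k))\<^sup>2) summable_on scaled_lattice h"
    proof (rule nonneg_bdd_above_summable_on)
      show "bdd_above (sum (\<lambda>k. (cmod (f k))\<^sup>2) ` {F. F \<subseteq> scaled_lattice h \<and> finite F})"
      proof (rule bdd_aboveI2)
        fix F :: "(real^'a) set" assume F: "F \<in> {F. F \<subseteq> scaled_lattice h \<and> finite F}"
        have "sqrt (\<Sum>k\<in>F. (cmod (f k))\<^sup>2) \<le> B"
          using B[of F] F unfolding L2_set_def by auto
        moreover have "0 \<le> (\<Sum>k\<in>F. (cmod (f k))\<^sup>2)" by (simp add: sum_nonneg)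
        ultimately show "(\<Sum>k\<in>F. (cmod (f k))\<^sup>2) \<le> B\<^sup>2"
          by (metis power_mono real_sqrt_ge_zero real_sqrt_pow2)
      qed
    qed auto
  qed
  then show ?thesis unfolding ell2_def by auto
qed

lemma ell2_zero_off: "f \<in> ell2 h \<Longrightarrow> k \<notin> scaled_lattice h \<Longrightarrow> f k = 0"
  by (simp add: ell2_def)

lemma ell2_norm_nonneg [simp]: "0 \<le> ell2_norm h f"
  by (simp add: ell2_norm_def infsum_nonneg)

lemma ell2_norm_power2: "(ell2_norm h f)\<^sup>2 = (\<Sum>\<^sub>\<infinity>k\<in>scaled_lattice h. (cmod (f k))\<^sup>2)"
  by (simp add: ell2_norm_def infsum_nonneg)

lemma L2_set_le_ell2_norm:
  assumes "f \<in> ell2 h" "finite F" "F \<subseteq> scaled_lattice h"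
  shows "L2_set (\<lambda>k. cmod (f k)) F \<le> ell2_norm h f"
  unfolding L2_set_def ell2_norm_def
  using assms by (auto intro!: finite_sum_le_infsum simp: ell2_def)

lemma ell2_norm_le:
  assumes "f \<in> ell2 h"
    and "\<And>F. finite F \<Longrightarrow> F \<subseteq> scaled_lattice h \<Longrightarrow> L2_set (\<lambda>k. cmod (f k)) F \<le> B"
  shows "ell2_norm h f \<le> B"
proof -
  have B: "0 \<le> B" using assms(2)[of "{}"] by simp
  have "infsum (\<lambda>k. (cmod (f k))\<^sup>2) (scaled_lattice h) \<le> B\<^sup>2"
  proof (rule infsum_le_finite_sums)
    show "(\<lambda>k. (cmod (f k))\<^sup>2) summable_on scaled_lattice h"
      using assms(1) by (simp add: ell2_def)
    fix F :: "(real^'a) set" assume F: "finite F" "F \<subseteq> scaled_lattice h"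
    show "(\<Sum>k\<in>F. (cmod (f k))\<^sup>2) \<le> B\<^sup>2"
      using assms(2)[OF F] unfolding L2_set_def
      by (metis power_mono real_sqrt_ge_zero real_sqrt_pow2 sum_nonneg zero_le_power2)
  qed
  then show ?thesis
    unfolding ell2_norm_def using B real_le_lsqrt by blast
qed

text \<open>All finite sections are bounded at once, so that inequalities for \<open>L2_set\<close>,
  such as Minkowski's, carry over to the infinite lattice.\<close>

lemma ell2I:
  assumes "\<And>k. k \<notin> scaled_lattice h \<Longrightarrow> f k = 0"
    and "\<And>F. finite F \<Longrightarrow> F \<subseteq> scaled_lattice h \<Longrightarrow> L2_set (\<lambda>k. cmod (f k)) F \<le> B"
  shows "f \<in> ell2 h" "ell2_norm h f \<le> B"
proof -
  show *: "f \<in> ell2 h" unfolding ell2_iff_bounded_sections using assms by blast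
  show "ell2_norm h f \<le> B" by (rule ell2_norm_le[OF * assms(2)])
qed

lemma cmod_le_ell2_norm:
  assumes "f \<in> ell2 h"
  shows "cmod (f k) \<le> ell2_norm h f"
proof (cases "k \<in> scaled_lattice h")
  case True
  then show ?thesis using L2_set_le_ell2_norm[OF assms, of "{k}"] by (simp add: L2_set_def)
qed (simp add: ell2_zero_off[OF assms])

lemma ell2_add:
  assumes "f \<in> ell2 h" "g \<in> ell2 h"
  shows "(\<lambda>k. f k + g k) \<in> ell2 h"
    and ell2_norm_triangle: "ell2_norm h (\<lambda>k. f k + g k) \<le> ell2_norm h f + ell2_norm h g"
proof -
  have "L2_set (\<lambda>k. cmod (f k + g k)) F \<le> ell2_norm h f + ell2_norm h g"
    if "finite F" "F \<subseteq> scaled_lattice h" for F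
  proof -
    have "L2_set (\<lambda>k. cmod (f k + g k)) F \<le> L2_set (\<lambda>k. cmod (f k) + cmod (g k)) F"
      by (intro L2_set_mono) (auto intro: norm_triangle_ineq)
    also have "\<dots> \<le> L2_set (\<lambda>k. cmod (f k)) F + L2_set (\<lambda>k. cmod (g k)) F"
      by (rule L2_set_triangle_ineq)
    also have "\<dots> \<le> ell2_norm h f + ell2_norm h g"
      by (intro add_mono L2_set_le_ell2_norm assms that)
    finally show ?thesis .
  qed
  note * = this
  have z: "f k + g k = 0" if "k \<notin> scaled_lattice h" for k
    using ell2_zero_off[OF assms(1) that] ell2_zero_off[OF assms(2) that] by simp
  show "(\<lambda>k. f k + g k) \<in> ell2 h" by (rule ell2I(1)[OF z *])
  show "ell2_norm h (\<lambda>k. f k + g k) \<le> ell2_norm h f + ell2_norm h g" by (rule ell2I(2)[OF z *])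
qed

lemma ell2_norm_uminus: "ell2_norm h (\<lambda>k. - f k) = ell2_norm h f"
  by (simp add: ell2_norm_def)

lemma ell2_uminus: "f \<in> ell2 h \<Longrightarrow> (\<lambda>k. - f k) \<in> ell2 h"
  by (simp add: ell2_def)

lemma ell2_diff:
  assumes "f \<in> ell2 h" "g \<in> ell2 h"
  shows "(\<lambda>k. f k - g k) \<in> ell2 h"
    and ell2_norm_diff_le: "ell2_norm h (\<lambda>k. f k - g k) \<le> ell2_norm h f + ell2_norm h g"
  using ell2_add[OF assms(1) ell2_uminus[OF assms(2)]] ell2_norm_triangle[OF assms(1) ell2_uminus[OF assms(2)]]
  by (simp_all add: ell2_norm_uminus)

lemma ell2_norm_diff_commute: "ell2_norm h (\<lambda>k. f k - g k) = ell2_norm h (\<lambda>k. g k - f k)"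
  by (simp add: ell2_norm_def norm_minus_commute)

lemma ell2_norm_diff_triangle:
  assumes "f \<in> ell2 h" "g \<in> ell2 h" "u \<in> ell2 h"
  shows "ell2_norm h (\<lambda>k. f k - u k) \<le> ell2_norm h (\<lambda>k. f k - g k) + ell2_norm h (\<lambda>k. g k - u k)"
  using ell2_norm_triangle[OF ell2_diff(1)[OF assms(1,2)] ell2_diff(1)[OF assms(2,3)]] by simp

lemma ell2_norm_triangle_sub:
  assumes "f \<in> ell2 h" "g \<in> ell2 h"
  shows "ell2_norm h f \<le> ell2_norm h g + ell2_norm h (\<lambda>k. f k - g k)"
  using ell2_norm_triangle[OF assms(2) ell2_diff(1)[OF assms]] by simp

lemma ell2_norm_reverse_triangle:
  assumes "f \<in> ell2 h" "g \<in> ell2 h"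
  shows "\<bar>ell2_norm h f - ell2_norm h g\<bar> \<le> ell2_norm h (\<lambda>k. f k - g k)"
  using ell2_norm_triangle_sub[OF assms] ell2_norm_triangle_sub[OF assms(2,1)]
  by (simp add: ell2_norm_diff_commute[of h g f])

lemma ell2_finite_support:
  assumes "finite F" "F \<subseteq> scaled_lattice h" "\<And>k. k \<notin> F \<Longrightarrow> f k = 0"
  shows "f \<in> ell2 h" "ell2_norm h f = L2_set (\<lambda>k. cmod (f k)) F"
proof -
  have "L2_set (\<lambda>k. cmod (f k)) G \<le> L2_set (\<lambda>k. cmod (f k)) F"
    if "finite G" "G \<subseteq> scaled_lattice h" for G
  proof -
    have "(\<Sum>k\<in>G. (cmod (f k))\<^sup>2) = (\<Sum>k\<in>G \<inter> F. (cmod (f k))\<^sup>2)"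
      by (rule sum.mono_neutral_right) (use that assms in auto)
    also have "\<dots> \<le> (\<Sum>k\<in>F. (cmod (f k))\<^sup>2)"
      by (rule sum_mono2) (use assms in auto)
    finally show ?thesis by (simp add: L2_set_def)
  qed
  note le = this
  have z: "f k = 0" if "k \<notin> scaled_lattice h" for k using assms(2,3) that by blast
  show *: "f \<in> ell2 h" by (rule ell2I(1)[OF z le])
  have "ell2_norm h f \<le> L2_set (\<lambda>k. cmod (f k)) F" by (rule ell2_norm_le[OF * le])
  then show "ell2_norm h f = L2_set (\<lambda>k. cmod (f k)) F"
    using L2_set_le_ell2_norm[OF * assms(1,2)] by linarith
qed

section \<open>Domination, cut-offs, tails and limits of square summable functions\<close>

lemma ell2_mono:
  assumes "f \<in> ell2 h" "\<And>k. cmod (g k) \<le> cmod (f k)"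
  shows "g \<in> ell2 h" "ell2_norm h g \<le> ell2_norm h f"
proof -
  have *: "L2_set (\<lambda>k. cmod (g k)) F \<le> ell2_norm h f"
    if "finite F" "F \<subseteq> scaled_lattice h" for F
    using L2_set_mono[of F "\<lambda>k. cmod (g k)" "\<lambda>k. cmod (f k)"] assms(2)
      L2_set_le_ell2_norm[OF assms(1) that] by force
  have z: "g k = 0" if "k \<notin> scaled_lattice h" for k
    using assms(2)[of k] ell2_zero_off[OF assms(1) that] by simp
  show "g \<in> ell2 h" by (rule ell2I(1)[OF z *])
  show "ell2_norm h g \<le> ell2_norm h f" by (rule ell2I(2)[OF z *])
qed

text \<open>Pythagoras. The identity also expresses the norm of the tail through the full norm and
  finitely many coordinates, which later makes it measurable in time.\<close>

lemma ell2_tail_power2: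
  assumes "f \<in> ell2 h" "finite F" "F \<subseteq> scaled_lattice h"
  shows "(ell2_norm h (\<lambda>k. if k \<in> F then 0 else f k))\<^sup>2
    = (ell2_norm h f)\<^sup>2 - (\<Sum>k\<in>F. (cmod (f k))\<^sup>2)"
proof -
  let ?q = "\<lambda>k. (cmod (f k))\<^sup>2"
  have s: "?q summable_on scaled_lattice h" using assms by (simp add: ell2_def)
  have "infsum ?q (scaled_lattice h - F) = infsum ?q (scaled_lattice h) - infsum ?q F"
    by (rule infsum_Diff) (use assms s in auto)
  moreover have "infsum (\<lambda>k. (cmod (if k \<in> F then 0 else f k))\<^sup>2) (scaled_lattice h)
      = infsum ?q (scaled_lattice h - F)"
    by (rule infsum_cong_neutral) auto
  ultimately show ?thesis unfolding ell2_norm_power2 using assms by simp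
qed

lemma ell2_cut:
  assumes "f \<in> ell2 h"
  shows "(\<lambda>k. if k \<in> F then f k else 0) \<in> ell2 h" "(\<lambda>k. if k \<in> F then 0 else f k) \<in> ell2 h"
    and "ell2_norm h (\<lambda>k. if k \<in> F then f k else 0) \<le> ell2_norm h f"
    and "ell2_norm h (\<lambda>k. if k \<in> F then 0 else f k) \<le> ell2_norm h f"
  by (rule ell2_mono[OF assms]; simp)+

text \<open>An increasing exhaustion by finite sets is cofinal among the finite subsets of the
  lattice, so the unconditional sum converges along it.\<close>

lemma ell2_tail_tendsto:
  fixes f :: "real^'n \<Rightarrow> complex"
  assumes f: "f \<in> ell2 h" and F: "\<And>j::nat. finite (F j)" "\<And>j. F j \<subseteq> scaled_lattice h"
    and mono: "\<And>i j. i \<le> j \<Longrightarrow> F i \<subseteq> F j" and un: "scaled_lattice h \<subseteq> (\<Union>j. F j)"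
  shows "(\<lambda>j. ell2_norm h (\<lambda>k. if k \<in> F j then 0 else f k)) \<longlonglongrightarrow> 0"
proof -
  let ?q = "\<lambda>k. (cmod (f k))\<^sup>2"
  have s: "?q summable_on scaled_lattice h" using f by (simp add: ell2_def)
  have "filterlim F (finite_subsets_at_top (scaled_lattice h)) sequentially"
    unfolding filterlim_finite_subsets_at_top
  proof safe
    fix X :: "(real^'n) set" assume X: "finite X" "X \<subseteq> scaled_lattice h"
    have "\<exists>j. X \<subseteq> F j" using X
    proof (induction X)
      case (insert x X)
      then obtain j where "X \<subseteq> F j" by auto
      moreover obtain i where "x \<in> F i" using un insert by auto
      ultimately have "insert x X \<subseteq> F (max i j)"
        using mono[of j "max i j"] mono[of i "max i j"] by auto
      then show ?case by blast
    qed auto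
    then obtain j where "X \<subseteq> F j" by blast
    then show "\<forall>\<^sub>F j in sequentially. finite (F j) \<and> X \<subseteq> F j \<and> F j \<subseteq> scaled_lattice h"
      using F mono[of j] by (fastforce simp: eventually_sequentially)
  qed
  moreover have "(sum ?q \<longlongrightarrow> (ell2_norm h f)\<^sup>2) (finite_subsets_at_top (scaled_lattice h))"
    unfolding ell2_norm_power2 using has_sum_infsum[OF s] by (simp only: has_sum_def)
  ultimately have "(\<lambda>j. sum ?q (F j)) \<longlonglongrightarrow> (ell2_norm h f)\<^sup>2"
    using filterlim_compose by blast
  then have "(\<lambda>j. (ell2_norm h f)\<^sup>2 - sum ?q (F j)) \<longlonglongrightarrow> (ell2_norm h f)\<^sup>2 - (ell2_norm h f)\<^sup>2"
    by (intro tendsto_intros)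
  then have "(\<lambda>j. sqrt ((ell2_norm h (\<lambda>k. if k \<in> F j then 0 else f k))\<^sup>2)) \<longlonglongrightarrow> sqrt 0"
    unfolding ell2_tail_power2[OF f F] by (intro tendsto_real_sqrt) simp
  then show ?thesis by simp
qed

text \<open>Completeness of ell2 in quantitative form. On a finite section the Cauchy bound passes
  to the coordinatewise limit in j, and e does not depend on the section.\<close>

lemma ell2_limit:
  assumes f: "\<And>i::nat. f i \<in> ell2 h" and lim: "\<And>k. (\<lambda>i. f i k) \<longlonglongrightarrow> u k"
    and c: "\<And>i j. i \<ge> M \<Longrightarrow> j \<ge> M \<Longrightarrow> ell2_norm h (\<lambda>k. f i k - f j k) \<le> e"
    and i: "i \<ge> M"
  shows "u \<in> ell2 h" "ell2_norm h (\<lambda>k. f i k - u k) \<le> e"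
proof -
  have *: "L2_set (\<lambda>k. cmod (f i k - u k)) F \<le> e" if F: "finite F" "F \<subseteq> scaled_lattice h" for F
  proof -
    have "(\<lambda>j. L2_set (\<lambda>k. cmod (f i k - f j k)) F) \<longlonglongrightarrow> L2_set (\<lambda>k. cmod (f i k - u k)) F"
      unfolding L2_set_def by (intro tendsto_intros lim)
    moreover have "L2_set (\<lambda>k. cmod (f i k - f j k)) F \<le> e" if "j \<ge> M" for j
      using L2_set_le_ell2_norm[OF ell2_diff(1)[OF f f] F] c[OF i that] order_trans by blast
    ultimately show ?thesis
      by (intro tendsto_upperbound[of _ _ sequentially]) (auto simp: eventually_sequentially)
  qed
  have u0: "u k = 0" if "k \<notin> scaled_lattice h" for k
    using ell2_zero_off[OF f that] lim[of k]
    by (simp add: LIMSEQ_const_iff)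
  have z: "f i k - u k = 0" if "k \<notin> scaled_lattice h" for k
    using ell2_zero_off[OF f that] u0[OF that] by simp
  have d: "(\<lambda>k. f i k - u k) \<in> ell2 h" by (rule ell2I(1)[OF z *])
  show "ell2_norm h (\<lambda>k. f i k - u k) \<le> e" by (rule ell2I(2)[OF z *])
  show "u \<in> ell2 h" using ell2_diff(1)[OF f[of i] d] by simp
qed

section \<open>Finite linear systems\<close>

text \<open>These are the summands of the Picard iteration rather than its iterates: each term is
  the Volterra operator of the system applied to the preceding one, and their sum is the solution
  (the Dyson series).\<close>

primrec picard_term :: "'a set \<Rightarrow> ('a \<Rightarrow> 'a \<Rightarrow> complex) \<Rightarrow> ('a \<Rightarrow> complex) \<Rightarrow> (real \<Rightarrow> 'a \<Rightarrow> complex)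
    \<Rightarrow> nat \<Rightarrow> real \<Rightarrow> 'a \<Rightarrow> complex" where
  "picard_term F B x0 \<phi> 0 t k = x0 k + integral {0..t} (\<lambda>s. \<phi> s k)"
| "picard_term F B x0 \<phi> (Suc n) t k = integral {0..t} (\<lambda>s. \<Sum>m\<in>F. B k m * picard_term F B x0 \<phi> n s m)"

lemma continuous_on_integral_upto:
  fixes f :: "real \<Rightarrow> complex"
  assumes "continuous_on {0..T} f"
  shows "continuous_on {0..T} (\<lambda>t. integral {0..t} f)"
  by (intro indefinite_integral_continuous_1 integrable_continuous_real assms)

lemma uniform_limit_sum:
  fixes f :: "'a \<Rightarrow> 'b \<Rightarrow> 'c \<Rightarrow> 'd::real_normed_vector"
  assumes "\<And>m. m \<in> I \<Longrightarrow> uniform_limit S (f m) (g m) F"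
  shows "uniform_limit S (\<lambda>n x. \<Sum>m\<in>I. f m n x) (\<lambda>x. \<Sum>m\<in>I. g m x) F"
  using assms
  by (induction I rule: infinite_finite_induct) (auto intro: uniform_limit_add uniform_limit_const)

text \<open>The n-th Picard term is of size \<open>M * (b * t) ^ n / fact n\<close>, so the series
  converges uniformly on all of [0,T], however large the entries of B are.\<close>

lemma linear_system_solution:
  fixes F :: "'a set" and B :: "'a \<Rightarrow> 'a \<Rightarrow> complex" and \<phi> :: "real \<Rightarrow> 'a \<Rightarrow> complex"
  assumes F: "finite F" and \<phi>: "\<And>k. k \<in> F \<Longrightarrow> continuous_on {0..T} (\<lambda>t. \<phi> t k)" and T: "0 \<le> T"
  obtains x where
    "\<And>k. k \<in> F \<Longrightarrow> x 0 k = x0 k"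
    "\<And>k t. k \<in> F \<Longrightarrow> t \<in> {0..T} \<Longrightarrow>
      ((\<lambda>s. x s k) has_vector_derivative ((\<Sum>m\<in>F. B k m * x t m) + \<phi> t k)) (at t within {0..T})"
proof -
  define y where "y = picard_term F B x0 \<phi>"
  have y0: "y 0 t k = x0 k + integral {0..t} (\<lambda>s. \<phi> s k)" for t k by (simp add: y_def)
  have ySuc: "y (Suc n) t k = integral {0..t} (\<lambda>s. \<Sum>m\<in>F. B k m * y n s m)" for n t k
    by (simp add: y_def)
  have cont: "continuous_on {0..T} (\<lambda>t. y n t k)" if "k \<in> F" for n k
    using that
  proof (induction n arbitrary: k)
    case 0
    then show ?case unfolding y0
      by (intro continuous_on_add continuous_on_const continuous_on_integral_upto \<phi>)
  next
    case (Suc n)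
    show ?case unfolding ySuc
      by (intro continuous_on_integral_upto continuous_on_sum continuous_on_mult
          continuous_on_const Suc.IH)
  qed
  have "\<exists>M. \<forall>k\<in>F. \<forall>t\<in>{0..T}. cmod (y 0 t k) \<le> M"
  proof -
    have "\<exists>M. \<forall>t\<in>{0..T}. cmod (y 0 t k) \<le> M" if "k \<in> F" for k
    proof -
      have "bounded ((\<lambda>t. y 0 t k) ` {0..T})"
        by (intro compact_imp_bounded compact_continuous_image cont[OF that] compact_Icc)
      then show ?thesis unfolding bounded_iff by auto
    qed
    then obtain M where M: "\<And>k t. k \<in> F \<Longrightarrow> t \<in> {0..T} \<Longrightarrow> cmod (y 0 t k) \<le> M k" by metis
    have "cmod (y 0 t k) \<le> (\<Sum>k\<in>F. \<bar>M k\<bar>)" if "k \<in> F" "t \<in> {0..T}" for k t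
    proof -
      have "cmod (y 0 t k) \<le> \<bar>M k\<bar>" using M[OF that] by linarith
      also have "\<dots> \<le> (\<Sum>k\<in>F. \<bar>M k\<bar>)" by (rule member_le_sum) (use F that in auto)
      finally show ?thesis .
    qed
    then show ?thesis by blast
  qed
  then obtain M where M: "\<And>k t. k \<in> F \<Longrightarrow> t \<in> {0..T} \<Longrightarrow> cmod (y 0 t k) \<le> M" by blast
  define b where "b = (\<Sum>k\<in>F. \<Sum>m\<in>F. cmod (B k m))"
  have b0: "0 \<le> b" by (simp add: b_def sum_nonneg)
  have b: "(\<Sum>m\<in>F. cmod (B k m)) \<le> b" if "k \<in> F" for k
    unfolding b_def by (rule member_le_sum[where f = "\<lambda>k. \<Sum>m\<in>F. cmod (B k m)"]) (use that F in \<open>auto intro: sum_nonneg\<close>)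
  have bound: "cmod (y n t k) \<le> M * (b * t) ^ n / fact n" if "k \<in> F" "t \<in> {0..T}" for n t k
    using that
  proof (induction n arbitrary: t k)
    case 0
    then show ?case using M by simp
  next
    case (Suc n)
    have sub: "{0..t} \<subseteq> {0..T}" using Suc.prems by auto
    have "((\<lambda>s. M * b ^ Suc n / fact n * s ^ n) has_integral
        M * b ^ Suc n / fact n * (t ^ Suc n / Suc n - 0 ^ Suc n / Suc n)) {0..t}"
    proof (rule has_integral_mult_right, rule fundamental_theorem_of_calculus)
      fix s assume "s \<in> {0..t}"
      show "((\<lambda>s. s ^ Suc n / real (Suc n)) has_vector_derivative s ^ n) (at s within {0..t})"
        unfolding has_real_derivative_iff_has_vector_derivative[symmetric]
        using DERIV_cdivide[OF DERIV_pow[of "Suc n" s "{0..t}"], of "real (Suc n)"] by (simp del: of_nat_Suc)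
    qed (use Suc.prems in auto)
    then have I: "((\<lambda>s. M * b ^ Suc n / fact n * s ^ n) has_integral M * (b * t) ^ Suc n / fact (Suc n)) {0..t}"
      by (simp add: power_mult_distrib field_simps)
    have "cmod (y (Suc n) t k) \<le> integral {0..t} (\<lambda>s. M * b ^ Suc n / fact n * s ^ n)"
      unfolding ySuc
    proof (rule integral_norm_bound_integral)
      show "(\<lambda>s. \<Sum>m\<in>F. B k m * y n s m) integrable_on {0..t}"
        by (intro integrable_continuous_real continuous_on_subset[OF _ sub] continuous_on_sum
            continuous_on_mult continuous_on_const cont)
      show "(\<lambda>s. M * b ^ Suc n / fact n * s ^ n) integrable_on {0..t}" using I by blast
      fix s assume s: "s \<in> {0..t}"
      have "cmod (\<Sum>m\<in>F. B k m * y n s m) \<le> (\<Sum>m\<in>F. cmod (B k m) * (M * (b * s) ^ n / fact n))"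
      proof (rule order_trans[OF norm_sum], rule sum_mono)
        fix m assume m: "m \<in> F"
        have "cmod (y n s m) \<le> M * (b * s) ^ n / fact n" using Suc.IH[OF m] s sub by blast
        then show "cmod (B k m * y n s m) \<le> cmod (B k m) * (M * (b * s) ^ n / fact n)"
          unfolding norm_mult by (rule mult_left_mono) simp
      qed
      also have "\<dots> = (\<Sum>m\<in>F. cmod (B k m)) * (M * (b * s) ^ n / fact n)"
        by (rule sum_distrib_right[symmetric])
      also have "\<dots> \<le> b * (M * (b * s) ^ n / fact n)"
      proof (rule mult_right_mono[OF b[OF Suc.prems(1)]])
        have "0 \<le> cmod (y n s k)" by simp
        also have "\<dots> \<le> M * (b * s) ^ n / fact n" using Suc.IH[OF Suc.prems(1)] s sub by blast
        finally show "0 \<le> M * (b * s) ^ n / fact n" .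
      qed
      finally show "cmod (\<Sum>m\<in>F. B k m * y n s m) \<le> M * b ^ Suc n / fact n * s ^ n"
        by (simp add: power_mult_distrib mult_ac)
    qed
    then show ?case using I by (simp only: integral_unique)
  qed
  define x where "x t k = (\<Sum>n. y n t k)" for t k
  have ulim: "uniform_limit {0..T} (\<lambda>n t. \<Sum>i<n. y i t k) (\<lambda>t. x t k) sequentially" if k: "k \<in> F" for k
    unfolding x_def
  proof (rule Weierstrass_m_test)
    have "(\<lambda>n. (b * T) ^ n /\<^sub>R fact n) sums exp (b * T)" by (rule exp_converges)
    then have "summable (\<lambda>n. (b * T) ^ n /\<^sub>R fact n)" by (simp add: sums_iff)
    then have "summable (\<lambda>n. M * ((b * T) ^ n /\<^sub>R fact n))" by (rule summable_mult)
    then show "summable (\<lambda>n. M * (b * T) ^ n / fact n)" by (simp add: field_simps)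
    fix n t assume t: "t \<in> {0..T}"
    have "0 \<le> cmod (y 0 t k)" by simp
    also have "\<dots> \<le> M" using M k t by blast
    finally have M0: "0 \<le> M" .
    have "cmod (y n t k) \<le> M * (b * t) ^ n / fact n" using bound k t by blast
    also have "\<dots> \<le> M * (b * T) ^ n / fact n"
      using t b0 M0 by (intro divide_right_mono mult_left_mono power_mono) auto
    finally show "cmod (y n t k) \<le> M * (b * T) ^ n / fact n" .
  qed
  have xcont: "continuous_on {0..T} (\<lambda>t. x t k)" if "k \<in> F" for k
    by (rule uniform_limit_theorem[OF _ ulim[OF that]])
      (auto intro!: always_eventually continuous_on_sum cont[OF that])
  have eq: "x t k = x0 k + integral {0..t} (\<lambda>s. (\<Sum>m\<in>F. B k m * x s m) + \<phi> s k)"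
    if k: "k \<in> F" and t: "t \<in> {0..T}" for k t
  proof -
    have sub: "{0..t} \<subseteq> {0..T}" using t by auto
    let ?S = "\<lambda>n s. \<Sum>m\<in>F. B k m * (\<Sum>i<n. y i s m)"
    have c: "continuous_on {0..t} (?S n)" for n
      by (intro continuous_on_sum continuous_on_mult continuous_on_const
          continuous_on_subset[OF cont sub])
    have "uniform_limit {0..t} ?S (\<lambda>s. \<Sum>m\<in>F. B k m * x s m) sequentially"
      by (intro uniform_limit_sum bounded_linear.uniform_limit[OF bounded_linear_mult_right]
          uniform_limit_on_subset[OF ulim sub])
    then obtain I J where I: "\<And>n. (?S n has_integral I n) {0..t}"
      and J: "((\<lambda>s. \<Sum>m\<in>F. B k m * x s m) has_integral J) {0..t}" and IJ: "I \<longlonglongrightarrow> J"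
      by (rule uniform_limit_integral[OF _ c]) auto
    \<comment> \<open>The partial sums satisfy the integral equation up to a shift of the index by
      one, which disappears in the limit.\<close>
    have "(\<Sum>i<Suc n. y i t k) = y 0 t k + I n" for n
    proof -
      have "(\<Sum>i<Suc n. y i t k) = y 0 t k + (\<Sum>i<n. y (Suc i) t k)"
        by (rule sum.lessThan_Suc_shift)
      also have "(\<Sum>i<n. y (Suc i) t k) = integral {0..t} (\<lambda>s. \<Sum>i<n. \<Sum>m\<in>F. B k m * y i s m)"
        unfolding ySuc
        by (rule integral_sum[symmetric])
          (auto intro!: integrable_continuous_real continuous_on_sum continuous_on_mult
            continuous_on_const continuous_on_subset[OF cont sub])
      also have "(\<lambda>s. \<Sum>i<n. \<Sum>m\<in>F. B k m * y i s m) = ?S n"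
        by (subst sum.swap) (simp add: sum_distrib_left)
      also have "integral {0..t} (?S n) = I n" using I by blast
      finally show ?thesis .
    qed
    then have "(\<lambda>n. \<Sum>i<Suc n. y i t k) \<longlonglongrightarrow> y 0 t k + J"
      by (simp only:) (intro tendsto_intros IJ)
    moreover have "(\<lambda>n. \<Sum>i<Suc n. y i t k) \<longlonglongrightarrow> x t k"
      by (rule LIMSEQ_Suc) (rule tendsto_uniform_limitI[OF ulim[OF k] t])
    ultimately have "x t k = y 0 t k + J" using LIMSEQ_unique by blast
    also have "\<dots> = x0 k + (integral {0..t} (\<lambda>s. \<phi> s k) + integral {0..t} (\<lambda>s. \<Sum>m\<in>F. B k m * x s m))"
      using integral_unique[OF J] by (simp add: y0)
    also have "integral {0..t} (\<lambda>s. \<phi> s k) + integral {0..t} (\<lambda>s. \<Sum>m\<in>F. B k m * x s m)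
      = integral {0..t} (\<lambda>s. (\<Sum>m\<in>F. B k m * x s m) + \<phi> s k)"
      using integral_add[OF _ has_integral_integrable[OF J], of "\<lambda>s. \<phi> s k"]
        integrable_continuous_real[OF continuous_on_subset[OF \<phi>[OF k] sub]] by (simp add: add.commute)
    finally show ?thesis .
  qed
  show ?thesis
  proof
    show "x 0 k = x0 k" if "k \<in> F" for k using eq[OF that, of 0] T by simp
    fix k t assume k: "k \<in> F" and t: "t \<in> {0..T}"
    have "continuous_on {0..T} (\<lambda>s. (\<Sum>m\<in>F. B k m * x s m) + \<phi> s k)"
      by (intro continuous_on_add continuous_on_sum continuous_on_mult continuous_on_const xcont \<phi> k)
    then have "((\<lambda>t. x0 k + integral {0..t} (\<lambda>s. (\<Sum>m\<in>F. B k m * x s m) + \<phi> s k)) has_vector_derivative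
        ((\<Sum>m\<in>F. B k m * x t m) + \<phi> t k)) (at t within {0..T})"
      using integral_has_vector_derivative[OF _ t] has_vector_derivative_add[OF has_vector_derivative_const]
      by fastforce
    then show "((\<lambda>s. x s k) has_vector_derivative ((\<Sum>m\<in>F. B k m * x t m) + \<phi> t k)) (at t within {0..T})"
      by (rule has_vector_derivative_transform[OF t, rotated]) (use eq k in auto)
  qed
qed

text \<open>The square root of the energy need not be differentiable where the energy vanishes; adding
  \<open>\<epsilon>\<^sup>2\<close> under the root removes this obstacle.\<close>

lemma weighted_energy_bound:
  fixes v :: "real \<Rightarrow> 'a \<Rightarrow> complex" and \<omega> :: "'a \<Rightarrow> real"
  assumes F: "finite F" and \<omega>: "\<And>k. 0 \<le> \<omega> k" and C: "0 \<le> C"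
    and dissipative: "\<And>u. (\<Sum>k\<in>F. (\<omega> k)\<^sup>2 * Re (cnj (u k) * (\<Sum>m\<in>F. A k m * u m)))
        \<le> C * (\<Sum>k\<in>F. (\<omega> k)\<^sup>2 * (cmod (u k))\<^sup>2)"
    and v: "\<And>k t. k \<in> F \<Longrightarrow> t \<in> {0..T} \<Longrightarrow>
      ((\<lambda>s. v s k) has_vector_derivative ((\<Sum>m\<in>F. A k m * v t m) + \<phi> t k)) (at t within {0..T})"
    and b: "continuous_on {0..T} b" "\<And>t. t \<in> {0..T} \<Longrightarrow> L2_set (\<lambda>k. \<omega> k * cmod (\<phi> t k)) F \<le> b t"
    and t: "t \<in> {0..T}"
  shows "L2_set (\<lambda>k. \<omega> k * cmod (v t k)) F
    \<le> exp (C * T) * (L2_set (\<lambda>k. \<omega> k * cmod (v 0 k)) F + integral {0..t} b)"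
proof -
  define E where "E s = (\<Sum>k\<in>F. (\<omega> k)\<^sup>2 * (cmod (v s k))\<^sup>2)" for s
  define E' where "E' s = (\<Sum>k\<in>F. (\<omega> k)\<^sup>2 * (2 * Re (cnj (v s k) * ((\<Sum>m\<in>F. A k m * v s m) + \<phi> s k))))" for s
  have E0: "0 \<le> E s" for s by (simp add: E_def sum_nonneg)
  have sqrtE: "sqrt (E s) = L2_set (\<lambda>k. \<omega> k * cmod (v s k)) F" for s
    by (simp add: E_def L2_set_def power_mult_distrib)
  have b0: "0 \<le> b s" if "s \<in> {0..T}" for s using b(2)[OF that] L2_set_nonneg order_trans by blast
  have dE: "(E has_real_derivative E' s) (at s within {0..T})" if s: "s \<in> {0..T}" for s
  proof -
    have "((\<lambda>s. (cmod (v s k))\<^sup>2) has_real_derivative 2 * Re (cnj (v s k) * ((\<Sum>m\<in>F. A k m * v s m) + \<phi> s k)))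
        (at s within {0..T})" if k: "k \<in> F" for k
    proof -
      let ?d = "(\<Sum>m\<in>F. A k m * v s m) + \<phi> s k"
      have re: "((\<lambda>s. Re (v s k)) has_real_derivative Re ?d) (at s within {0..T})"
        and im: "((\<lambda>s. Im (v s k)) has_real_derivative Im ?d) (at s within {0..T})"
        using v[OF k s] unfolding has_vector_derivative_complex_iff by auto
      have "((\<lambda>s. (Re (v s k))\<^sup>2 + (Im (v s k))\<^sup>2) has_real_derivative
          2 * Re (cnj (v s k) * ?d)) (at s within {0..T})"
        by (rule derivative_eq_intros re im refl)+ (simp add: algebra_simps)
      then show ?thesis by (simp add: cmod_power2)
    qed
    then show ?thesis unfolding E_def E'_def
      by (intro DERIV_sum DERIV_cmult) auto
  qed
  have E'le: "E' s \<le> 2 * C * E s + 2 * (sqrt (E s) * b s)" if s: "s \<in> {0..T}" for s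
  proof -
    have "(\<Sum>k\<in>F. (\<omega> k)\<^sup>2 * Re (cnj (v s k) * \<phi> s k)) \<le> (\<Sum>k\<in>F. \<bar>\<omega> k * cmod (v s k)\<bar> * \<bar>\<omega> k * cmod (\<phi> s k)\<bar>)"
    proof (rule sum_mono)
      fix k assume "k \<in> F"
      have "Re (cnj (v s k) * \<phi> s k) \<le> cmod (v s k) * cmod (\<phi> s k)"
        using complex_Re_le_cmod[of "cnj (v s k) * \<phi> s k"] by (simp add: norm_mult)
      then have "(\<omega> k)\<^sup>2 * Re (cnj (v s k) * \<phi> s k) \<le> (\<omega> k)\<^sup>2 * (cmod (v s k) * cmod (\<phi> s k))"
        by (intro mult_left_mono) auto
      also have "\<dots> = \<bar>\<omega> k * cmod (v s k)\<bar> * \<bar>\<omega> k * cmod (\<phi> s k)\<bar>"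
        using \<omega>[of k] by (simp add: abs_mult power2_eq_square mult_ac)
      finally show "(\<omega> k)\<^sup>2 * Re (cnj (v s k) * \<phi> s k) \<le> \<bar>\<omega> k * cmod (v s k)\<bar> * \<bar>\<omega> k * cmod (\<phi> s k)\<bar>" .
    qed
    also have "\<dots> \<le> sqrt (E s) * L2_set (\<lambda>k. \<omega> k * cmod (\<phi> s k)) F"
      unfolding sqrtE by (rule L2_set_mult_ineq)
    also have "\<dots> \<le> sqrt (E s) * b s"
      by (intro mult_left_mono b(2)[OF s]) (simp add: E0)
    finally have 1: "(\<Sum>k\<in>F. (\<omega> k)\<^sup>2 * Re (cnj (v s k) * \<phi> s k)) \<le> sqrt (E s) * b s" .
    have "E' s = 2 * (\<Sum>k\<in>F. (\<omega> k)\<^sup>2 * Re (cnj (v s k) * (\<Sum>m\<in>F. A k m * v s m)))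
        + 2 * (\<Sum>k\<in>F. (\<omega> k)\<^sup>2 * Re (cnj (v s k) * \<phi> s k))"
      by (simp only: E'_def sum_distrib_left sum.distrib[symmetric] distrib_left plus_complex.sel)
        (simp add: algebra_simps)
    then show ?thesis using 1 dissipative[of "v s"] by (simp add: E_def)
  qed
  have main: "exp (- C * t) * sqrt (E t + \<epsilon>\<^sup>2) \<le> sqrt (E 0 + \<epsilon>\<^sup>2) + integral {0..t} b" if \<epsilon>: "0 < \<epsilon>" for \<epsilon>
  proof -
    \<comment> \<open>Gronwall's lemma as monotonicity: the exponential cancels the growth rate C,
      and the subtracted integral pays for the forcing, because \<open>exp (- C * s) * b s\<close>
      is at most \<open>b s\<close>.\<close>
    define \<psi> where "\<psi> s = exp (- C * s) * sqrt (E s + \<epsilon>\<^sup>2) - integral {0..s} b" for s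
    have pos: "0 < E s + \<epsilon>\<^sup>2" for s using E0[of s] \<epsilon> by (simp add: add_nonneg_pos)
    have d\<psi>: "(\<psi> has_real_derivative
        (exp (- C * s) * (E' s / (2 * sqrt (E s + \<epsilon>\<^sup>2)) - C * sqrt (E s + \<epsilon>\<^sup>2)) - b s)) (at s within {0..T})"
      if s: "s \<in> {0..T}" for s
    proof -
      have ib: "((\<lambda>s. integral {0..s} b) has_real_derivative b s) (at s within {0..T})"
        using integral_has_real_derivative[OF b(1) s] .
      have sq: "((\<lambda>s. sqrt (E s + \<epsilon>\<^sup>2)) has_real_derivative E' s / (2 * sqrt (E s + \<epsilon>\<^sup>2))) (at s within {0..T})"
        using pos[of s] by (auto intro!: derivative_eq_intros dE[OF s] simp: field_simps)
      have ex: "((\<lambda>s. exp (- C * s)) has_real_derivative exp (- C * s) * (- C)) (at s within {0..T})"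
        by (auto intro!: derivative_eq_intros)
      show ?thesis unfolding \<psi>_def
        by (rule DERIV_cong[OF DERIV_diff[OF DERIV_mult[OF ex sq] ib]]) (simp add: algebra_simps)
    qed
    have "\<psi> t \<le> \<psi> 0"
    proof (rule DERIV_nonpos_imp_decreasing_open[where f = \<psi> and a = 0 and b = t])
      show "0 \<le> t" using t by simp
      show "continuous_on {0..t} \<psi>"
        using continuous_on_subset[OF DERIV_continuous_on[OF d\<psi>], of "{0..t}"] t by auto
      fix s assume s: "0 < s" "s < t"
      then have sT: "s \<in> {0..T}" "s \<in> interior {0..T}" using t by auto
      let ?y = "sqrt (E s + \<epsilon>\<^sup>2)"
      have y: "0 < ?y" "?y\<^sup>2 = E s + \<epsilon>\<^sup>2" "sqrt (E s) \<le> ?y" using pos[of s] by auto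
      have "E' s \<le> 2 * C * ?y\<^sup>2 + 2 * (?y * b s)"
      proof -
        have "E s \<le> ?y\<^sup>2" using y(2) by simp
        then have "2 * C * E s \<le> 2 * C * ?y\<^sup>2" using C by (intro mult_left_mono) auto
        moreover have "sqrt (E s) * b s \<le> ?y * b s" using y(3) b0[OF sT(1)] by (rule mult_right_mono)
        ultimately show ?thesis using E'le[OF sT(1)] by linarith
      qed
      then have "E' s / (2 * ?y) \<le> C * ?y + b s"
        using y(1) by (simp add: field_simps power2_eq_square)
      then have "E' s / (2 * ?y) - C * ?y \<le> b s" by simp
      then have "exp (- C * s) * (E' s / (2 * ?y) - C * ?y) \<le> exp (- C * s) * b s"
        by (rule mult_left_mono) simp
      also have "\<dots> \<le> b s" using C s b0[OF sT(1)] by (simp add: mult_left_le_one_le)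
      finally have "exp (- C * s) * (E' s / (2 * ?y) - C * ?y) - b s \<le> 0" by simp
      moreover have "at s within {0..T} = at s" using at_within_interior sT by blast
      ultimately show "\<exists>y. (\<psi> has_real_derivative y) (at s) \<and> y \<le> 0" using d\<psi>[OF sT(1)] by metis
    qed
    then show ?thesis by (simp add: \<psi>_def)
  qed
  have "((\<lambda>\<epsilon>. exp (- C * t) * sqrt (E t + \<epsilon>\<^sup>2)) \<longlongrightarrow> exp (- C * t) * sqrt (E t + 0\<^sup>2)) (at_right 0)"
    "((\<lambda>\<epsilon>. sqrt (E 0 + \<epsilon>\<^sup>2) + integral {0..t} b) \<longlongrightarrow> sqrt (E 0 + 0\<^sup>2) + integral {0..t} b) (at_right 0)"
    by (intro tendsto_intros)+
  note lims = this
  have "exp (- C * t) * sqrt (E t + 0\<^sup>2) \<le> sqrt (E 0 + 0\<^sup>2) + integral {0..t} b"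
    by (rule tendsto_le[OF trivial_limit_at_right_real lims(2,1)])
      (rule eventually_at_rightI[of 0 1], use main in auto)
  then have "sqrt (E t) \<le> exp (C * t) * (sqrt (E 0) + integral {0..t} b)"
    by (simp add: exp_minus field_simps)
  also have "\<dots> \<le> exp (C * T) * (sqrt (E 0) + integral {0..t} b)"
  proof (rule mult_right_mono)
    have "0 \<le> integral {0..t} b"
    proof (rule integral_nonneg)
      show "b integrable_on {0..t}"
        by (rule integrable_continuous_real[OF continuous_on_subset[OF b(1)]]) (use t in auto)
      show "0 \<le> b s" if "s \<in> {0..t}" for s using b0 that t by auto
    qed
    then show "0 \<le> sqrt (E 0) + integral {0..t} b" using E0 by simp
    show "exp (C * t) \<le> exp (C * T)" using t C by (simp add: mult_left_mono)
  qed
  finally show ?thesis by (simp add: sqrtE)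
qed

section \<open>Parabolic kernels\<close>

text \<open>The weight of \<open>symbol_class\<close>. It is comparable to the usual square root of
  1 + |k|^2, but satisfies Peetre's inequality with constant 1.\<close>

definition bracket :: "'a::real_normed_vector \<Rightarrow> real" where
  "bracket k = 1 + norm k"

lemma bracket_ge_1 [simp]: "1 \<le> bracket k" by (simp add: bracket_def)

lemma bracket_pos [simp]: "0 < bracket k" using bracket_ge_1[of k] by linarith

lemma bracket_nonzero [simp]: "bracket k \<noteq> 0" using bracket_pos[of k] by linarith

lemma finite_lattice_ball:
  fixes h :: real
  assumes h: "0 < h"
  shows "finite {k \<in> (scaled_lattice h :: (real^'n) set). norm k \<le> R}"
proof -
  define K where "K = \<lceil>R / h\<rceil>"
  have "finite (PiE (UNIV :: 'n set) (\<lambda>_. {-K..K}))" by (intro finite_PiE) auto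
  then have fin: "finite {m :: int^'n. vec_nth m \<in> PiE UNIV (\<lambda>_. {-K..K})}"
    using finite_vimageI[of _ "vec_nth :: int^'n \<Rightarrow> _"] by (simp add: vimage_def inj_def vec_eq_iff fun_eq_iff)
  have "{k \<in> scaled_lattice h. norm k \<le> R}
      \<subseteq> (\<lambda>m::int^'n. h *\<^sub>R (\<chi> j. of_int (m $ j))) ` {m. vec_nth m \<in> PiE UNIV (\<lambda>_. {-K..K})}"
  proof
    fix k :: "real^'n" assume k: "k \<in> {k \<in> scaled_lattice h. norm k \<le> R}"
    then obtain m :: "int^'n" where m: "k = h *\<^sub>R (\<chi> j. of_int (m $ j))" unfolding scaled_lattice_def by auto
    have "m $ j \<in> {-K..K}" for j
    proof -
      have "\<bar>k $ j\<bar> \<le> R" using component_le_norm_cart[of k j] k by auto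
      then have "h * \<bar>real_of_int (m $ j)\<bar> \<le> R" using h by (simp add: m abs_mult)
      then have "\<bar>real_of_int (m $ j)\<bar> \<le> R / h" using h by (simp add: field_simps)
      then have "\<bar>m $ j\<bar> \<le> K" unfolding K_def by linarith
      then show ?thesis by auto
    qed
    then show "k \<in> (\<lambda>m::int^'n. h *\<^sub>R (\<chi> j. of_int (m $ j))) ` {m. vec_nth m \<in> PiE UNIV (\<lambda>_. {-K..K})}"
      using m by auto
  qed
  then show ?thesis using finite_subset finite_imageI[OF fin] by blast
qed

lemma L2_set_support_le:
  assumes "finite F" "finite F0" "\<And>k. k \<in> F \<Longrightarrow> k \<notin> F0 \<Longrightarrow> f k = 0"
  shows "L2_set f F \<le> L2_set f F0"
proof -
  have "(\<Sum>k\<in>F. (f k)\<^sup>2) = (\<Sum>k\<in>F \<inter> F0. (f k)\<^sup>2)"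
    by (rule sum.mono_neutral_right) (use assms in auto)
  also have "\<dots> \<le> (\<Sum>k\<in>F0. (f k)\<^sup>2)" by (rule sum_mono2) (use assms in auto)
  finally show ?thesis by (simp add: L2_set_def)
qed

section \<open>Norm continuous curves in ell2 and their uniform limits\<close>

lemma continuous_ell2_uniform_limit:
  assumes V: "\<And>n::nat. n \<ge> N \<Longrightarrow> continuous_ell2 h T (V n)"
    and W: "\<And>t. t \<in> {0..T} \<Longrightarrow> W t \<in> ell2 h"
    and lim: "\<And>n t. n \<ge> N \<Longrightarrow> t \<in> {0..T} \<Longrightarrow> ell2_norm h (\<lambda>k. V n t k - W t k) \<le> e n"
    and e: "e \<longlonglongrightarrow> (0::real)"
  shows "continuous_ell2 h T W"
  unfolding continuous_ell2_def
proof (intro conjI ballI W)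
  fix t assume t: "t \<in> {0..T}"
  show "((\<lambda>s. ell2_norm h (\<lambda>k. W s k - W t k)) \<longlongrightarrow> 0) (at t within {0..T})"
  proof (rule tendstoI)
    fix \<epsilon> :: real assume "0 < \<epsilon>"
    then have "\<forall>\<^sub>F n in sequentially. e n < \<epsilon> / 3 \<and> n \<ge> N"
      by (intro eventually_conj order_tendstoD(2)[OF e] eventually_ge_at_top) simp
    then obtain n where n: "e n < \<epsilon> / 3" "n \<ge> N" using eventually_happens' sequentially_bot by blast
    have Vn: "s \<in> {0..T} \<Longrightarrow> V n s \<in> ell2 h" for s using V[OF n(2)] by (auto simp: continuous_ell2_def)
    have "((\<lambda>s. ell2_norm h (\<lambda>k. V n s k - V n t k)) \<longlongrightarrow> 0) (at t within {0..T})"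
      using V[OF n(2)] t by (auto simp: continuous_ell2_def)
    then have "\<forall>\<^sub>F s in at t within {0..T}. ell2_norm h (\<lambda>k. V n s k - V n t k) < \<epsilon> / 3"
      using \<open>0 < \<epsilon>\<close> by (intro order_tendstoD(2)) auto
    moreover have "\<forall>\<^sub>F s in at t within {0..T}. s \<in> {0..T}"
      by (simp add: eventually_at_topological) blast
    ultimately show "\<forall>\<^sub>F s in at t within {0..T}. dist (ell2_norm h (\<lambda>k. W s k - W t k)) 0 < \<epsilon>"
    proof eventually_elim
      case (elim s)
      have "ell2_norm h (\<lambda>k. W s k - W t k) \<le> ell2_norm h (\<lambda>k. W s k - V n s k) + ell2_norm h (\<lambda>k. V n s k - W t k)"
        by (rule ell2_norm_diff_triangle[OF W Vn W]) (use elim t in auto)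
      also have "ell2_norm h (\<lambda>k. V n s k - W t k) \<le> ell2_norm h (\<lambda>k. V n s k - V n t k) + ell2_norm h (\<lambda>k. V n t k - W t k)"
        by (rule ell2_norm_diff_triangle[OF Vn Vn W]) (use elim t in auto)
      finally show ?case
        using lim[OF n(2) elim(2)] lim[OF n(2) t] elim n(1)
        by (simp add: ell2_norm_diff_commute[of h "W s"] dist_real_def)
    qed
  qed
qed

text \<open>Completeness of C([0,T], ell2). The limit inherits the rate e, so that estimates for the
  approximations pass to it with an explicit error.\<close>

lemma uniformly_cauchy_ell2_limit:
  assumes V: "\<And>n. continuous_ell2 h T (V n)"
    and close: "\<And>n i j t. N \<le> n \<Longrightarrow> n \<le> i \<Longrightarrow> n \<le> j \<Longrightarrow> t \<in> {0..T} \<Longrightarrow> ell2_norm h (\<lambda>k. V i t k - V j t k) \<le> e n"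
    and e: "e \<longlonglongrightarrow> (0::real)"
  shows "\<exists>W. continuous_ell2 h T W \<and> (\<forall>n\<ge>N. \<forall>t\<in>{0..T}. ell2_norm h (\<lambda>k. V n t k - W t k) \<le> e n)"
proof -
  have VE: "V n t \<in> ell2 h" if "t \<in> {0..T}" for n t using V that by (auto simp: continuous_ell2_def)
  have "\<exists>l. (\<lambda>n. V n t k) \<longlonglongrightarrow> l" if t: "t \<in> {0..T}" for t k
  proof -
    have "Cauchy (\<lambda>n. V n t k)"
    proof (rule metric_CauchyI)
      fix \<epsilon> :: real assume \<epsilon>: "0 < \<epsilon>"
      have "\<forall>\<^sub>F n in sequentially. e n < \<epsilon> \<and> N \<le> n"
        by (intro eventually_conj order_tendstoD(2)[OF e \<epsilon>] eventually_ge_at_top)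
      then obtain n where n: "e n < \<epsilon>" "N \<le> n" using eventually_happens' sequentially_bot by blast
      show "\<exists>M. \<forall>m\<ge>M. \<forall>n\<ge>M. dist (V m t k) (V n t k) < \<epsilon>"
      proof (intro exI allI impI)
        fix i j assume "n \<le> i" "n \<le> j"
        then show "dist (V i t k) (V j t k) < \<epsilon>"
          using cmod_le_ell2_norm[OF ell2_diff(1)[OF VE[OF t, of i] VE[OF t, of j]], of k] close[OF n(2) _ _ t, of i j] n(1)
          by (simp add: dist_norm)
      qed
    qed
    then show ?thesis by (simp add: Cauchy_convergent_iff convergent_def)
  qed
  then obtain W where W: "\<And>t k. t \<in> {0..T} \<Longrightarrow> (\<lambda>n. V n t k) \<longlonglongrightarrow> W t k" by metis
  have WE: "W t \<in> ell2 h" if "t \<in> {0..T}" for t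
    by (rule ell2_limit(1)[OF VE[OF that] W[OF that] close[OF order_refl _ _ that] order_refl])
  have closeW: "ell2_norm h (\<lambda>k. V n t k - W t k) \<le> e n" if "N \<le> n" "t \<in> {0..T}" for t n
    by (rule ell2_limit(2)[OF VE[OF that(2)] W[OF that(2)] close[OF that(1) _ _ that(2)] order_refl])
  have "continuous_ell2 h T W" by (rule continuous_ell2_uniform_limit[OF V WE closeW e])
  then show ?thesis using closeW by blast
qed

lemma continuous_ell2_norm:
  assumes "continuous_ell2 h T w"
  shows "continuous_on {0..T} (\<lambda>t. ell2_norm h (w t))"
  unfolding continuous_on_def
proof
  fix t assume t: "t \<in> {0..T}"
  have ell: "s \<in> {0..T} \<Longrightarrow> w s \<in> ell2 h" for s using assms by (auto simp: continuous_ell2_def)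
  have "((\<lambda>s. ell2_norm h (w s) - ell2_norm h (w t)) \<longlongrightarrow> 0) (at t within {0..T})"
  proof (rule Lim_null_comparison)
    show "((\<lambda>s. ell2_norm h (\<lambda>k. w s k - w t k)) \<longlongrightarrow> 0) (at t within {0..T})"
      using assms t by (auto simp: continuous_ell2_def)
    show "\<forall>\<^sub>F s in at t within {0..T}. norm (ell2_norm h (w s) - ell2_norm h (w t)) \<le> ell2_norm h (\<lambda>k. w s k - w t k)"
      using ell2_norm_reverse_triangle[OF ell ell[OF t]]
      by (auto simp: eventually_at_topological)
  qed
  then show "((\<lambda>s. ell2_norm h (w s)) \<longlongrightarrow> ell2_norm h (w t)) (at t within {0..T})" by (rule LIM_zero_cancel)
qed

lemma continuous_ell2_finite_support:
  assumes F: "finite F" "F \<subseteq> scaled_lattice h"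
    and z: "\<And>t k. t \<in> {0..T} \<Longrightarrow> k \<notin> F \<Longrightarrow> w t k = 0" and c: "\<And>k. k \<in> F \<Longrightarrow> continuous_on {0..T} (\<lambda>t. w t k)"
  shows "continuous_ell2 h T w"
  unfolding continuous_ell2_def
proof (intro conjI ballI)
  fix t assume t: "t \<in> {0..T}"
  show "w t \<in> ell2 h" by (rule ell2_finite_support(1)[OF F z[OF t]])
  have "((\<lambda>s. L2_set (\<lambda>k. cmod (w s k - w t k)) F) \<longlongrightarrow> L2_set (\<lambda>k. cmod (w t k - w t k)) F) (at t within {0..T})"
    unfolding L2_set_def
    by (intro tendsto_intros) (use c t in \<open>auto simp: continuous_on_def\<close>)
  then have "((\<lambda>s. L2_set (\<lambda>k. cmod (w s k - w t k)) F) \<longlongrightarrow> 0) (at t within {0..T})"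
    by (simp add: L2_set_0')
  moreover have "\<forall>\<^sub>F s in at t within {0..T}. L2_set (\<lambda>k. cmod (w s k - w t k)) F = ell2_norm h (\<lambda>k. w s k - w t k)"
  proof -
    have "ell2_norm h (\<lambda>k. w s k - w t k) = L2_set (\<lambda>k. cmod (w s k - w t k)) F" if "s \<in> {0..T}" for s
      by (rule ell2_finite_support(2)[OF F]) (use z that t in auto)
    then show ?thesis by (auto simp: eventually_at_topological)
  qed
  ultimately show "((\<lambda>s. ell2_norm h (\<lambda>k. w s k - w t k)) \<longlongrightarrow> 0) (at t within {0..T})"
    by (rule Lim_transform_eventually)
qed

text \<open>This is all that the solution theory uses of the operator; in the application p is r +
  1. For an operator of order r, \<open>gain\<close> and \<open>loss\<close> both have one power of
  \<open>bracket\<close> to spare, which becomes a factor 1/n at radius n: \<open>gain\<close>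
  measures what leaves a ball (existence), \<open>loss\<close> what enters it (uniqueness). Finite
  sums keep the assumptions free of convergence questions.\<close>

locale parabolic_kernel =
  fixes h T p S :: real and A :: "real^'n \<Rightarrow> real^'n \<Rightarrow> complex"
  assumes h_pos: "0 < h" and T_pos: "0 < T" and S_nonneg: "0 \<le> S"
    and gain: "\<And>G F u. finite G \<Longrightarrow> finite F \<Longrightarrow> G \<subseteq> scaled_lattice h \<Longrightarrow> F \<subseteq> scaled_lattice h \<Longrightarrow>
      L2_set (\<lambda>k. bracket k * cmod (\<Sum>m\<in>F. A k m * u m)) G
        \<le> S * L2_set (\<lambda>m. bracket m powr p * cmod (u m)) F"
    and loss: "\<And>G F u. finite G \<Longrightarrow> finite F \<Longrightarrow> G \<subseteq> scaled_lattice h \<Longrightarrow> F \<subseteq> scaled_lattice h \<Longrightarrow>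
      L2_set (\<lambda>k. bracket k powr - p * cmod (\<Sum>m\<in>F. A k m * u m)) G
        \<le> S * L2_set (\<lambda>m. cmod (u m) / bracket m) F"
    and garding: "\<And>q. \<exists>C\<ge>0. \<forall>F u. finite F \<longrightarrow> F \<subseteq> scaled_lattice h \<longrightarrow>
      (\<Sum>k\<in>F. (bracket k powr q)\<^sup>2 * Re (cnj (u k) * (\<Sum>m\<in>F. A k m * u m)))
        \<le> C * (\<Sum>k\<in>F. (bracket k powr q)\<^sup>2 * (cmod (u k))\<^sup>2)"
begin

abbreviation "L \<equiv> (scaled_lattice h :: (real^'n) set)"

definition act :: "(real^'n \<Rightarrow> complex) \<Rightarrow> real^'n \<Rightarrow> complex" where
  "act u k = (\<Sum>\<^sub>\<infinity>m\<in>L. A k m * u m)"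

definition row_const :: "real^'n \<Rightarrow> real" where "row_const k = S * bracket k powr p"

definition lattice_ball :: "nat \<Rightarrow> (real^'n) set" where
  "lattice_ball n = {k \<in> L. bracket k \<le> real n}"

lemma row_const_nonneg: "0 \<le> row_const k"
  by (simp add: row_const_def S_nonneg)

lemma lattice_ball:
  "finite (lattice_ball n)" "lattice_ball n \<subseteq> L" "i \<le> j \<Longrightarrow> lattice_ball i \<subseteq> lattice_ball j"
proof -
  have "lattice_ball n = {k \<in> L. norm k \<le> real n - 1}" by (auto simp: lattice_ball_def bracket_def)
  then show "finite (lattice_ball n)" by (simp only: finite_lattice_ball[OF h_pos])
qed (auto simp: lattice_ball_def)

lemma lattice_ball_Un: "L \<subseteq> (\<Union>n. lattice_ball n)"
  using real_arch_simple by (auto simp: lattice_ball_def)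

lemma finite_subset_lattice_ball:
  assumes "finite F" "F \<subseteq> L"
  obtains N where "N > 0" "F \<subseteq> lattice_ball N"
proof -
  obtain N :: nat where N: "(\<Sum>k\<in>F. bracket k) + 1 \<le> real N" using real_arch_simple by blast
  have "bracket k \<le> real N" if "k \<in> F" for k
    using member_le_sum[of k F bracket] assms that N by (force simp: bracket_def)
  moreover have "0 \<le> (\<Sum>k\<in>F. bracket k)" by (intro sum_nonneg) (simp add: bracket_def)
  then have "N > 0" using N by (cases N) auto
  ultimately show ?thesis using that assms(2) by (auto simp: lattice_ball_def)
qed

text \<open>\<open>loss\<close>, taken on the single row k, bounds the modulus of a sum. Adjusting
  the phases of u so that every term becomes nonnegative turns it into a bound for the sum of the
  moduli. Hence each coordinate of the operator is a bounded functional on ell2, although the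
  operator itself need not be bounded.\<close>

lemma row_bound:
  assumes "finite F" "F \<subseteq> L" "k \<in> L"
  shows "(\<Sum>m\<in>F. cmod (A k m * u m)) \<le> row_const k * L2_set (\<lambda>m. cmod (u m)) F"
proof -
  \<comment> \<open>Where \<open>A k m\<close> is 0, so is its \<open>sgn\<close>, and the term
    vanishes on both sides.\<close>
  define v where "v m = cnj (sgn (A k m)) * of_real (cmod (u m))" for m
  have "z * cnj (sgn z) = of_real (cmod z)" for z
  proof -
    have "z * cnj (sgn z) = of_real ((cmod z)\<^sup>2) / of_real (cmod z)"
      by (simp only: complex_norm_square) (simp add: sgn_eq)
    then show ?thesis by (simp add: power2_eq_square)
  qed
  then have "A k m * v m = of_real (cmod (A k m * u m))" for m
    by (simp add: v_def norm_mult mult.assoc[symmetric])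
  then have "(\<Sum>m\<in>F. A k m * v m) = of_real (\<Sum>m\<in>F. cmod (A k m * u m))" by simp
  then have e: "cmod (\<Sum>m\<in>F. A k m * v m) = (\<Sum>m\<in>F. cmod (A k m * u m))"
    by (simp only: norm_of_real) (simp add: sum_nonneg)
  have "bracket k powr - p * (\<Sum>m\<in>F. cmod (A k m * u m)) = L2_set (\<lambda>k. bracket k powr - p * cmod (\<Sum>m\<in>F. A k m * v m)) {k}"
    unfolding L2_set_def by (simp add: e sum_nonneg)
  also have "\<dots> \<le> S * L2_set (\<lambda>m. cmod (v m) / bracket m) F"
    by (rule loss) (use assms in auto)
  also have "\<dots> \<le> S * L2_set (\<lambda>m. cmod (u m)) F"
  proof (intro mult_left_mono L2_set_mono S_nonneg)
    fix m
    have "cmod (v m) \<le> cmod (u m)"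
      by (simp add: v_def norm_mult norm_sgn)
    then show "cmod (v m) / bracket m \<le> cmod (u m)"
      using frac_le[of "cmod (u m)" "cmod (v m)" 1 "bracket m"] by simp
    show "0 \<le> cmod (v m) / bracket m" by (simp add: less_imp_le)
  qed
  finally have "(\<Sum>m\<in>F. cmod (A k m * u m)) / bracket k powr p \<le> S * L2_set (\<lambda>m. cmod (u m)) F"
    by (simp add: powr_minus field_simps)
  then show ?thesis
    unfolding row_const_def by (subst (asm) pos_divide_le_eq) (simp_all add: mult_ac)
qed

lemma act_abs_summable:
  assumes "u \<in> ell2 h" "k \<in> L"
  shows "(\<lambda>m. cmod (A k m * u m)) summable_on L"
    and "infsum (\<lambda>m. cmod (A k m * u m)) L \<le> row_const k * ell2_norm h u"
proof -
  have b: "sum (\<lambda>m. cmod (A k m * u m)) F \<le> row_const k * ell2_norm h u" if "finite F" "F \<subseteq> L" for F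
    using row_bound[OF that assms(2), of u] mult_left_mono[OF L2_set_le_ell2_norm[OF assms(1) that] row_const_nonneg[of k]]
    by linarith
  show s: "(\<lambda>m. cmod (A k m * u m)) summable_on L"
    by (rule nonneg_bdd_above_summable_on) (auto intro!: bdd_aboveI2 b)
  show "infsum (\<lambda>m. cmod (A k m * u m)) L \<le> row_const k * ell2_norm h u"
    by (rule infsum_le_finite_sums[OF s b])
qed

lemma act_summable:
  assumes "u \<in> ell2 h" "k \<in> L"
  shows "(\<lambda>m. A k m * u m) summable_on L"
  using act_abs_summable(1)[OF assms] by (rule abs_summable_summable)

lemma act_bound:
  assumes "u \<in> ell2 h" "k \<in> L"
  shows "cmod (act u k) \<le> row_const k * ell2_norm h u"
  unfolding act_def
  using norm_infsum_bound[OF act_abs_summable(1)[OF assms]] act_abs_summable(2)[OF assms] by linarith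

lemma act_diff:
  assumes "u \<in> ell2 h" "v \<in> ell2 h" "k \<in> L"
  shows "act (\<lambda>m. u m - v m) k = act u k - act v k"
proof -
  have "act (\<lambda>m. u m - v m) k = infsum (\<lambda>m. A k m * u m + A k m * (- v m)) L"
    unfolding act_def by (rule infsum_cong) (simp add: algebra_simps)
  also have "\<dots> = act u k + act (\<lambda>m. - v m) k"
    unfolding act_def by (intro infsum_add act_summable assms ell2_uminus)
  also have "act (\<lambda>m. - v m) k = - act v k" unfolding act_def by (simp add: infsum_uminus)
  finally show ?thesis by simp
qed

lemma act_finite_support:
  assumes "finite F" "F \<subseteq> L" "\<And>k. k \<in> L \<Longrightarrow> k \<notin> F \<Longrightarrow> u k = 0"
  shows "act u k = (\<Sum>m\<in>F. A k m * u m)"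
proof -
  have "act u k = infsum (\<lambda>m. A k m * u m) F"
    unfolding act_def by (rule infsum_cong_neutral) (use assms in auto)
  then show ?thesis using assms by simp
qed

lemma continuous_act:
  assumes w: "continuous_ell2 h T w" and k: "k \<in> L"
  shows "continuous_on {0..T} (\<lambda>t. act (w t) k)"
  unfolding continuous_on_def
proof
  fix t assume t: "t \<in> {0..T}"
  have ell: "s \<in> {0..T} \<Longrightarrow> w s \<in> ell2 h" for s using w by (auto simp: continuous_ell2_def)
  have "((\<lambda>s. act (w s) k - act (w t) k) \<longlongrightarrow> 0) (at t within {0..T})"
  proof (rule Lim_null_comparison)
    have "((\<lambda>s. row_const k * ell2_norm h (\<lambda>k. w s k - w t k)) \<longlongrightarrow> row_const k * 0) (at t within {0..T})"
      using w t by (intro tendsto_mult_left) (auto simp: continuous_ell2_def)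
    then show "((\<lambda>s. row_const k * ell2_norm h (\<lambda>k. w s k - w t k)) \<longlongrightarrow> 0) (at t within {0..T})" by simp
    have "norm (act (w s) k - act (w t) k) \<le> row_const k * ell2_norm h (\<lambda>k. w s k - w t k)" if s: "s \<in> {0..T}" for s
      using act_bound[OF ell2_diff(1)[OF ell[OF s] ell[OF t]] k] act_diff[OF ell[OF s] ell[OF t] k] by simp
    then show "\<forall>\<^sub>F s in at t within {0..T}. norm (act (w s) k - act (w t) k) \<le> row_const k * ell2_norm h (\<lambda>k. w s k - w t k)"
      by (auto simp: eventually_at_topological)
  qed
  then show "((\<lambda>s. act (w s) k) \<longlongrightarrow> act (w t) k) (at t within {0..T})" by (rule LIM_zero_cancel)
qed

text \<open>The factor \<open>1 / bracket m\<close> on the right of \<open>loss\<close> is at most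
  \<open>1 / \<rho>\<close> on the support of u. The infinite sum is reached coordinate by
  coordinate, since G is finite.\<close>

lemma act_loss:
  assumes u: "u \<in> ell2 h" and G: "finite G" "G \<subseteq> L" and \<rho>: "0 < \<rho>"
    and far: "\<And>m. m \<in> L \<Longrightarrow> bracket m < \<rho> \<Longrightarrow> u m = 0"
  shows "L2_set (\<lambda>k. bracket k powr - p * cmod (act u k)) G \<le> S * ell2_norm h u / \<rho>"
proof -
  have "((\<lambda>F. \<Sum>m\<in>F. A k m * u m) \<longlongrightarrow> act u k) (finite_subsets_at_top L)" if "k \<in> G" for k
    using has_sum_infsum[OF act_summable[OF u, of k]] that G unfolding has_sum_def act_def by auto
  then have lim: "((\<lambda>F. L2_set (\<lambda>k. bracket k powr - p * cmod (\<Sum>m\<in>F. A k m * u m)) G) \<longlongrightarrow>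
      L2_set (\<lambda>k. bracket k powr - p * cmod (act u k)) G) (finite_subsets_at_top L)"
    unfolding L2_set_def by (auto intro!: tendsto_intros)
  have *: "L2_set (\<lambda>k. bracket k powr - p * cmod (\<Sum>m\<in>F. A k m * u m)) G \<le> S * ell2_norm h u / \<rho>"
    if F: "finite F" "F \<subseteq> L" for F
  proof -
    have "L2_set (\<lambda>m. cmod (u m) / bracket m) F \<le> L2_set (\<lambda>m. (1 / \<rho>) * cmod (u m)) F"
    proof (rule L2_set_mono)
      fix m assume "m \<in> F"
      then have "m \<in> L" using F by blast
      then show "cmod (u m) / bracket m \<le> (1 / \<rho>) * cmod (u m)"
        using far[of m] \<rho> by (cases "bracket m < \<rho>") (auto intro!: divide_left_mono)
      show "0 \<le> cmod (u m) / bracket m" by (simp add: less_imp_le)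
    qed
    also have "\<dots> = (1 / \<rho>) * L2_set (\<lambda>m. cmod (u m)) F"
      by (rule L2_set_right_distrib[symmetric]) (use \<rho> in simp)
    also have "\<dots> \<le> (1 / \<rho>) * ell2_norm h u"
      using \<rho> by (intro mult_left_mono L2_set_le_ell2_norm[OF u F]) auto
    finally have "S * L2_set (\<lambda>m. cmod (u m) / bracket m) F \<le> S * ((1 / \<rho>) * ell2_norm h u)"
      by (rule mult_left_mono[OF _ S_nonneg])
    then show ?thesis using loss[OF G(1) F(1) G(2) F(2), of u] by simp
  qed
  have ev: "\<forall>\<^sub>F F in finite_subsets_at_top L.
      L2_set (\<lambda>k. bracket k powr - p * cmod (\<Sum>m\<in>F. A k m * u m)) G \<le> S * ell2_norm h u / \<rho>"
    by (rule eventually_finite_subsets_at_top_weakI) (use * in auto)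
  show ?thesis by (rule tendsto_upperbound[OF lim ev]) simp
qed

lemma energy_estimate:
  obtains K where "0 \<le> K"
    and "\<And>F v \<phi> b t. \<lbrakk>finite F; F \<subseteq> L;
      \<And>k t. k \<in> F \<Longrightarrow> t \<in> {0..T} \<Longrightarrow>
        ((\<lambda>s. v s k) has_vector_derivative ((\<Sum>m\<in>F. A k m * v t m) + \<phi> t k)) (at t within {0..T});
      continuous_on {0..T} b; \<And>t. t \<in> {0..T} \<Longrightarrow> L2_set (\<lambda>k. bracket k powr q * cmod (\<phi> t k)) F \<le> b t;
      t \<in> {0..T}\<rbrakk>
    \<Longrightarrow> L2_set (\<lambda>k. bracket k powr q * cmod (v t k)) F
      \<le> K * (L2_set (\<lambda>k. bracket k powr q * cmod (v 0 k)) F + integral {0..t} b)"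
proof -
  obtain C where C: "0 \<le> C" "\<And>F u. finite F \<Longrightarrow> F \<subseteq> L \<Longrightarrow>
      (\<Sum>k\<in>F. (bracket k powr q)\<^sup>2 * Re (cnj (u k) * (\<Sum>m\<in>F. A k m * u m)))
        \<le> C * (\<Sum>k\<in>F. (bracket k powr q)\<^sup>2 * (cmod (u k))\<^sup>2)"
    using garding[of q] by blast
  show ?thesis
  \<comment> \<open>C is the constant of \<open>garding\<close> for the weight q, hence the same for
    all truncations F.\<close>
  proof (rule that[of "exp (C * T)"])
    fix F v \<phi> b t
    assume F: "finite F" "F \<subseteq> L" and v: "\<And>k t. k \<in> F \<Longrightarrow> t \<in> {0..T} \<Longrightarrow>
        ((\<lambda>s. v s k) has_vector_derivative ((\<Sum>m\<in>F. A k m * v t m) + \<phi> t k)) (at t within {0..T})"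
      and b: "continuous_on {0..T} b" "\<And>t. t \<in> {0..T} \<Longrightarrow> L2_set (\<lambda>k. bracket k powr q * cmod (\<phi> t k)) F \<le> b t"
      and t: "t \<in> {0..T}"
    show "L2_set (\<lambda>k. bracket k powr q * cmod (v t k)) F
      \<le> exp (C * T) * (L2_set (\<lambda>k. bracket k powr q * cmod (v 0 k)) F + integral {0..t} b)"
      by (rule weighted_energy_bound[where A = A and \<phi> = \<phi>, OF F(1) _ C(1) C(2)[OF F] v b t]) auto
  qed simp
qed

end

lemma bracket_powr_0_mult: "bracket k powr 0 * x = x" by simp

context parabolic_kernel
begin

section \<open>Linearity and uniqueness\<close>

lemma solution_ell2: "cauchy_solution h T act w0 g w \<Longrightarrow> t \<in> {0..T} \<Longrightarrow> w t \<in> ell2 h"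
  by (simp add: cauchy_solution_def continuous_ell2_def)

lemma set_integrable_act:
  assumes "continuous_ell2 h T w" "k \<in> L" "t \<in> {0..T}"
  shows "set_integrable lebesgue {0..t} (\<lambda>s. act (w s) k)"
  by (rule absolutely_integrable_continuous_real, rule continuous_on_subset[OF continuous_act[OF assms(1,2)]])
    (use assms(3) in auto)

lemma solution_diff:
  assumes w: "cauchy_solution h T act w0 g w" and w': "cauchy_solution h T act w0' g' w'"
  shows "cauchy_solution h T act (\<lambda>k. w0 k - w0' k) (\<lambda>s k. g s k - g' s k) (\<lambda>s k. w s k - w' s k)"
  unfolding cauchy_solution_def
proof (intro conjI ballI)
  note ell = solution_ell2[OF w] and ell' = solution_ell2[OF w']
  show "continuous_ell2 h T (\<lambda>s k. w s k - w' s k)"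
    unfolding continuous_ell2_def
  proof (intro conjI ballI)
    fix t assume t: "t \<in> {0..T}"
    show "(\<lambda>k. w t k - w' t k) \<in> ell2 h" by (intro ell2_diff ell ell' t)
    show "((\<lambda>s. ell2_norm h (\<lambda>k. w s k - w' s k - (w t k - w' t k))) \<longlongrightarrow> 0) (at t within {0..T})"
    proof (rule Lim_null_comparison)
      have "((\<lambda>s. ell2_norm h (\<lambda>k. w s k - w t k) + ell2_norm h (\<lambda>k. w' s k - w' t k)) \<longlongrightarrow> 0 + 0) (at t within {0..T})"
        by (intro tendsto_add) (use w w' t in \<open>auto simp: cauchy_solution_def continuous_ell2_def\<close>)
      then show "((\<lambda>s. ell2_norm h (\<lambda>k. w s k - w t k) + ell2_norm h (\<lambda>k. w' s k - w' t k)) \<longlongrightarrow> 0) (at t within {0..T})"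
        by simp
      have "norm (ell2_norm h (\<lambda>k. w s k - w' s k - (w t k - w' t k)))
          \<le> ell2_norm h (\<lambda>k. w s k - w t k) + ell2_norm h (\<lambda>k. w' s k - w' t k)" if s: "s \<in> {0..T}" for s
        using ell2_norm_diff_le[OF ell2_diff(1)[OF ell[OF s] ell[OF t]] ell2_diff(1)[OF ell'[OF s] ell'[OF t]]]
        by (simp add: algebra_simps)
      then show "\<forall>\<^sub>F s in at t within {0..T}. norm (ell2_norm h (\<lambda>k. w s k - w' s k - (w t k - w' t k)))
          \<le> ell2_norm h (\<lambda>k. w s k - w t k) + ell2_norm h (\<lambda>k. w' s k - w' t k)"
        by (auto simp: eventually_at_topological)
    qed
  qed
  fix t k assume t: "t \<in> {0..T}" and k: "k \<in> L"
  let ?f = "\<lambda>s. act (w s) k + g s k" and ?f' = "\<lambda>s. act (w' s) k + g' s k"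
  have i: "set_integrable lebesgue {0..t} ?f" "set_integrable lebesgue {0..t} ?f'"
    using w w' t k by (auto simp: cauchy_solution_def)
  have eq: "act (\<lambda>k. w s k - w' s k) k + (g s k - g' s k) = ?f s - ?f' s" if "s \<in> {0..t}" for s
    using act_diff[OF ell ell' k, of s s] that t by auto
  have "set_integrable lebesgue {0..t} (\<lambda>s. ?f s - ?f' s)" using i by (rule set_integral_diff(1))
  moreover have "set_integrable lebesgue {0..t} (\<lambda>s. act (\<lambda>k. w s k - w' s k) k + (g s k - g' s k))
      = set_integrable lebesgue {0..t} (\<lambda>s. ?f s - ?f' s)"
    by (rule set_integrable_cong) (use eq in auto)
  ultimately show "set_integrable lebesgue {0..t} (\<lambda>s. act (\<lambda>k. w s k - w' s k) k + (g s k - g' s k))" by simp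
  have "(LINT s:{0..t}|lebesgue. act (\<lambda>k. w s k - w' s k) k + (g s k - g' s k)) = (LINT s:{0..t}|lebesgue. ?f s - ?f' s)"
    by (rule set_lebesgue_integral_cong) (use eq in auto)
  also have "\<dots> = (LINT s:{0..t}|lebesgue. ?f s) - (LINT s:{0..t}|lebesgue. ?f' s)"
    using i by (rule set_integral_diff(2))
  finally show "w t k - w' t k = w0 k - w0' k + (LINT s:{0..t}|lebesgue. act (\<lambda>k. w s k - w' s k) k + (g s k - g' s k))"
    using w w' t k by (simp add: cauchy_solution_def)
qed

text \<open>Restricted to a ball, z solves the truncated system with the contribution of its own
  tail as forcing. Only a bound for the ell2 norm of the tail is known, so this forcing is small
  merely in the norm with weight - p, where \<open>act_loss\<close> supplies the rate 1/n.\<close>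

lemma homogeneous_solution_zero:
  assumes z: "cauchy_solution h T act (\<lambda>k. 0) (\<lambda>s k. 0) z" and t: "t \<in> {0..T}"
  shows "z t k = 0"
proof (cases "k \<in> L")
  case False
  then show ?thesis using ell2_zero_off solution_ell2[OF z t] by blast
next
  case k: True
  have cz: "continuous_ell2 h T z" using z by (simp add: cauchy_solution_def)
  note ell = solution_ell2[OF z]
  obtain M where M: "\<And>s. s \<in> {0..T} \<Longrightarrow> ell2_norm h (z s) \<le> M"
  proof -
    have "bounded ((\<lambda>s. ell2_norm h (z s)) ` {0..T})"
      by (intro compact_imp_bounded compact_continuous_image continuous_ell2_norm[OF cz] compact_Icc)
    then show ?thesis using that unfolding bounded_iff by fastforce
  qed
  have eq: "z s j = integral {0..s} (\<lambda>r. act (z r) j)" if "s \<in> {0..T}" "j \<in> L" for s j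
    using z that set_lebesgue_integral_eq_integral(2)[OF set_integrable_act[OF cz that(2,1)]]
    by (simp add: cauchy_solution_def)
  \<comment> \<open>Every coordinate of the operator is continuous in time, so the integrated
    equation is a differential equation coordinate by coordinate.\<close>
  have dz: "((\<lambda>s. z s j) has_vector_derivative act (z s) j) (at s within {0..T})" if "s \<in> {0..T}" "j \<in> L" for s j
    by (rule has_vector_derivative_transform[OF that(1) _ integral_has_vector_derivative[OF continuous_act[OF cz that(2)] that(1)]])
      (use eq that(2) in auto)
  obtain K where K: "0 \<le> K" and K_est: "\<And>F v \<phi> b t. \<lbrakk>finite F; F \<subseteq> L;
      \<And>k t. k \<in> F \<Longrightarrow> t \<in> {0..T} \<Longrightarrow>
        ((\<lambda>s. v s k) has_vector_derivative ((\<Sum>m\<in>F. A k m * v t m) + \<phi> t k)) (at t within {0..T});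
      continuous_on {0..T} b; \<And>t. t \<in> {0..T} \<Longrightarrow> L2_set (\<lambda>k. bracket k powr - p * cmod (\<phi> t k)) F \<le> b t;
      t \<in> {0..T}\<rbrakk>
    \<Longrightarrow> L2_set (\<lambda>k. bracket k powr - p * cmod (v t k)) F
      \<le> K * (L2_set (\<lambda>k. bracket k powr - p * cmod (v 0 k)) F + integral {0..t} b)"
    by (fact energy_estimate[of "- p"])
  have bound: "bracket k powr - p * cmod (z t k) \<le> K * T * (S * M) / real n"
    if n: "n > 0" "k \<in> lattice_ball n" for n
  proof -
    define F where "F = lattice_ball n"
    have F: "finite F" "F \<subseteq> L" using lattice_ball by (auto simp: F_def)
    define tail where "tail s = (\<lambda>j. if j \<in> F then 0 else z s j)" for s
    have split: "act (z s) j = (\<Sum>m\<in>F. A j m * z s m) + act (tail s) j" if s: "s \<in> {0..T}" and j: "j \<in> L" for s j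
    proof -
      have "act (tail s) j = act (\<lambda>m. z s m - (if m \<in> F then z s m else 0)) j"
        by (rule arg_cong[of _ _ "\<lambda>u. act u j"]) (auto simp: tail_def)
      also have "\<dots> = act (z s) j - act (\<lambda>m. if m \<in> F then z s m else 0) j"
        by (intro act_diff ell s j ell2_cut)
      also have "act (\<lambda>m. if m \<in> F then z s m else 0) j = (\<Sum>m\<in>F. A j m * z s m)"
        by (subst act_finite_support[OF F]) auto
      finally show ?thesis by simp
    qed
    have small: "L2_set (\<lambda>k. bracket k powr - p * cmod (act (tail s) k)) F \<le> S * M / real n" if s: "s \<in> {0..T}" for s
    proof -
      have "L2_set (\<lambda>k. bracket k powr - p * cmod (act (tail s) k)) F \<le> S * ell2_norm h (tail s) / real n"
        by (rule act_loss)
          (simp_all only: F of_nat_0_less_iff n tail_def ell2_cut(2)[OF ell[OF s]], simp add: F_def lattice_ball_def)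
      also have "\<dots> \<le> S * M / real n"
        using order_trans[OF ell2_cut(4)[OF ell[OF s], of F] M[OF s]] S_nonneg
        by (intro divide_right_mono mult_left_mono) (auto simp: tail_def)
      finally show ?thesis .
    qed
    have "L2_set (\<lambda>k. bracket k powr - p * cmod (z t k)) F
        \<le> K * (L2_set (\<lambda>k. bracket k powr - p * cmod (z 0 k)) F + integral {0..t} (\<lambda>s. S * M / real n))"
    proof (rule K_est[OF F _ _ small t])
      fix j s assume j: "j \<in> F" and s: "s \<in> {0..T}"
      then have "j \<in> L" using F by blast
      then show "((\<lambda>s. z s j) has_vector_derivative (\<Sum>m\<in>F. A j m * z s m) + act (tail s) j) (at s within {0..T})"
        using dz[OF s] split[OF s] by simp
    qed simp
    also have "L2_set (\<lambda>k. bracket k powr - p * cmod (z 0 k)) F = 0"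
      using eq[of 0] T_pos F by (intro L2_set_0') auto
    also have "K * (0 + integral {0..t} (\<lambda>s. S * M / real n)) = (K * (S * M) / real n) * t"
      using t by simp
    also have "\<dots> \<le> (K * (S * M) / real n) * T"
    proof (rule mult_left_mono)
      have "0 \<le> M" using M[OF t] ell2_norm_nonneg order_trans by blast
      then show "0 \<le> K * (S * M) / real n" using K S_nonneg by simp
    qed (use t in auto)
    finally have "L2_set (\<lambda>k. bracket k powr - p * cmod (z t k)) F \<le> K * T * (S * M) / real n"
      by (simp add: mult_ac)
    moreover have "bracket k powr - p * cmod (z t k) \<le> L2_set (\<lambda>k. bracket k powr - p * cmod (z t k)) F"
      by (rule member_le_L2_set) (use F n in \<open>auto simp: F_def\<close>)
    ultimately show ?thesis by linarith
  qed
  obtain N where N: "N > 0" "{k} \<subseteq> lattice_ball N" using finite_subset_lattice_ball[of "{k}"] k by auto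
  \<comment> \<open>The weight at the fixed point k does not change with the radius n, so the bounds
    at all large radii force the value to vanish.\<close>
  have "bracket k powr - p * cmod (z t k) \<le> 0"
  proof (rule tendsto_lowerbound)
    show "(\<lambda>n. K * T * (S * M) / real n) \<longlonglongrightarrow> 0" by (rule lim_const_over_n)
    show "\<forall>\<^sub>F n in sequentially. bracket k powr - p * cmod (z t k) \<le> K * T * (S * M) / real n"
      using eventually_ge_at_top[of N]
    proof eventually_elim
      case (elim n)
      then show ?case using bound[of n] N lattice_ball(3)[OF elim] by auto
    qed
  qed simp
  moreover have "0 < bracket k powr - p" by simp
  ultimately show ?thesis by (simp add: mult_le_0_iff)
qed

lemma solution_unique:
  assumes "cauchy_solution h T act w0 g w" "cauchy_solution h T act w0 g w'" "t \<in> {0..T}"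
  shows "w' t = w t"
proof
  fix k
  show "w' t k = w t k"
    using homogeneous_solution_zero[of "\<lambda>s k. w s k - w' s k", OF _ assms(3), of k]
      solution_diff[OF assms(1,2)] by simp
qed

section \<open>Passage to the limit, and existence for finitely supported data\<close>

lemma limit_of_solutions:
  assumes W: "continuous_ell2 h T W" and V: "\<And>n. n \<ge> N \<Longrightarrow> continuous_ell2 h T (V n)"
    and close: "\<And>n s. n \<ge> N \<Longrightarrow> s \<in> {0..T} \<Longrightarrow> ell2_norm h (\<lambda>k. V n s k - W s k) \<le> e n"
    and e: "e \<longlonglongrightarrow> (0::real)" and t: "t \<in> {0..T}" and k: "k \<in> L"
    and u: "u \<longlonglongrightarrow> u0"
    and g: "\<And>n. n \<ge> N \<Longrightarrow> set_integrable lebesgue {0..t} (\<lambda>s. g n s k)" "set_integrable lebesgue {0..t} (\<lambda>s. g0 s k)"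
      "(\<lambda>n. LINT s:{0..t}|lebesgue. g n s k) \<longlonglongrightarrow> (LINT s:{0..t}|lebesgue. g0 s k)"
    and eq: "\<And>n. n \<ge> N \<Longrightarrow> V n t k = u n + (LINT s:{0..t}|lebesgue. act (V n s) k + g n s k)"
  shows "W t k = u0 + (LINT s:{0..t}|lebesgue. act (W s) k + g0 s k)"
proof -
  have VE: "n \<ge> N \<Longrightarrow> s \<in> {0..T} \<Longrightarrow> V n s \<in> ell2 h" and WE: "s \<in> {0..T} \<Longrightarrow> W s \<in> ell2 h" for n s
    using V W by (auto simp: continuous_ell2_def)
  \<comment> \<open>Uniform closeness in ell2 gives uniform closeness of the coordinate k of the
    operator, with the factor \<open>row_const k\<close>; its growth in k is harmless because k is
    fixed.\<close>
  have "(\<lambda>n. (LINT s:{0..t}|lebesgue. act (V n s) k) - (LINT s:{0..t}|lebesgue. act (W s) k)) \<longlonglongrightarrow> 0"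
  proof (rule Lim_null_comparison)
    have "(\<lambda>n. row_const k * e n * t) \<longlonglongrightarrow> row_const k * 0 * t" by (intro tendsto_intros e)
    then show "(\<lambda>n. row_const k * e n * t) \<longlonglongrightarrow> 0" by simp
    show "\<forall>\<^sub>F n in sequentially. norm ((LINT s:{0..t}|lebesgue. act (V n s) k) - (LINT s:{0..t}|lebesgue. act (W s) k))
        \<le> row_const k * e n * t"
      using eventually_ge_at_top[of N]
    proof eventually_elim
      case (elim n)
      have i: "set_integrable lebesgue {0..t} (\<lambda>s. act (V n s) k)" "set_integrable lebesgue {0..t} (\<lambda>s. act (W s) k)"
        by (intro set_integrable_act V W elim k t)+
      have "norm ((LINT s:{0..t}|lebesgue. act (V n s) k) - (LINT s:{0..t}|lebesgue. act (W s) k))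
        = norm (LINT s:{0..t}|lebesgue. act (V n s) k - act (W s) k)"
        using set_integral_diff(2)[OF i] by simp
      also have "\<dots> = norm (integral {0..t} (\<lambda>s. act (V n s) k - act (W s) k))"
        using set_lebesgue_integral_eq_integral(2)[OF set_integral_diff(1)[OF i]] by simp
      also have "\<dots> \<le> (row_const k * e n) * (t - 0)"
      proof (rule integral_bound)
        show "0 \<le> t" using t by simp
        show "continuous_on {0..t} (\<lambda>s. act (V n s) k - act (W s) k)"
          by (intro continuous_on_diff continuous_on_subset[OF continuous_act] V W elim k) (use t in auto)
        fix s assume "s \<in> {0..t}"
        then have s: "s \<in> {0..T}" using t by auto
        have "norm (act (V n s) k - act (W s) k) \<le> row_const k * ell2_norm h (\<lambda>k. V n s k - W s k)"
          using act_bound[OF ell2_diff(1)[OF VE[OF elim s] WE[OF s]] k] act_diff[OF VE[OF elim s] WE[OF s] k] by simp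
        also have "\<dots> \<le> row_const k * e n"
          by (intro mult_left_mono close elim s row_const_nonneg)
        finally show "norm (act (V n s) k - act (W s) k) \<le> row_const k * e n" .
      qed
      finally show ?case by simp
    qed
  qed
  then have "(\<lambda>n. LINT s:{0..t}|lebesgue. act (V n s) k) \<longlonglongrightarrow> (LINT s:{0..t}|lebesgue. act (W s) k)"
    by (rule LIM_zero_cancel)
  then have "(\<lambda>n. u n + ((LINT s:{0..t}|lebesgue. act (V n s) k) + (LINT s:{0..t}|lebesgue. g n s k)))
      \<longlonglongrightarrow> u0 + ((LINT s:{0..t}|lebesgue. act (W s) k) + (LINT s:{0..t}|lebesgue. g0 s k))"
    by (intro tendsto_add u g(3))
  moreover have "\<forall>\<^sub>F n in sequentially. u n + ((LINT s:{0..t}|lebesgue. act (V n s) k) + (LINT s:{0..t}|lebesgue. g n s k)) = V n t k"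
    using eventually_ge_at_top[of N]
  proof eventually_elim
    case (elim n)
    show ?case
      using eq[OF elim] set_integral_add(2)[OF set_integrable_act[OF V[OF elim] k t] g(1)[OF elim]] by simp
  qed
  ultimately have "(\<lambda>n. V n t k) \<longlonglongrightarrow> u0 + ((LINT s:{0..t}|lebesgue. act (W s) k) + (LINT s:{0..t}|lebesgue. g0 s k))"
    by (rule Lim_transform_eventually)
  moreover have "(\<lambda>n. V n t k) \<longlonglongrightarrow> W t k"
  proof (rule LIM_zero_cancel, rule Lim_null_comparison[OF _ e])
    show "\<forall>\<^sub>F n in sequentially. norm (V n t k - W t k) \<le> e n"
      using eventually_ge_at_top[of N]
    proof eventually_elim
      case (elim n)
      show ?case
        using cmod_le_ell2_norm[OF ell2_diff(1)[OF VE[OF elim t] WE[OF t]], of k] close[OF elim t] by linarith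
    qed
  qed
  ultimately have "W t k = u0 + ((LINT s:{0..t}|lebesgue. act (W s) k) + (LINT s:{0..t}|lebesgue. g0 s k))"
    using LIMSEQ_unique by blast
  then show ?thesis
    using set_integral_add(2)[OF set_integrable_act[OF W k t] g(2)] by simp
qed

text \<open>Finitely supported data have finite norm with weight p, and this bounds all truncated
  solutions in that norm. The bound governs only the speed of convergence of the truncations. The
  estimate of the limit uses weight 0 alone, so its constant K does not see the support and survives
  the passage to general data.\<close>

lemma solution_finite_support:
  obtains K where "0 \<le> K"
    and "\<And>F0 w0 \<phi>. \<lbrakk>finite F0; F0 \<subseteq> L; \<And>k. k \<notin> F0 \<Longrightarrow> w0 k = 0;
      \<And>t k. k \<notin> F0 \<Longrightarrow> \<phi> t k = 0; \<And>k. continuous_on {0..T} (\<lambda>t. \<phi> t k)\<rbrakk> \<Longrightarrow>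
      \<exists>w. cauchy_solution h T act w0 \<phi> w \<and>
        (\<forall>t\<in>{0..T}. ell2_norm h (w t) \<le> K * (ell2_norm h w0 + integral {0..t} (\<lambda>s. ell2_norm h (\<phi> s))))"
proof -
  obtain K where K: "0 \<le> K" and K_est0: "\<And>F v \<phi> b t. \<lbrakk>finite F; F \<subseteq> L;
      \<And>k t. k \<in> F \<Longrightarrow> t \<in> {0..T} \<Longrightarrow>
        ((\<lambda>s. v s k) has_vector_derivative ((\<Sum>m\<in>F. A k m * v t m) + \<phi> t k)) (at t within {0..T});
      continuous_on {0..T} b; \<And>t. t \<in> {0..T} \<Longrightarrow> L2_set (\<lambda>k. bracket k powr 0 * cmod (\<phi> t k)) F \<le> b t;
      t \<in> {0..T}\<rbrakk>
    \<Longrightarrow> L2_set (\<lambda>k. bracket k powr 0 * cmod (v t k)) F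
      \<le> K * (L2_set (\<lambda>k. bracket k powr 0 * cmod (v 0 k)) F + integral {0..t} b)"
    by (fact energy_estimate[of 0])
  note K_est = K_est0[unfolded bracket_powr_0_mult]
  obtain Kp where Kp: "0 \<le> Kp" and Kp_est: "\<And>F v \<phi> b t. \<lbrakk>finite F; F \<subseteq> L;
      \<And>k t. k \<in> F \<Longrightarrow> t \<in> {0..T} \<Longrightarrow>
        ((\<lambda>s. v s k) has_vector_derivative ((\<Sum>m\<in>F. A k m * v t m) + \<phi> t k)) (at t within {0..T});
      continuous_on {0..T} b; \<And>t. t \<in> {0..T} \<Longrightarrow> L2_set (\<lambda>k. bracket k powr p * cmod (\<phi> t k)) F \<le> b t;
      t \<in> {0..T}\<rbrakk>
    \<Longrightarrow> L2_set (\<lambda>k. bracket k powr p * cmod (v t k)) F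
      \<le> Kp * (L2_set (\<lambda>k. bracket k powr p * cmod (v 0 k)) F + integral {0..t} b)"
    by (fact energy_estimate[of p])
  show ?thesis
  proof (rule that[OF K])
    fix F0 and w0 :: "real^'n \<Rightarrow> complex" and \<phi> :: "real \<Rightarrow> real^'n \<Rightarrow> complex"
    assume F0: "finite F0" "F0 \<subseteq> L" and w0: "\<And>k. k \<notin> F0 \<Longrightarrow> w0 k = 0"
      and \<phi>0: "\<And>t k. k \<notin> F0 \<Longrightarrow> \<phi> t k = 0" and \<phi>cont: "\<And>k. continuous_on {0..T} (\<lambda>t. \<phi> t k)"
    have c\<phi>: "continuous_ell2 h T \<phi>"
      by (rule continuous_ell2_finite_support[OF F0 _ \<phi>cont]) (use \<phi>0 in auto)
    define F where "F = lattice_ball"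
    have F: "finite (F n)" "F n \<subseteq> L" "i \<le> j \<Longrightarrow> F i \<subseteq> F j" for n i j
      using lattice_ball by (auto simp: F_def)
    have "\<exists>x. \<forall>k\<in>F n. x 0 k = w0 k \<and> (\<forall>t\<in>{0..T}.
        ((\<lambda>s. x s k) has_vector_derivative ((\<Sum>m\<in>F n. A k m * x t m) + \<phi> t k)) (at t within {0..T}))" for n
    proof -
      obtain x where "\<And>k. k \<in> F n \<Longrightarrow> x 0 k = w0 k"
        "\<And>k t. k \<in> F n \<Longrightarrow> t \<in> {0..T} \<Longrightarrow>
          ((\<lambda>s. x s k) has_vector_derivative ((\<Sum>m\<in>F n. A k m * x t m) + \<phi> t k)) (at t within {0..T})"
        by (fact linear_system_solution[of "F n" T \<phi> w0 A, OF F(1) \<phi>cont less_imp_le[OF T_pos]])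
      then show ?thesis by blast
    qed
    then obtain x where x0: "\<And>n k. k \<in> F n \<Longrightarrow> x n 0 k = w0 k"
      and dx: "\<And>n k t. k \<in> F n \<Longrightarrow> t \<in> {0..T} \<Longrightarrow>
        ((\<lambda>s. x n s k) has_vector_derivative ((\<Sum>m\<in>F n. A k m * x n t m) + \<phi> t k)) (at t within {0..T})"
      by metis
    define V where "V n t k = (if k \<in> F n then x n t k else 0)" for n t k
    have sumV: "(\<Sum>m\<in>F n. A k m * V n t m) = (\<Sum>m\<in>F n. A k m * x n t m)" for n k t
      by (rule sum.cong) (auto simp: V_def)
    have dV: "((\<lambda>s. V n s k) has_vector_derivative ((\<Sum>m\<in>F n. A k m * V n t m) + \<phi> t k)) (at t within {0..T})"
      if "k \<in> F n" "t \<in> {0..T}" for n k t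
      using dx[OF that] that(1) by (simp add: sumV) (simp add: V_def)
    have V0: "V n 0 k = w0 k" if "k \<in> F n" for n k using x0 that by (simp add: V_def)
    have cV: "continuous_ell2 h T (V n)" for n
    proof (rule continuous_ell2_finite_support[OF F(1,2)])
      show "continuous_on {0..T} (\<lambda>t. V n t k)" if "k \<in> F n" for k
        unfolding continuous_on_eq_continuous_within
        using has_vector_derivative_continuous[OF dV[OF that]] by blast
    qed (simp add: V_def)
    \<comment> \<open>From this radius on no part of the data is cut off.\<close>
    obtain N0 where N0: "N0 > 0" "F0 \<subseteq> F N0"
      using finite_subset_lattice_ball[OF F0] by (auto simp: F_def)
    define B where "B t = L2_set (\<lambda>k. bracket k powr p * cmod (\<phi> t k)) F0" for t
    have Bc: "continuous_on {0..T} B"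
      unfolding B_def L2_set_def by (intro continuous_intros \<phi>cont)
    have B0: "0 \<le> B t" for t by (simp add: B_def)
    define M where "M = Kp * (L2_set (\<lambda>k. bracket k powr p * cmod (w0 k)) F0 + integral {0..T} B)"
    have VM: "L2_set (\<lambda>k. bracket k powr p * cmod (V n t k)) (F n) \<le> M" if t: "t \<in> {0..T}" for n t
    proof -
      have "L2_set (\<lambda>k. bracket k powr p * cmod (V n t k)) (F n)
          \<le> Kp * (L2_set (\<lambda>k. bracket k powr p * cmod (V n 0 k)) (F n) + integral {0..t} B)"
        by (rule Kp_est[OF F(1,2) dV Bc _ t])
          (auto simp: B_def \<phi>0 intro!: L2_set_support_le F(1) F0(1))
      also have "\<dots> \<le> M"
        unfolding M_def
      proof (intro mult_left_mono add_mono Kp)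
        have "L2_set (\<lambda>k. bracket k powr p * cmod (V n 0 k)) (F n) = L2_set (\<lambda>k. bracket k powr p * cmod (w0 k)) (F n)"
          by (rule L2_set_cong) (auto simp: V0)
        also have "\<dots> \<le> L2_set (\<lambda>k. bracket k powr p * cmod (w0 k)) F0"
          by (rule L2_set_support_le[OF F(1) F0(1)]) (use w0 in auto)
        finally show "L2_set (\<lambda>k. bracket k powr p * cmod (V n 0 k)) (F n) \<le> L2_set (\<lambda>k. bracket k powr p * cmod (w0 k)) F0" .
        show "integral {0..t} B \<le> integral {0..T} B"
          by (rule integral_subset_le)
            (use t B0 in \<open>auto intro!: integrable_continuous_real continuous_on_subset[OF Bc]\<close>)
      qed
      finally show ?thesis .
    qed
    have M0: "0 \<le> M"
      using order_trans[OF L2_set_nonneg VM[of 0 0]] T_pos by simp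
    define c where "c = K * T * (S * M)"
    have c0: "0 \<le> c" using K T_pos S_nonneg M0 by (simp add: c_def)
    have VE: "V n t \<in> ell2 h" if "t \<in> {0..T}" for n t using cV that by (auto simp: continuous_ell2_def)
    have close1: "ell2_norm h (\<lambda>k. V i t k - V j t k) \<le> c / real j" if ij: "N0 \<le> j" "j \<le> i" and t: "t \<in> {0..T}" for i j t
    proof -
      have Fij: "F j \<subseteq> F i" "F0 \<subseteq> F j" using F(3)[OF ij(2)] F(3)[OF ij(1)] N0 by auto
      have j0: "0 < real j" using N0(1) ij(1) by simp
      \<comment> \<open>The smaller solution, extended by 0, solves the larger system except for
        what the operator sends from \<open>F j\<close> to points outside it. There
        \<open>bracket k\<close> is at least j, and \<open>gain\<close> turns this into a factor
        1/j.\<close>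
      define \<psi> where "\<psi> s k = (if k \<in> F j then 0 else \<Sum>m\<in>F j. A k m * V j s m)" for s k
      let ?z = "\<lambda>s k. V i s k - V j s k"
      have ext: "(\<Sum>m\<in>F i. A k m * V j s m) = (\<Sum>m\<in>F j. A k m * V j s m)" for k s
        by (rule sum.mono_neutral_right) (use Fij F in \<open>auto simp: V_def\<close>)
      have dz: "((\<lambda>s. ?z s k) has_vector_derivative ((\<Sum>m\<in>F i. A k m * ?z s m) + \<psi> s k)) (at s within {0..T})"
        if k: "k \<in> F i" and s: "s \<in> {0..T}" for k s
      proof (cases "k \<in> F j")
        case True
        have "((\<lambda>s. ?z s k) has_vector_derivative ((\<Sum>m\<in>F i. A k m * V i s m) + \<phi> s k) - ((\<Sum>m\<in>F j. A k m * V j s m) + \<phi> s k)) (at s within {0..T})"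
          by (intro has_vector_derivative_diff dV k s True)
        then show ?thesis using True by (simp add: \<psi>_def right_diff_distrib sum_subtractf ext)
      next
        case False
        have "\<phi> s k = 0" using \<phi>0 False Fij by auto
        then have "((\<lambda>s. V i s k - 0) has_vector_derivative ((\<Sum>m\<in>F i. A k m * V i s m) + 0) - 0) (at s within {0..T})"
          using dV[OF k s] by simp
        then show ?thesis using False by (simp add: \<psi>_def right_diff_distrib sum_subtractf ext) (simp add: V_def)
      qed
      have small: "L2_set (\<lambda>k. cmod (\<psi> s k)) (F i) \<le> S * M / real j" if s: "s \<in> {0..T}" for s
      proof -
        have "L2_set (\<lambda>k. cmod (\<psi> s k)) (F i) \<le> L2_set (\<lambda>k. (1 / real j) * (bracket k * cmod (\<Sum>m\<in>F j. A k m * V j s m))) (F i)"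
        proof (rule L2_set_mono)
          fix k assume k: "k \<in> F i"
          show "cmod (\<psi> s k) \<le> (1 / real j) * (bracket k * cmod (\<Sum>m\<in>F j. A k m * V j s m))"
          proof (cases "k \<in> F j")
            case False
            then have "real j \<le> bracket k" using k by (auto simp: F_def lattice_ball_def)
            then have "1 \<le> bracket k / real j" using j0 by simp
            then have "1 * cmod (\<Sum>m\<in>F j. A k m * V j s m) \<le> bracket k / real j * cmod (\<Sum>m\<in>F j. A k m * V j s m)"
              by (rule mult_right_mono) simp
            then show ?thesis using False by (simp add: \<psi>_def)
          qed (use j0 in \<open>simp add: \<psi>_def less_imp_le\<close>)
        qed simp
        also have "\<dots> = (1 / real j) * L2_set (\<lambda>k. bracket k * cmod (\<Sum>m\<in>F j. A k m * V j s m)) (F i)"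
          by (rule L2_set_right_distrib[symmetric]) simp
        also have "\<dots> \<le> (1 / real j) * (S * L2_set (\<lambda>m. bracket m powr p * cmod (V j s m)) (F j))"
          by (intro mult_left_mono gain F) simp
        also have "\<dots> \<le> (1 / real j) * (S * M)"
          by (intro mult_left_mono VM s S_nonneg) simp
        finally show ?thesis by simp
      qed
      have "L2_set (\<lambda>k. cmod (?z t k)) (F i) \<le> K * (L2_set (\<lambda>k. cmod (?z 0 k)) (F i) + integral {0..t} (\<lambda>s. S * M / real j))"
        by (rule K_est[OF F(1,2) dz _ small t]) auto
      \<comment> \<open>Both solutions start from \<open>w0\<close> on \<open>F j\<close>, and
        outside \<open>F j\<close> the initial datum vanishes because \<open>F0\<close> lies
        inside.\<close>
      also have "L2_set (\<lambda>k. cmod (?z 0 k)) (F i) = 0"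
      proof (intro L2_set_0' ballI)
        fix k assume "k \<in> F i"
        then show "cmod (?z 0 k) = 0"
          using V0[of k i] V0[of k j] w0 Fij by (cases "k \<in> F j") (auto simp: V_def[of j 0 k])
      qed
      also have "K * (0 + integral {0..t} (\<lambda>s. S * M / real j)) = (K * (S * M) / real j) * t" using t by simp
      also have "\<dots> \<le> (K * (S * M) / real j) * T"
        using t K S_nonneg M0 by (intro mult_left_mono) auto
      finally have "L2_set (\<lambda>k. cmod (?z t k)) (F i) \<le> c / real j" by (simp add: c_def mult_ac)
      moreover have "ell2_norm h (\<lambda>k. ?z t k) = L2_set (\<lambda>k. cmod (?z t k)) (F i)"
        by (rule ell2_finite_support(2)[OF F(1,2)]) (use Fij in \<open>auto simp: V_def\<close>)
      ultimately show ?thesis by simp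
    qed
    have close: "ell2_norm h (\<lambda>k. V i t k - V j t k) \<le> c / real n"
      if n: "N0 \<le> n" "n \<le> i" "n \<le> j" and t: "t \<in> {0..T}" for i j n t
    proof -
      have *: "c / real q \<le> c / real n" if "n \<le> q" for q
        using that n N0 c0 by (intro divide_left_mono) auto
      show ?thesis
      proof (cases "j \<le> i")
        case True
        then show ?thesis using close1[of j i t] *[OF n(3)] n t by linarith
      next
        case False
        then show ?thesis using close1[of i j t] *[OF n(2)] n t by (simp add: ell2_norm_diff_commute[of h "V i t"])
      qed
    qed
    have "\<exists>W. continuous_ell2 h T W \<and> (\<forall>n\<ge>N0. \<forall>t\<in>{0..T}. ell2_norm h (\<lambda>k. V n t k - W t k) \<le> c / real n)"
      by (rule uniformly_cauchy_ell2_limit[OF cV close lim_const_over_n])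
    then obtain W where cW: "continuous_ell2 h T W"
      and closeW: "\<And>n t. N0 \<le> n \<Longrightarrow> t \<in> {0..T} \<Longrightarrow> ell2_norm h (\<lambda>k. V n t k - W t k) \<le> c / real n"
      by blast
    have WE: "W t \<in> ell2 h" if "t \<in> {0..T}" for t using cW that by (auto simp: continuous_ell2_def)
    have i\<phi>: "set_integrable lebesgue {0..t} (\<lambda>s. \<phi> s k)" if "t \<in> {0..T}" for t k
      by (rule absolutely_integrable_continuous_real, rule continuous_on_subset[OF \<phi>cont]) (use that in auto)
    have eqW: "W t k = w0 k + (LINT s:{0..t}|lebesgue. act (W s) k + \<phi> s k)" if t: "t \<in> {0..T}" and k: "k \<in> L" for t k
    proof -
      obtain N1 where N1: "N1 > 0" "{k} \<subseteq> F N1"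
        using finite_subset_lattice_ball[of "{k}"] k by (auto simp: F_def)
      show ?thesis
      proof (rule limit_of_solutions[where N = "max N0 N1" and V = V and e = "\<lambda>n. c / real n" and u = "\<lambda>n. w0 k" and g = "\<lambda>n. \<phi>"])
        fix n assume n: "max N0 N1 \<le> n"
        then have kn: "k \<in> F n" using N1 F(3)[of N1 n] by auto
        have "((\<lambda>s. (\<Sum>m\<in>F n. A k m * V n s m) + \<phi> s k) has_integral (V n t k - V n 0 k)) {0..t}"
        proof (rule fundamental_theorem_of_calculus)
          fix s assume "s \<in> {0..t}"
          then show "((\<lambda>s. V n s k) has_vector_derivative (\<Sum>m\<in>F n. A k m * V n s m) + \<phi> s k) (at s within {0..t})"
            by (intro has_vector_derivative_within_subset[OF dV[OF kn]]) (use t in auto)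
        qed (use t in auto)
        moreover have "(\<Sum>m\<in>F n. A k m * V n s m) = act (V n s) k" for s
          by (rule act_finite_support[OF F(1,2), symmetric]) (auto simp: V_def)
        ultimately have "integral {0..t} (\<lambda>s. act (V n s) k + \<phi> s k) = V n t k - w0 k"
          using V0[OF kn] by (simp add: integral_unique)
        then show "V n t k = w0 k + (LINT s:{0..t}|lebesgue. act (V n s) k + \<phi> s k)"
          using set_lebesgue_integral_eq_integral(2)[OF set_integral_add(1)[OF set_integrable_act[OF cV k t] i\<phi>[OF t]]]
          by simp
      qed (use cW cV closeW t k i\<phi> in \<open>auto intro: lim_const_over_n\<close>)
    qed
    show "\<exists>w. cauchy_solution h T act w0 \<phi> w \<and>
       (\<forall>t\<in>{0..T}. ell2_norm h (w t) \<le> K * (ell2_norm h w0 + integral {0..t} (\<lambda>s. ell2_norm h (\<phi> s))))"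
    proof (intro exI[of _ W] conjI ballI)
      show "cauchy_solution h T act w0 \<phi> W"
        unfolding cauchy_solution_def
        using cW eqW set_integral_add(1)[OF set_integrable_act[OF cW] i\<phi>] by blast
      fix t assume t: "t \<in> {0..T}"
      have w0E: "ell2_norm h w0 = L2_set (\<lambda>k. cmod (w0 k)) F0" "\<And>s. ell2_norm h (\<phi> s) = L2_set (\<lambda>k. cmod (\<phi> s k)) F0"
        by (rule ell2_finite_support(2)[OF F0]; use w0 \<phi>0 in simp)+
      have Vb: "ell2_norm h (V n t) \<le> K * (ell2_norm h w0 + integral {0..t} (\<lambda>s. ell2_norm h (\<phi> s)))" for n
      proof -
        have "L2_set (\<lambda>k. cmod (V n t k)) (F n) \<le> K * (L2_set (\<lambda>k. cmod (V n 0 k)) (F n) + integral {0..t} (\<lambda>s. ell2_norm h (\<phi> s)))"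
        proof (rule K_est[OF F(1,2) dV continuous_ell2_norm[OF c\<phi>] _ t])
          show "L2_set (\<lambda>k. cmod (\<phi> s k)) (F n) \<le> ell2_norm h (\<phi> s)" for s
            unfolding w0E by (rule L2_set_support_le[OF F(1) F0(1)]) (use \<phi>0 in auto)
        qed
        also have "\<dots> \<le> K * (ell2_norm h w0 + integral {0..t} (\<lambda>s. ell2_norm h (\<phi> s)))"
        proof (intro mult_left_mono add_mono order_refl K)
          have "L2_set (\<lambda>k. cmod (V n 0 k)) (F n) = L2_set (\<lambda>k. cmod (w0 k)) (F n)"
            by (rule L2_set_cong) (auto simp: V0)
          also have "\<dots> \<le> ell2_norm h w0"
            unfolding w0E by (rule L2_set_support_le[OF F(1) F0(1)]) (use w0 in auto)
          finally show "L2_set (\<lambda>k. cmod (V n 0 k)) (F n) \<le> ell2_norm h w0" .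
        qed
        finally show ?thesis
          by (subst ell2_finite_support(2)[OF F(1,2), of n]) (auto simp: V_def)
      qed
      show "ell2_norm h (W t) \<le> K * (ell2_norm h w0 + integral {0..t} (\<lambda>s. ell2_norm h (\<phi> s)))" (is "_ \<le> ?R")
      proof (rule tendsto_lowerbound)
        have "(\<lambda>n. ?R + c / real n) \<longlonglongrightarrow> ?R + 0" by (intro tendsto_intros lim_const_over_n)
        then show "(\<lambda>n. ?R + c / real n) \<longlonglongrightarrow> ?R" by simp
        show "\<forall>\<^sub>F n in sequentially. ell2_norm h (W t) \<le> ?R + c / real n"
          using eventually_ge_at_top[of N0]
        proof eventually_elim
          case (elim n)
          show ?case
            using ell2_norm_triangle_sub[OF WE[OF t] VE[OF t], of n] Vb[of n] closeW[OF elim t]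
            by (simp add: ell2_norm_diff_commute[of h "W t"])
        qed
      qed simp
    qed
  qed
qed

end

section \<open>Integrable data\<close>

lemma set_integrable_lebesgue_on:
  fixes f :: "'a::euclidean_space \<Rightarrow> 'b::{banach, second_countable_topology}"
  assumes "S \<in> sets lebesgue"
  shows "set_integrable lebesgue S f \<longleftrightarrow> integrable (lebesgue_on S) f"
    and "(LINT x:S|lebesgue. f x) = integral\<^sup>L (lebesgue_on S) f"
  using assms by (simp_all add: set_integrable_def set_lebesgue_integral_def integrable_restrict_space integral_restrict_space)

lemma set_integrable_initial_segment:
  fixes f :: "real \<Rightarrow> 'b::{banach, second_countable_topology}"
  assumes "integrable (lebesgue_on {0..T}) f" "t \<in> {0..T}"
  shows "set_integrable lebesgue {0..t} f"
  by (rule set_integrable_subset[of lebesgue "{0..T}"])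
    (use assms in \<open>auto simp: set_integrable_lebesgue_on\<close>)

text \<open>The functions are set to 0 on the null set where convergence fails; completeness of
  Lebesgue measure then allows the limit to be changed back.\<close>

lemma borel_measurable_lebesgue_on_AE_limit:
  fixes u :: "nat \<Rightarrow> 'a::euclidean_space \<Rightarrow> 'b::euclidean_space"
  assumes S: "S \<in> sets lebesgue" and u: "\<And>m. u m \<in> borel_measurable (lebesgue_on S)"
    and lim: "AE x in lebesgue_on S. (\<lambda>m. u m x) \<longlonglongrightarrow> v x"
  shows "v \<in> borel_measurable (lebesgue_on S)"
proof -
  define u' where "u' m x = (if x \<in> S then u m x else 0)" for m x
  define v' where "v' x = (if x \<in> S then v x else 0)" for x
  have u': "u' m \<in> borel_measurable lebesgue" for m
    unfolding u'_def using borel_measurable_if_I[OF u S] .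
  have "AE x in lebesgue. x \<in> S \<longrightarrow> (\<lambda>m. u m x) \<longlonglongrightarrow> v x"
    using lim S by (subst (asm) AE_restrict_space_iff) auto
  then have "AE x in lebesgue. (\<lambda>m. u' m x) \<longlonglongrightarrow> v' x"
    by eventually_elim (auto simp: u'_def v'_def)
  then obtain N where N0: "N \<in> null_sets lebesgue" and N: "{x \<in> space lebesgue. \<not> (\<lambda>m. u' m x) \<longlonglongrightarrow> v' x} \<subseteq> N"
    unfolding eventually_ae_filter by blast
  have Nn: "AE x in lebesgue. x \<notin> N" by (rule AE_not_in[OF N0])
  have "(\<lambda>x. if x \<in> N then 0 else v' x) \<in> borel_measurable lebesgue"
  proof (rule borel_measurable_LIMSEQ_metric)
    show "(\<lambda>x. if x \<in> N then 0 else u' m x) \<in> borel_measurable lebesgue" for m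
      using u' N0 by (intro measurable_If) auto
    show "(\<lambda>m. if x \<in> N then 0 else u' m x) \<longlonglongrightarrow> (if x \<in> N then 0 else v' x)" for x
      using N by auto
  qed
  moreover have "AE x in lebesgue. (if x \<in> N then 0 else v' x) = v' x"
    using Nn by eventually_elim simp
  ultimately have "v' \<in> borel_measurable lebesgue" by (rule borel_measurable_AE)
  then show ?thesis unfolding v'_def by (rule borel_measurable_if_D)
qed

text \<open>The norm and each coordinate are Lipschitz functions of a vector in ell2, so convergence
  of the simple functions in norm makes both measurable; the norm dominates the coordinate.\<close>

lemma L1_ell2_integrable:
  assumes "L1_ell2 h T g"
  shows "integrable (lebesgue_on {0..T}) (\<lambda>s. ell2_norm h (g s))"
    and "integrable (lebesgue_on {0..T}) (\<lambda>s. g s k)"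
proof -
  obtain G where G: "\<And>m. simple_function (lebesgue_on {0..T}) (G m)" "\<And>m s. s \<in> {0..T} \<Longrightarrow> G m s \<in> ell2 h"
    and lim: "AE s in lebesgue_on {0..T}. (\<lambda>m::nat. ell2_norm h (\<lambda>k. G m s k - g s k)) \<longlonglongrightarrow> 0"
    using assms unfolding L1_ell2_def by blast
  have g: "s \<in> {0..T} \<Longrightarrow> g s \<in> ell2 h" for s using assms by (auto simp: L1_ell2_def)
  have sp: "AE s in lebesgue_on {0..T}. s \<in> {0..T}"
    using AE_space[of "lebesgue_on {0..T}"] by simp
  note meas = borel_measurable_simple_function[OF simple_function_compose1[OF G(1)]]
  have mn: "(\<lambda>s. ell2_norm h (g s)) \<in> borel_measurable (lebesgue_on {0..T})"
  proof (rule borel_measurable_lebesgue_on_AE_limit)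
    show "(\<lambda>s. ell2_norm h (G m s)) \<in> borel_measurable (lebesgue_on {0..T})" for m by (rule meas)
    show "AE s in lebesgue_on {0..T}. (\<lambda>m. ell2_norm h (G m s)) \<longlonglongrightarrow> ell2_norm h (g s)"
      using lim sp
    proof eventually_elim
      case (elim s)
      show ?case
        by (rule LIM_zero_cancel, rule Lim_null_comparison[OF _ elim(1)])
          (use ell2_norm_reverse_triangle[OF G(2)[OF elim(2)] g[OF elim(2)]] in auto)
    qed
  qed simp
  have mk: "(\<lambda>s. g s k) \<in> borel_measurable (lebesgue_on {0..T})"
  proof (rule borel_measurable_lebesgue_on_AE_limit)
    show "(\<lambda>s. G m s k) \<in> borel_measurable (lebesgue_on {0..T})" for m by (rule meas)
    show "AE s in lebesgue_on {0..T}. (\<lambda>m. G m s k) \<longlonglongrightarrow> g s k"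
      using lim sp
    proof eventually_elim
      case (elim s)
      show ?case
        by (rule LIM_zero_cancel, rule Lim_null_comparison[OF _ elim(1)])
          (use cmod_le_ell2_norm[OF ell2_diff(1)[OF G(2)[OF elim(2)] g[OF elim(2)]]] in auto)
    qed
  qed simp
  show *: "integrable (lebesgue_on {0..T}) (\<lambda>s. ell2_norm h (g s))"
    using assms mn by (intro integrableI_bounded) (auto simp: L1_ell2_def)
  show "integrable (lebesgue_on {0..T}) (\<lambda>s. g s k)"
  proof (rule Bochner_Integration.integrable_bound[OF * mk])
    show "AE s in lebesgue_on {0..T}. norm (g s k) \<le> norm (ell2_norm h (g s))"
      using sp
    proof eventually_elim
      case (elim s)
      then show ?case using cmod_le_ell2_norm[OF g] by simp
    qed
  qed
qed

section \<open>Approximation of the forcing by continuous functions of time\<close>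

definition clip :: "real \<Rightarrow> complex \<Rightarrow> complex" where
  "clip B z = of_real (B / max B (cmod z)) * z"

lemma clip:
  assumes "0 < B"
  shows "cmod (clip B z) \<le> B" "cmod (clip B z) \<le> cmod z" "cmod z \<le> B \<Longrightarrow> clip B z = z"
    and "continuous_on UNIV (clip B)"
proof -
  have m: "0 < max B (cmod z)" "B \<le> max B (cmod z)" "cmod z \<le> max B (cmod z)" using assms by auto
  have e: "cmod (clip B z) = B * cmod z / max B (cmod z)"
    using assms m by (simp add: clip_def norm_mult norm_divide)
  show "cmod (clip B z) \<le> B" unfolding e
    using m assms by (subst pos_divide_le_eq) (auto intro: mult_left_mono)
  show "cmod (clip B z) \<le> cmod z" unfolding e
    using m assms by (subst pos_divide_le_eq) (auto simp: mult.commute[of B] intro: mult_left_mono)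
  show "cmod z \<le> B \<Longrightarrow> clip B z = z" using assms by (simp add: clip_def)
  show "continuous_on UNIV (clip B)"
    unfolding clip_def using assms by (intro continuous_intros) auto
qed

text \<open>Measurability yields continuous functions converging almost everywhere, but no common
  bound for them. Clipping f and its approximants to a disc, which keeps the latter continuous,
  makes dominated convergence applicable on the interval of finite measure; clipping f itself costs
  little for a large radius.\<close>

lemma continuous_L1_approximation:
  fixes f :: "real \<Rightarrow> complex"
  assumes f: "integrable (lebesgue_on {0..T}) f" and e: "0 < e"
  obtains g where "continuous_on UNIV g" "integrable (lebesgue_on {0..T}) (\<lambda>t. cmod (f t - g t))"
    "(LINT t|lebesgue_on {0..T}. cmod (f t - g t)) < e"
proof -
  let ?M = "lebesgue_on {0..T}"
  have fm: "f \<in> borel_measurable ?M" using f by simp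
  have cm: "(\<lambda>t. clip B (u t)) \<in> borel_measurable ?M" if "0 < B" "u \<in> borel_measurable ?M" for B u
    using borel_measurable_continuous_onI[OF clip(4)[OF that(1)]] measurable_compose[OF that(2)] by blast
  have "(\<lambda>n. LINT t|?M. cmod (clip (real (Suc n)) (f t) - f t)) \<longlonglongrightarrow> (LINT t|?M. 0)"
  proof (rule integral_dominated_convergence[where w = "\<lambda>t. 2 * cmod (f t)"])
    show "integrable ?M (\<lambda>t. 2 * cmod (f t))" using f by simp
    have [measurable]: "(\<lambda>t. clip (real (Suc n)) (f t)) \<in> borel_measurable ?M" for n
      by (rule cm[OF _ fm]) simp
    show "(\<lambda>t. cmod (clip (real (Suc n)) (f t) - f t)) \<in> borel_measurable ?M" for n
      using fm by measurable
    show "AE t in ?M. (\<lambda>n. cmod (clip (real (Suc n)) (f t) - f t)) \<longlonglongrightarrow> 0"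
    proof (intro AE_I2)
      fix t
      obtain N :: nat where N: "cmod (f t) \<le> real N" using real_arch_simple by blast
      show "(\<lambda>n. cmod (clip (real (Suc n)) (f t) - f t)) \<longlonglongrightarrow> 0"
        by (rule tendsto_eventually) (use N clip(3) in \<open>auto simp: eventually_sequentially intro!: exI[of _ N]\<close>)
    qed
    show "AE t in ?M. norm (cmod (clip (real (Suc n)) (f t) - f t)) \<le> 2 * cmod (f t)" for n
    proof (intro AE_I2)
      fix t
      show "norm (cmod (clip (real (Suc n)) (f t) - f t)) \<le> 2 * cmod (f t)"
        using clip(2)[of "real (Suc n)" "f t"] norm_triangle_ineq4[of "clip (real (Suc n)) (f t)" "f t"] by simp
    qed
  qed simp
  then have "\<forall>\<^sub>F n in sequentially. (LINT t|?M. cmod (clip (real (Suc n)) (f t) - f t)) < e / 2"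
    using e by (intro order_tendstoD(2)) auto
  then obtain n where n: "(LINT t|?M. cmod (clip (real (Suc n)) (f t) - f t)) < e / 2"
    using eventually_happens' sequentially_bot by blast
  define B where "B = real (Suc n)"
  have B: "0 < B" by (simp add: B_def)
  let ?f = "\<lambda>t. if t \<in> {0..T} then f t else 0"
  have "?f measurable_on UNIV"
    by (intro lebesgue_measurable_imp_measurable_on borel_measurable_if_I fm) simp_all
  \<comment> \<open>\<open>measurable_on\<close> is defined by approximation with continuous
    functions off a negligible set.\<close>
  then have "\<exists>N g. negligible N \<and> (\<forall>n. continuous_on UNIV (g n)) \<and>
      (\<forall>t. t \<notin> N \<longrightarrow> (\<lambda>n::nat. g n t) \<longlonglongrightarrow> ?f t)"
    unfolding measurable_on_def by simp
  then obtain N and g :: "nat \<Rightarrow> real \<Rightarrow> complex" where N: "negligible N" and g: "\<And>n. continuous_on UNIV (g n)"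
    and lim: "\<And>t. t \<notin> N \<Longrightarrow> (\<lambda>n. g n t) \<longlonglongrightarrow> ?f t"
    by metis
  have gm: "(\<lambda>t. clip B (g n t)) \<in> borel_measurable ?M" for n
    by (intro continuous_imp_measurable_on_sets_lebesgue continuous_on_subset[OF continuous_on_compose2[OF clip(4)[OF B] g]]) auto
  have fmeas: "finite_measure ?M" by (rule finite_measure_lebesgue_on) simp
  have bounded_int: "integrable ?M u" if "u \<in> borel_measurable ?M" "\<And>t. cmod (u t) \<le> B" for u
    by (rule finite_measure.integrable_const_bound[OF fmeas, of _ B]) (use that in auto)
  have "(\<lambda>n. LINT t|?M. cmod (clip B (f t) - clip B (g n t))) \<longlonglongrightarrow> (LINT t|?M. 0)"
  proof (rule integral_dominated_convergence[where w = "\<lambda>t. 2 * B"])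
    show "integrable ?M (\<lambda>t. 2 * B)" by (rule finite_measure.integrable_const[OF fmeas])
    show "(\<lambda>t. cmod (clip B (f t) - clip B (g n t))) \<in> borel_measurable ?M" for n
      using cm[OF B fm] gm[of n] by measurable
    have "AE t in lebesgue. t \<notin> N" by (rule AE_not_in) (use N in \<open>simp add: negligible_iff_null_sets\<close>)
    then have "AE t in ?M. t \<notin> N" by (subst AE_restrict_space_iff) auto
    moreover have "AE t in ?M. t \<in> {0..T}" using AE_space[of ?M] by simp
    ultimately show "AE t in ?M. (\<lambda>n. cmod (clip B (f t) - clip B (g n t))) \<longlonglongrightarrow> 0"
    proof eventually_elim
      case (elim t)
      have "(\<lambda>n. clip B (g n t)) \<longlonglongrightarrow> clip B (f t)"
        by (rule continuous_on_tendsto_compose[OF clip(4)[OF B]]) (use lim[OF elim(1)] elim(2) in auto)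
      then have "(\<lambda>n. cmod (clip B (f t) - clip B (g n t))) \<longlonglongrightarrow> cmod (clip B (f t) - clip B (f t))"
        by (intro tendsto_intros)
      then show ?case by simp
    qed
    show "AE t in ?M. norm (cmod (clip B (f t) - clip B (g n t))) \<le> 2 * B" for n
    proof (intro AE_I2)
      fix t
      show "norm (cmod (clip B (f t) - clip B (g n t))) \<le> 2 * B"
        using clip(1)[OF B, of "f t"] clip(1)[OF B, of "g n t"] norm_triangle_ineq4[of "clip B (f t)" "clip B (g n t)"] by simp
    qed
  qed simp
  then have "\<forall>\<^sub>F n in sequentially. (LINT t|?M. cmod (clip B (f t) - clip B (g n t))) < e / 2"
    using e by (intro order_tendstoD(2)) auto
  then obtain m where m: "(LINT t|?M. cmod (clip B (f t) - clip B (g m t))) < e / 2"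
    using eventually_happens' sequentially_bot by blast
  have ic: "integrable ?M (\<lambda>t. clip B (f t))" and ig: "integrable ?M (\<lambda>t. clip B (g m t))"
    by (intro bounded_int cm gm fm B clip(1))+
  show ?thesis
  proof (rule that[of "\<lambda>t. clip B (g m t)"])
    show "continuous_on UNIV (\<lambda>t. clip B (g m t))"
      by (rule continuous_on_compose2[OF clip(4)[OF B] g]) auto
    show i: "integrable ?M (\<lambda>t. cmod (f t - clip B (g m t)))" using f ig by simp
    have "(LINT t|?M. cmod (f t - clip B (g m t)))
        \<le> (LINT t|?M. cmod (clip B (f t) - f t) + cmod (clip B (f t) - clip B (g m t)))"
    proof (rule integral_mono[OF i])
      show "integrable ?M (\<lambda>t. cmod (clip B (f t) - f t) + cmod (clip B (f t) - clip B (g m t)))"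
        using f ic ig by simp
      show "cmod (f t - clip B (g m t)) \<le> cmod (clip B (f t) - f t) + cmod (clip B (f t) - clip B (g m t))" for t
        using norm_triangle_ineq[of "f t - clip B (f t)" "clip B (f t) - clip B (g m t)"]
        by (simp add: norm_minus_commute)
    qed
    also have "\<dots> = (LINT t|?M. cmod (clip B (f t) - f t)) + (LINT t|?M. cmod (clip B (f t) - clip B (g m t)))"
      using f ic ig by (intro Bochner_Integration.integral_add) auto
    also have "\<dots> < e" using n m by (simp add: B_def)
    finally show "(LINT t|?M. cmod (f t - clip B (g m t))) < e" .
  qed
qed

section \<open>Well-posedness for integrable data\<close>

context parabolic_kernel
begin

text \<open>The error splits into the tail outside a ball, small in L^1 by dominated convergence,
  and finitely many coordinates that are approximated one at a time. The integrable majorant d takes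
  the place of the norm of the error, whose measurability then need not be discussed.\<close>

lemma L1_ell2_approximation:
  assumes g: "L1_ell2 h T g" and e: "0 < e"
  obtains F \<phi> d where "finite F" "F \<subseteq> L" "\<And>t k. k \<notin> F \<Longrightarrow> \<phi> t k = 0"
    "\<And>k. continuous_on {0..T} (\<lambda>t. \<phi> t k)"
    "integrable (lebesgue_on {0..T}) d" "\<And>s. s \<in> {0..T} \<Longrightarrow> ell2_norm h (\<lambda>k. g s k - \<phi> s k) \<le> d s"
    "(LINT s|lebesgue_on {0..T}. d s) \<le> (e::real)"
proof -
  let ?M = "lebesgue_on {0..T}"
  have gE: "s \<in> {0..T} \<Longrightarrow> g s \<in> ell2 h" for s using g by (auto simp: L1_ell2_def)
  note gi = L1_ell2_integrable[OF g]
  have sp: "AE s in ?M. s \<in> {0..T}" using AE_space[of ?M] by simp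
  define c where "c j s = ell2_norm h (\<lambda>k. if k \<in> lattice_ball j then 0 else g s k)" for j s
  have ceq: "c j s = sqrt ((ell2_norm h (g s))\<^sup>2 - (\<Sum>k\<in>lattice_ball j. (cmod (g s k))\<^sup>2))" if "s \<in> {0..T}" for j s
    using arg_cong[OF ell2_tail_power2[OF gE[OF that] lattice_ball(1,2), of j], of sqrt]
    by (simp add: c_def)
  have cm: "c j \<in> borel_measurable ?M" for j
  proof -
    have [measurable]: "(\<lambda>s. ell2_norm h (g s)) \<in> borel_measurable ?M" "(\<lambda>s. g s k) \<in> borel_measurable ?M" for k
      using gi by auto
    have "(\<lambda>s. sqrt ((ell2_norm h (g s))\<^sup>2 - (\<Sum>k\<in>lattice_ball j. (cmod (g s k))\<^sup>2))) \<in> borel_measurable ?M"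
      by measurable
    then show ?thesis by (subst measurable_cong[OF ceq]) auto
  qed
  have cle: "c j s \<le> ell2_norm h (g s)" if "s \<in> {0..T}" for j s
    unfolding c_def by (rule ell2_cut(4)[OF gE[OF that]])
  have c0: "0 \<le> c j s" for j s by (simp add: c_def)
  have ci: "integrable ?M (c j)" for j
    by (rule Bochner_Integration.integrable_bound[OF gi(1) cm]) (use sp in \<open>eventually_elim, simp add: cle c0\<close>)
  have "(\<lambda>j. LINT s|?M. c j s) \<longlonglongrightarrow> (LINT s|?M. 0)"
  proof (rule integral_dominated_convergence[OF _ cm gi(1)])
    show "AE s in ?M. (\<lambda>j. c j s) \<longlonglongrightarrow> 0"
      using sp
    proof eventually_elim
      case (elim s)
      then show ?case unfolding c_def
        by (intro ell2_tail_tendsto gE lattice_ball lattice_ball_Un)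
    qed
    show "AE s in ?M. norm (c j s) \<le> ell2_norm h (g s)" for j
      using sp by eventually_elim (simp add: cle c0)
  qed simp
  then have "\<forall>\<^sub>F j in sequentially. (LINT s|?M. c j s) < e / 2"
    using e by (intro order_tendstoD(2)) auto
  then obtain j where j: "(LINT s|?M. c j s) < e / 2"
    using eventually_happens' sequentially_bot by blast
  define F where "F = lattice_ball j"
  have F: "finite F" "F \<subseteq> L" using lattice_ball by (auto simp: F_def)
  \<comment> \<open>Half of e is shared among the coordinates in F; the summand 1 keeps the
    denominator positive when F is empty.\<close>
  define \<epsilon> where "\<epsilon> = e / (2 * (real (card F) + 1))"
  have \<epsilon>: "0 < \<epsilon>" using e by (simp add: \<epsilon>_def)
  have "\<forall>k. \<exists>\<psi>. continuous_on UNIV \<psi> \<and> integrable ?M (\<lambda>t. cmod (g t k - \<psi> t)) \<and> (LINT t|?M. cmod (g t k - \<psi> t)) < \<epsilon>"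
  proof
    show "\<exists>\<psi>. continuous_on UNIV \<psi> \<and> integrable ?M (\<lambda>t. cmod (g t k - \<psi> t)) \<and> (LINT t|?M. cmod (g t k - \<psi> t)) < \<epsilon>" for k
      by (rule continuous_L1_approximation[OF gi(2) \<epsilon>, of k]) blast
  qed
  from choice[OF this] obtain \<psi> where \<psi>: "\<And>k. continuous_on UNIV (\<psi> k)" "\<And>k. integrable ?M (\<lambda>t. cmod (g t k - \<psi> k t))"
      "\<And>k. (LINT t|?M. cmod (g t k - \<psi> k t)) < \<epsilon>"
    by blast
  define \<phi> where "\<phi> t k = (if k \<in> F then \<psi> k t else 0)" for t k
  define d where "d s = c j s + (\<Sum>k\<in>F. cmod (g s k - \<psi> k s))" for s
  show ?thesis
  proof (rule that[of F \<phi> d])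
    show "\<phi> t k = 0" if "k \<notin> F" for t k using that by (simp add: \<phi>_def)
    show "continuous_on {0..T} (\<lambda>t. \<phi> t k)" for k
      using continuous_on_subset[OF \<psi>(1)] by (cases "k \<in> F") (auto simp: \<phi>_def)
    show "integrable ?M d" unfolding d_def
      by (intro Bochner_Integration.integrable_add Bochner_Integration.integrable_sum ci \<psi>(2))
    show "ell2_norm h (\<lambda>k. g s k - \<phi> s k) \<le> d s" if s: "s \<in> {0..T}" for s
    proof -
      let ?a = "\<lambda>k. if k \<in> F then 0 else g s k" and ?b = "\<lambda>k. if k \<in> F then g s k - \<psi> k s else 0"
      have b: "?b \<in> ell2 h" "ell2_norm h ?b = L2_set (\<lambda>k. cmod (?b k)) F"
        by (rule ell2_finite_support[OF F]; simp)+
      have "(\<lambda>k. g s k - \<phi> s k) = (\<lambda>k. ?a k + ?b k)" by (auto simp: \<phi>_def)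
      then have "ell2_norm h (\<lambda>k. g s k - \<phi> s k) \<le> ell2_norm h ?a + ell2_norm h ?b"
        using ell2_norm_triangle[OF ell2_cut(2)[OF gE[OF s], of F] b(1)] by simp
      also have "ell2_norm h ?b \<le> (\<Sum>k\<in>F. cmod (g s k - \<psi> k s))"
        unfolding b(2) using L2_set_le_sum_abs[of "\<lambda>k. cmod (?b k)" F] by (simp cong: sum.cong)
      finally show ?thesis by (simp add: d_def c_def F_def)
    qed
    have "(LINT s|?M. d s) = (LINT s|?M. c j s) + (\<Sum>k\<in>F. LINT s|?M. cmod (g s k - \<psi> k s))"
      unfolding d_def
      by (subst Bochner_Integration.integral_add)
        (auto intro!: ci \<psi>(2) Bochner_Integration.integrable_sum Bochner_Integration.integral_sum)
    also have "(\<Sum>k\<in>F. LINT s|?M. cmod (g s k - \<psi> k s)) \<le> (\<Sum>k\<in>F. \<epsilon>)"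
      by (intro sum_mono less_imp_le \<psi>(3))
    also have "(\<Sum>k\<in>F. \<epsilon>) \<le> e / 2" using e by (simp add: \<epsilon>_def field_simps)
    finally show "(LINT s|?M. d s) \<le> e" using j by simp
  qed (use F in auto)
qed

text \<open>The approximate solutions are Cauchy by the estimate for finitely supported data,
  applied to differences of data. That estimate is known for some solution of the difference
  problem; by uniqueness this solution is the difference of the two given ones.\<close>

lemma solution_exists:
  "\<exists>K\<ge>0. \<forall>w0 g. w0 \<in> ell2 h \<longrightarrow> L1_ell2 h T g \<longrightarrow>
     (\<exists>w. cauchy_solution h T act w0 g w \<and>
       (\<forall>t\<in>{0..T}. ell2_norm h (w t) \<le> K * (ell2_norm h w0 + (LINT s:{0..t}|lebesgue. ell2_norm h (g s)))))"
proof -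
  obtain K where K: "0 \<le> K" and sol: "\<And>F0 w0 \<phi>. \<lbrakk>finite F0; F0 \<subseteq> L; \<And>k. k \<notin> F0 \<Longrightarrow> w0 k = 0;
     \<And>t k. k \<notin> F0 \<Longrightarrow> \<phi> t k = 0; \<And>k. continuous_on {0..T} (\<lambda>t. \<phi> t k)\<rbrakk> \<Longrightarrow>
     \<exists>w. cauchy_solution h T act w0 \<phi> w \<and>
       (\<forall>t\<in>{0..T}. ell2_norm h (w t) \<le> K * (ell2_norm h w0 + integral {0..t} (\<lambda>s. ell2_norm h (\<phi> s))))"
    by (fact solution_finite_support)
  show ?thesis
  proof (intro exI[of _ K] conjI K allI impI)
    fix w0 :: "real^'n \<Rightarrow> complex" and g :: "real \<Rightarrow> real^'n \<Rightarrow> complex"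
    assume w0: "w0 \<in> ell2 h" and g: "L1_ell2 h T g"
    let ?M = "lebesgue_on {0..T}"
    have gE: "s \<in> {0..T} \<Longrightarrow> g s \<in> ell2 h" for s using g by (auto simp: L1_ell2_def)
    note gi = L1_ell2_integrable[OF g] and restr = set_integrable_initial_segment
    have sub: "{0..t} \<in> sets lebesgue" "{0..t} \<subseteq> {0..T}" if "t \<in> {0..T}" for t using that by auto
    have restr_le: "(LINT s:{0..t}|lebesgue. f s) \<le> (LINT s|?M. f s)"
      if "integrable ?M f" "t \<in> {0..T}" "\<And>s. s \<in> {0..T} \<Longrightarrow> 0 \<le> f s" for t and f :: "real \<Rightarrow> real"
    proof -
      have "(LINT s:{0..t}|lebesgue. f s) \<le> (LINT s:{0..T}|lebesgue. f s)"
        unfolding set_lebesgue_integral_def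
        by (rule integral_mono)
          (use restr[OF that(1,2)] that set_integrable_lebesgue_on(1)[of "{0..T}" f] in \<open>auto simp: set_integrable_def indicator_def\<close>)
      then show ?thesis by (simp add: set_integrable_lebesgue_on)
    qed
    define e where "e n = 1 / (real n + 1)" for n
    have e: "0 < e n" for n by (simp add: e_def)
    have e_lim: "e \<longlonglongrightarrow> 0" unfolding e_def using LIMSEQ_inverse_real_of_nat by (simp add: inverse_eq_divide add.commute)
    have e_mono: "n \<le> m \<Longrightarrow> e m \<le> e n" for n m by (simp add: e_def frac_le)
    define approx where "approx n F \<phi> d \<longleftrightarrow> finite F \<and> F \<subseteq> L \<and> (\<forall>t k. k \<notin> F \<longrightarrow> \<phi> t k = 0) \<and>
      (\<forall>k. continuous_on {0..T} (\<lambda>t. \<phi> t k)) \<and> integrable ?M d \<and>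
      (\<forall>s\<in>{0..T}. ell2_norm h (\<lambda>k. g s k - \<phi> s k) \<le> d s) \<and> (LINT s|?M. d s) \<le> e n" for n F \<phi> d
    have "\<exists>F \<phi> d. approx n F \<phi> d" for n
    proof -
      obtain F \<phi> d where "finite F" "F \<subseteq> L" "\<And>t k. k \<notin> F \<Longrightarrow> \<phi> t k = 0"
        "\<And>k. continuous_on {0..T} (\<lambda>t. \<phi> t k)"
        "integrable ?M d" "\<And>s. s \<in> {0..T} \<Longrightarrow> ell2_norm h (\<lambda>k. g s k - \<phi> s k) \<le> d s"
        "(LINT s|?M. d s) \<le> e n"
        by (fact L1_ell2_approximation[OF g e[of n]])
      then have "approx n F \<phi> d" unfolding approx_def by blast
      then show ?thesis by blast
    qed
    then obtain F \<phi> d where ap: "\<And>n. approx n (F n) (\<phi> n) (d n)" by metis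
    have F: "\<And>n. finite (F n)" "\<And>n. F n \<subseteq> L" and \<phi>0: "\<And>n t k. k \<notin> F n \<Longrightarrow> \<phi> n t k = 0"
      and \<phi>c: "\<And>n k. continuous_on {0..T} (\<lambda>t. \<phi> n t k)" and di: "\<And>n. integrable ?M (d n)"
      and d: "\<And>n s. s \<in> {0..T} \<Longrightarrow> ell2_norm h (\<lambda>k. g s k - \<phi> n s k) \<le> d n s"
      and de: "\<And>n. (LINT s|?M. d n s) \<le> e n"
      using ap unfolding approx_def by blast+
    have d0: "0 \<le> d n s" if "s \<in> {0..T}" for n s using d[OF that, of n] ell2_norm_nonneg order_trans by blast
    have \<phi>C: "continuous_ell2 h T (\<phi> n)" for n
      by (rule continuous_ell2_finite_support[OF F \<phi>0 \<phi>c])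
    have \<phi>E: "\<phi> n s \<in> ell2 h" if "s \<in> {0..T}" for n s using \<phi>C that by (auto simp: continuous_ell2_def)
    have "\<exists>j. ell2_norm h (\<lambda>k. if k \<in> lattice_ball j then 0 else w0 k) < e n" for n
    proof -
      have "(\<lambda>j. ell2_norm h (\<lambda>k. if k \<in> lattice_ball j then 0 else w0 k)) \<longlonglongrightarrow> 0"
        by (intro ell2_tail_tendsto w0 lattice_ball lattice_ball_Un)
      then have "\<forall>\<^sub>F j in sequentially. ell2_norm h (\<lambda>k. if k \<in> lattice_ball j then 0 else w0 k) < e n"
        using e by (intro order_tendstoD(2)) auto
      then show ?thesis using eventually_happens' sequentially_bot by blast
    qed
    then obtain r where r: "\<And>n. ell2_norm h (\<lambda>k. if k \<in> lattice_ball (r n) then 0 else w0 k) < e n" by metis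
    define u where "u n k = (if k \<in> lattice_ball (r n) then w0 k else 0)" for n k
    have uE: "u n \<in> ell2 h" for n unfolding u_def by (rule ell2_cut(1)[OF w0])
    have ue: "ell2_norm h (\<lambda>k. w0 k - u n k) \<le> e n" for n
    proof -
      have "(\<lambda>k. w0 k - u n k) = (\<lambda>k. if k \<in> lattice_ball (r n) then 0 else w0 k)" by (auto simp: u_def)
      then show ?thesis using r[of n] by simp
    qed
    define F0 where "F0 n = F n \<union> lattice_ball (r n)" for n
    have F0: "finite (F0 n)" "F0 n \<subseteq> L" for n using F lattice_ball by (auto simp: F0_def)
    have "\<exists>w. cauchy_solution h T act (u n) (\<phi> n) w \<and>
       (\<forall>t\<in>{0..T}. ell2_norm h (w t) \<le> K * (ell2_norm h (u n) + integral {0..t} (\<lambda>s. ell2_norm h (\<phi> n s))))" for n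
      by (rule sol[OF F0[of n]]) (auto simp: F0_def u_def \<phi>0 \<phi>c)
    then obtain w where w: "\<And>n. cauchy_solution h T act (u n) (\<phi> n) (w n)"
      and w_est: "\<And>n t. t \<in> {0..T} \<Longrightarrow> ell2_norm h (w n t) \<le> K * (ell2_norm h (u n) + integral {0..t} (\<lambda>s. ell2_norm h (\<phi> n s)))"
      by metis
    have wC: "continuous_ell2 h T (w n)" for n using w by (simp add: cauchy_solution_def)
    have wE: "w n t \<in> ell2 h" if "t \<in> {0..T}" for n t by (rule solution_ell2[OF w that])
    \<comment> \<open>Each initial datum is within \<open>e n\<close> of \<open>w0\<close>, and each
      forcing within \<open>e n\<close> of g in L^1, so two data pairs differ by
      \<open>2 * e n + 2 * e n\<close>.\<close>
    have close: "ell2_norm h (\<lambda>k. w i t k - w j t k) \<le> 4 * K * e n"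
      if n: "n \<le> i" "n \<le> j" and t: "t \<in> {0..T}" for i j n t
    proof -
      have z: "cauchy_solution h T act (\<lambda>k. u i k - u j k) (\<lambda>s k. \<phi> i s k - \<phi> j s k) (\<lambda>s k. w i s k - w j s k)"
        by (rule solution_diff[OF w w])
      have "\<exists>z. cauchy_solution h T act (\<lambda>k. u i k - u j k) (\<lambda>s k. \<phi> i s k - \<phi> j s k) z \<and>
        (\<forall>t\<in>{0..T}. ell2_norm h (z t) \<le> K * (ell2_norm h (\<lambda>k. u i k - u j k) + integral {0..t} (\<lambda>s. ell2_norm h (\<lambda>k. \<phi> i s k - \<phi> j s k))))"
        by (rule sol[of "F0 i \<union> F0 j"]) (use F0 in \<open>auto simp: F0_def u_def \<phi>0 intro!: continuous_on_diff \<phi>c\<close>)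
      then obtain z' where z': "cauchy_solution h T act (\<lambda>k. u i k - u j k) (\<lambda>s k. \<phi> i s k - \<phi> j s k) z'"
        "ell2_norm h (z' t) \<le> K * (ell2_norm h (\<lambda>k. u i k - u j k) + integral {0..t} (\<lambda>s. ell2_norm h (\<lambda>k. \<phi> i s k - \<phi> j s k)))"
        using t by blast
      have "ell2_norm h (\<lambda>k. w i t k - w j t k) \<le> K * (ell2_norm h (\<lambda>k. u i k - u j k) + integral {0..t} (\<lambda>s. ell2_norm h (\<lambda>k. \<phi> i s k - \<phi> j s k)))"
        using z'(2) solution_unique[OF z z'(1) t] by simp
      also have "\<dots> \<le> K * (2 * e n + 2 * e n)"
      proof (intro mult_left_mono add_mono K)
        have "ell2_norm h (\<lambda>k. u i k - u j k) \<le> ell2_norm h (\<lambda>k. u i k - w0 k) + ell2_norm h (\<lambda>k. w0 k - u j k)"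
          by (rule ell2_norm_diff_triangle[OF uE w0 uE])
        then show "ell2_norm h (\<lambda>k. u i k - u j k) \<le> 2 * e n"
          using ue[of i] ue[of j] e_mono[OF n(1)] e_mono[OF n(2)] by (simp add: ell2_norm_diff_commute[of h "u i"])
        have C: "continuous_ell2 h T (\<lambda>s k. \<phi> i s k - \<phi> j s k)"
          by (rule continuous_ell2_finite_support[of "F i \<union> F j"]) (use F in \<open>auto simp: \<phi>0 intro!: continuous_on_diff \<phi>c\<close>)
        have si: "set_integrable lebesgue {0..t} (\<lambda>s. ell2_norm h (\<lambda>k. \<phi> i s k - \<phi> j s k))"
          by (rule absolutely_integrable_continuous_real, rule continuous_on_subset[OF continuous_ell2_norm[OF C]]) (use t in auto)
        have "integral {0..t} (\<lambda>s. ell2_norm h (\<lambda>k. \<phi> i s k - \<phi> j s k)) = (LINT s:{0..t}|lebesgue. ell2_norm h (\<lambda>k. \<phi> i s k - \<phi> j s k))"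
          using set_lebesgue_integral_eq_integral(2)[OF si] by simp
        also have "\<dots> \<le> (LINT s:{0..t}|lebesgue. d i s + d j s)"
        proof (rule set_integral_mono[OF si])
          show "set_integrable lebesgue {0..t} (\<lambda>s. d i s + d j s)" by (intro restr[OF _ t] Bochner_Integration.integrable_add di)
          fix s assume "s \<in> {0..t}"
          then have s: "s \<in> {0..T}" using t by auto
          have "ell2_norm h (\<lambda>k. \<phi> i s k - \<phi> j s k) \<le> ell2_norm h (\<lambda>k. \<phi> i s k - g s k) + ell2_norm h (\<lambda>k. g s k - \<phi> j s k)"
            by (rule ell2_norm_diff_triangle[OF \<phi>E gE \<phi>E]) (rule s)+
          then show "ell2_norm h (\<lambda>k. \<phi> i s k - \<phi> j s k) \<le> d i s + d j s"
            using d[OF s, of i] d[OF s, of j] by (simp add: ell2_norm_diff_commute[of h "\<phi> i s"])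
        qed
        also have "\<dots> \<le> (LINT s|?M. d i s + d j s)"
          by (intro restr_le t Bochner_Integration.integrable_add di add_nonneg_nonneg d0)
        also have "\<dots> = (LINT s|?M. d i s) + (LINT s|?M. d j s)"
          by (intro Bochner_Integration.integral_add di)
        also have "\<dots> \<le> 2 * e n" using de[of i] de[of j] e_mono[OF n(1)] e_mono[OF n(2)] by simp
        finally show "integral {0..t} (\<lambda>s. ell2_norm h (\<lambda>k. \<phi> i s k - \<phi> j s k)) \<le> 2 * e n" .
      qed
      finally show ?thesis by simp
    qed
    have e4: "(\<lambda>n. 4 * K * e n) \<longlonglongrightarrow> 0" using tendsto_mult_left[OF e_lim, of "4 * K"] by simp
    have "\<exists>W. continuous_ell2 h T W \<and> (\<forall>n\<ge>0. \<forall>t\<in>{0..T}. ell2_norm h (\<lambda>k. w n t k - W t k) \<le> 4 * K * e n)"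
      by (rule uniformly_cauchy_ell2_limit[OF wC close e4])
    then obtain W where WC: "continuous_ell2 h T W"
      and closeW: "\<And>n t. t \<in> {0..T} \<Longrightarrow> ell2_norm h (\<lambda>k. w n t k - W t k) \<le> 4 * K * e n"
      by blast
    have WE: "W t \<in> ell2 h" if "t \<in> {0..T}" for t using WC that by (auto simp: continuous_ell2_def)
    have ik: "set_integrable lebesgue {0..t} (\<lambda>s. g s k)" if "t \<in> {0..T}" for t k by (rule restr[OF gi(2) that])
    have i\<phi>: "set_integrable lebesgue {0..t} (\<lambda>s. \<phi> n s k)" if "t \<in> {0..T}" for n t k
      by (rule absolutely_integrable_continuous_real, rule continuous_on_subset[OF \<phi>c]) (use that in auto)
    have eqW: "W t k = w0 k + (LINT s:{0..t}|lebesgue. act (W s) k + g s k)" if t: "t \<in> {0..T}" and k: "k \<in> L" for t k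
    proof (rule limit_of_solutions[OF WC wC closeW e4 t k _ i\<phi>[OF t] ik[OF t], of 0])
      show "(\<lambda>n. u n k) \<longlonglongrightarrow> w0 k"
      proof (rule LIM_zero_cancel, rule Lim_null_comparison[OF _ e_lim], rule always_eventually, rule allI)
        fix n
        show "norm (u n k - w0 k) \<le> e n"
          using cmod_le_ell2_norm[OF ell2_diff(1)[OF w0 uE[of n]], of k] ue[of n] by (simp add: norm_minus_commute)
      qed
      show "(\<lambda>n. LINT s:{0..t}|lebesgue. \<phi> n s k) \<longlonglongrightarrow> (LINT s:{0..t}|lebesgue. g s k)"
      proof (rule LIM_zero_cancel, rule Lim_null_comparison[OF _ e_lim], rule always_eventually, rule allI)
        fix n
        have id: "set_integrable lebesgue {0..t} (\<lambda>s. \<phi> n s k - g s k)" by (intro set_integral_diff(1) i\<phi> ik t)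
        have "norm ((LINT s:{0..t}|lebesgue. \<phi> n s k) - (LINT s:{0..t}|lebesgue. g s k)) = norm (LINT s:{0..t}|lebesgue. \<phi> n s k - g s k)"
          using set_integral_diff(2)[OF i\<phi>[OF t] ik[OF t], of n k k] by simp
        also have "\<dots> \<le> (LINT s:{0..t}|lebesgue. norm (\<phi> n s k - g s k))" by (rule set_integral_norm_bound[OF id])
        also have "\<dots> \<le> (LINT s:{0..t}|lebesgue. d n s)"
        proof (rule set_integral_mono[OF set_integrable_norm[OF id] restr[OF di t]])
          fix s assume "s \<in> {0..t}"
          then have s: "s \<in> {0..T}" using t by auto
          show "norm (\<phi> n s k - g s k) \<le> d n s"
            using cmod_le_ell2_norm[OF ell2_diff(1)[OF gE[OF s] \<phi>E[OF s, of n]], of k] d[OF s, of n] by (simp add: norm_minus_commute)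
        qed
        also have "\<dots> \<le> (LINT s|?M. d n s)" by (intro restr_le di t d0)
        also have "\<dots> \<le> e n" by (rule de)
        finally show "norm ((LINT s:{0..t}|lebesgue. \<phi> n s k) - (LINT s:{0..t}|lebesgue. g s k)) \<le> e n" .
      qed
      show "w n t k = u n k + (LINT s:{0..t}|lebesgue. act (w n s) k + \<phi> n s k)" for n
        using w[of n] t k by (simp add: cauchy_solution_def)
    qed
    show "\<exists>w. cauchy_solution h T act w0 g w \<and>
       (\<forall>t\<in>{0..T}. ell2_norm h (w t) \<le> K * (ell2_norm h w0 + (LINT s:{0..t}|lebesgue. ell2_norm h (g s))))"
    proof (intro exI[of _ W] conjI ballI)
      show "cauchy_solution h T act w0 g W"
        unfolding cauchy_solution_def
        using WC eqW set_integral_add(1)[OF set_integrable_act[OF WC] ik] by blast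
      fix t assume t: "t \<in> {0..T}"
      let ?R = "K * (ell2_norm h w0 + (LINT s:{0..t}|lebesgue. ell2_norm h (g s)))"
      \<comment> \<open>\<open>4 * K * e n\<close> is the distance from the limit to
        \<open>w n\<close>; the remaining \<open>2 * K * e n\<close> comes from replacing the
        approximate data by \<open>w0\<close> and g.\<close>
      have bound: "ell2_norm h (W t) \<le> ?R + 6 * K * e n" for n
      proof -
        have si: "set_integrable lebesgue {0..t} (\<lambda>s. ell2_norm h (\<phi> n s))"
          by (rule absolutely_integrable_continuous_real, rule continuous_on_subset[OF continuous_ell2_norm[OF \<phi>C]]) (use t in auto)
        have "integral {0..t} (\<lambda>s. ell2_norm h (\<phi> n s)) = (LINT s:{0..t}|lebesgue. ell2_norm h (\<phi> n s))"
          using set_lebesgue_integral_eq_integral(2)[OF si] by simp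
        also have "\<dots> \<le> (LINT s:{0..t}|lebesgue. ell2_norm h (g s) + d n s)"
        proof (rule set_integral_mono[OF si])
          show "set_integrable lebesgue {0..t} (\<lambda>s. ell2_norm h (g s) + d n s)"
            by (intro restr[OF _ t] Bochner_Integration.integrable_add di gi)
          fix s assume "s \<in> {0..t}"
          then have s: "s \<in> {0..T}" using t by auto
          show "ell2_norm h (\<phi> n s) \<le> ell2_norm h (g s) + d n s"
            using ell2_norm_triangle_sub[OF \<phi>E[OF s, of n] gE[OF s]] d[OF s, of n] by (simp add: ell2_norm_diff_commute[of h "\<phi> n s"])
        qed
        also have "\<dots> = (LINT s:{0..t}|lebesgue. ell2_norm h (g s)) + (LINT s:{0..t}|lebesgue. d n s)"
          by (intro set_integral_add(2) restr[OF _ t] di gi)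
        also have "\<dots> \<le> (LINT s:{0..t}|lebesgue. ell2_norm h (g s)) + e n"
          using restr_le[OF di[of n] t d0] de[of n] by simp
        finally have 1: "integral {0..t} (\<lambda>s. ell2_norm h (\<phi> n s)) \<le> (LINT s:{0..t}|lebesgue. ell2_norm h (g s)) + e n" .
        have 2: "ell2_norm h (u n) \<le> ell2_norm h w0 + e n"
          using ell2_norm_triangle_sub[OF uE[of n] w0] ue[of n] by (simp add: ell2_norm_diff_commute[of h "u n"])
        have "ell2_norm h (W t) \<le> ell2_norm h (w n t) + 4 * K * e n"
          using ell2_norm_triangle_sub[OF WE[OF t] wE[OF t, of n]] closeW[OF t, of n] by (simp add: ell2_norm_diff_commute[of h "W t"])
        also have "ell2_norm h (w n t) \<le> K * ((ell2_norm h w0 + e n) + ((LINT s:{0..t}|lebesgue. ell2_norm h (g s)) + e n))"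
          by (rule order_trans[OF w_est[OF t]]) (intro mult_left_mono add_mono K 1 2)
        finally show ?thesis by (simp add: algebra_simps)
      qed
      show "ell2_norm h (W t) \<le> ?R"
      proof (rule tendsto_lowerbound)
        have "(\<lambda>n. ?R + 6 * K * e n) \<longlonglongrightarrow> ?R + 6 * K * 0" by (intro tendsto_intros e_lim)
        then show "(\<lambda>n. ?R + 6 * K * e n) \<longlonglongrightarrow> ?R" by simp
        show "\<forall>\<^sub>F n in sequentially. ell2_norm h (W t) \<le> ?R + 6 * K * e n"
          by (intro always_eventually allI bound)
      qed simp
    qed
  qed
qed

text \<open>The estimate with \<open>L\<^sup>1\<close> norms in time implies the one with \<open>L\<^sup>2\<close> norms by the
  Cauchy-Schwarz inequality on \<open>[0,t]\<close>.\<close>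

lemma well_posed:
  "\<exists>C>0. \<forall>w0 g. w0 \<in> ell2 h \<and> L1_ell2 h T g \<longrightarrow>
     (\<exists>w. cauchy_solution h T act w0 g w \<and>
       (\<forall>w'. cauchy_solution h T act w0 g w' \<longrightarrow> (\<forall>t\<in>{0..T}. w' t = w t)) \<and>
       (\<forall>t\<in>{0..T}. ennreal ((ell2_norm h (w t))\<^sup>2)
          \<le> ennreal C * (ennreal ((ell2_norm h w0)\<^sup>2)
              + (\<integral>\<^sup>+s\<in>{0..t}. ennreal ((ell2_norm h (g s))\<^sup>2) \<partial>lebesgue))))"
proof -
  obtain K where K: "0 \<le> K" and sol: "\<And>w0 g. w0 \<in> ell2 h \<Longrightarrow> L1_ell2 h T g \<Longrightarrow>
     \<exists>w. cauchy_solution h T act w0 g w \<and>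
       (\<forall>t\<in>{0..T}. ell2_norm h (w t) \<le> K * (ell2_norm h w0 + (LINT s:{0..t}|lebesgue. ell2_norm h (g s))))"
    using solution_exists by blast
  \<comment> \<open>The 2 comes from squaring a sum of two terms, the T from Cauchy-Schwarz on an
    interval of length at most T. The final 1 makes C positive even if K is 0.\<close>
  define C where "C = 2 * K\<^sup>2 * (1 + T) + 1"
  have C: "0 < C" using T_pos by (simp add: C_def add_nonneg_pos)
  show ?thesis
  proof (intro exI[of _ C] conjI C allI impI)
    fix w0 :: "real^'n \<Rightarrow> complex" and g :: "real \<Rightarrow> real^'n \<Rightarrow> complex"
    assume "w0 \<in> ell2 h \<and> L1_ell2 h T g"
    then have w0: "w0 \<in> ell2 h" and g: "L1_ell2 h T g" by auto
    obtain w where w: "cauchy_solution h T act w0 g w"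
      and est: "\<And>t. t \<in> {0..T} \<Longrightarrow> ell2_norm h (w t) \<le> K * (ell2_norm h w0 + (LINT s:{0..t}|lebesgue. ell2_norm h (g s)))"
      using sol[OF w0 g] by blast
    have "ennreal ((ell2_norm h (w t))\<^sup>2) \<le> ennreal C * (ennreal ((ell2_norm h w0)\<^sup>2)
              + (\<integral>\<^sup>+s\<in>{0..t}. ennreal ((ell2_norm h (g s))\<^sup>2) \<partial>lebesgue))" if t: "t \<in> {0..T}" for t
    proof -
      let ?M = "lebesgue_on {0..t}"
      have i: "integrable ?M (\<lambda>s. ell2_norm h (g s))"
        using set_integrable_initial_segment[OF L1_ell2_integrable(1)[OF g] t] by (simp add: set_integrable_lebesgue_on)
      then have m: "(\<lambda>s. ennreal (ell2_norm h (g s))) \<in> borel_measurable ?M" by simp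
      define a where "a = (LINT s:{0..t}|lebesgue. ell2_norm h (g s))"
      define I where "I = (\<integral>\<^sup>+s\<in>{0..t}. ennreal ((ell2_norm h (g s))\<^sup>2) \<partial>lebesgue)"
      have I: "I = (\<integral>\<^sup>+s. (ennreal (ell2_norm h (g s)))\<^sup>2 \<partial>?M)"
        by (simp add: I_def nn_integral_restrict_space ennreal_power)
      have a: "a = integral\<^sup>L ?M (\<lambda>s. ell2_norm h (g s))" by (simp add: a_def set_integrable_lebesgue_on)
      have a0: "0 \<le> a" unfolding a by (intro Bochner_Integration.integral_nonneg) simp
      have "ennreal a = (\<integral>\<^sup>+s. ennreal (ell2_norm h (g s)) * 1 \<partial>?M)"
        unfolding a using nn_integral_eq_integral[OF i] by simp
      then have "(ennreal a)\<^sup>2 \<le> I * (\<integral>\<^sup>+s. 1\<^sup>2 \<partial>?M)"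
        unfolding I using Cauchy_Schwarz_nn_integral[OF m, of "\<lambda>s. 1"] by simp
      also have "(\<integral>\<^sup>+s. 1\<^sup>2 \<partial>?M) = ennreal t"
        using t by (simp add: emeasure_restrict_space)
      finally have aI: "(ennreal a)\<^sup>2 \<le> I * ennreal t" .
      show ?thesis
      proof (cases "I = top")
        \<comment> \<open>Here positivity of C matters: 0 times infinity would be 0.\<close>
        case True
        then show ?thesis using C by (simp add: I_def[symmetric] ennreal_mult_top)
      next
        case False
        then obtain J where J: "I = ennreal J" "0 \<le> J" by (cases I) auto
        have "ennreal (a\<^sup>2) \<le> ennreal (J * t)"
          using aI t J a0 by (simp add: ennreal_power ennreal_mult)
        then have "a\<^sup>2 \<le> J * t" using J t by (subst (asm) ennreal_le_iff) auto
        also have "J * t \<le> J * T" using t J by (intro mult_left_mono) auto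
        finally have aJT: "a\<^sup>2 \<le> J * T" .
        have "(ell2_norm h (w t))\<^sup>2 \<le> (K * (ell2_norm h w0 + a))\<^sup>2"
          using est[OF t] by (intro power_mono) (auto simp: a_def)
        also have "\<dots> = K\<^sup>2 * (ell2_norm h w0 + a)\<^sup>2" by (simp add: power_mult_distrib)
        also have "\<dots> \<le> K\<^sup>2 * (2 * ((ell2_norm h w0)\<^sup>2 + a\<^sup>2))"
          using sum_squares_bound[of "ell2_norm h w0" a] by (intro mult_left_mono) (auto simp: power2_sum)
        also have "K\<^sup>2 * (2 * ((ell2_norm h w0)\<^sup>2 + a\<^sup>2)) \<le> K\<^sup>2 * (2 * ((ell2_norm h w0)\<^sup>2 + J * T))"
          using aJT by (intro mult_left_mono) auto
        also have "\<dots> \<le> K\<^sup>2 * (2 * ((1 + T) * ((ell2_norm h w0)\<^sup>2 + J)))"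
          using J T_pos by (intro mult_left_mono) (auto simp: algebra_simps)
        also have "\<dots> \<le> C * ((ell2_norm h w0)\<^sup>2 + J)"
          using J by (simp add: C_def algebra_simps)
        finally have "ennreal ((ell2_norm h (w t))\<^sup>2) \<le> ennreal (C * ((ell2_norm h w0)\<^sup>2 + J))"
          by (rule ennreal_leI)
        also have "\<dots> = ennreal C * (ennreal ((ell2_norm h w0)\<^sup>2) + I)"
          using C J by (simp add: ennreal_mult)
        finally show ?thesis by (simp add: I_def)
      qed
    qed
    then show "\<exists>w. cauchy_solution h T act w0 g w \<and>
       (\<forall>w'. cauchy_solution h T act w0 g w' \<longrightarrow> (\<forall>t\<in>{0..T}. w' t = w t)) \<and>
       (\<forall>t\<in>{0..T}. ennreal ((ell2_norm h (w t))\<^sup>2)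
          \<le> ennreal C * (ennreal ((ell2_norm h w0)\<^sup>2)
              + (\<integral>\<^sup>+s\<in>{0..t}. ennreal ((ell2_norm h (g s))\<^sup>2) \<partial>lebesgue)))"
      using w solution_unique[OF w] by blast
  qed
qed

end

section \<open>Kernels with rapid off-diagonal decay\<close>

lemma abs_bracket [simp]: "\<bar>bracket k\<bar> = bracket k"
  by (simp add: less_imp_le)

lemma bracket_minus_commute: "bracket (k - m) = bracket (m - k)"
  by (simp add: bracket_def norm_minus_commute)

lemma peetre: "bracket k \<le> bracket m * bracket (k - m)"
proof -
  have "norm k \<le> norm m + norm (k - m)" using norm_triangle_sub[of k m] by simp
  moreover have "0 \<le> norm m * norm (k - m)" by simp
  moreover have "bracket m * bracket (k - m) = 1 + norm m + norm (k - m) + norm m * norm (k - m)"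
    by (simp add: bracket_def algebra_simps)
  ultimately show ?thesis unfolding bracket_def[of k] by linarith
qed

text \<open>For negative s the roles of k and m are exchanged in Peetre's inequality, whence the
  absolute value in the exponent of the difference.\<close>

lemma peetre_powr: "bracket k powr s \<le> bracket m powr s * bracket (k - m) powr \<bar>s\<bar>"
proof (cases "0 \<le> s")
  case True
  then show ?thesis
    using powr_mono2[OF True _ peetre[of k m]] by (simp add: powr_mult less_imp_le)
next
  case False
  then have "bracket m powr (- s) \<le> (bracket k * bracket (k - m)) powr (- s)"
    using peetre[of m k] by (intro powr_mono2) (auto simp: bracket_minus_commute[of m] less_imp_le)
  then have "bracket m powr (- s) \<le> bracket k powr (- s) * bracket (k - m) powr \<bar>s\<bar>"
    using False by (simp add: powr_mult less_imp_le)
  then show ?thesis by (simp add: powr_minus field_simps)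
qed

lemma bracket_powr_mono: "s \<le> t \<Longrightarrow> bracket k powr s \<le> bracket k powr t"
  by (rule powr_mono) auto

text \<open>This controls the commutator with a weight. Put x = \<open>bracket k / bracket m\<close>
  and N = \<open>bracket (k - m)\<close>. By Peetre, x lies in [1/N, N], so the mean value theorem
  bounds the difference by |q| N^|q - 1| |x - 1|, and |x - 1| is at most N^2 /
  \<open>bracket k\<close>. The division by \<open>bracket k\<close> lowers the order by one; the
  powers of N are paid by off-diagonal decay.\<close>

lemma bracket_quotient_powr:
  "\<bar>(bracket k / bracket m) powr q - 1\<bar> \<le> \<bar>q\<bar> * (bracket (k - m) powr (2 + \<bar>q - 1\<bar>) / bracket k)"
proof -
  define x where "x = bracket k / bracket m"
  define N where "N = bracket (k - m)"
  have N1: "1 \<le> N" and N0: "0 < N" by (simp_all add: N_def)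
  have x0: "0 < x" by (simp add: x_def)
  have xN: "x \<le> N" unfolding x_def N_def using peetre[of k m] by (simp add: field_simps)
  have xN': "1 / N \<le> x" unfolding x_def N_def
    using peetre[of m k] by (simp add: field_simps bracket_minus_commute[of m])
  have "\<exists>\<xi>. 1 / N \<le> \<xi> \<and> \<xi> \<le> N \<and> x powr q - 1 = q * \<xi> powr (q - 1) * (x - 1)"
  proof -
    have d: "((\<lambda>x. x powr q) has_real_derivative q * \<xi> powr (q - 1)) (at \<xi>)" if "0 < \<xi>" for \<xi>
      using that by (auto intro!: derivative_eq_intros simp: powr_diff field_simps)
    have N': "1 / N \<le> 1" using N1 by simp
    consider "x < 1" | "x = 1" | "1 < x" by linarith
    then show ?thesis
    proof cases
      case 1
      then obtain \<xi> where "x < \<xi>" "\<xi> < 1" "1 powr q - x powr q = (1 - x) * (q * \<xi> powr (q - 1))"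
        using MVT2[OF 1, of "\<lambda>x. x powr q" "\<lambda>\<xi>. q * \<xi> powr (q - 1)"] d x0 by force
      then show ?thesis using xN' N1 by (intro exI[of _ \<xi>]) (auto simp: algebra_simps)
    next
      case 2
      then show ?thesis using N1 N' by (intro exI[of _ 1]) auto
    next
      case 3
      obtain \<xi> where "1 < \<xi>" "\<xi> < x" "x powr q - 1 powr q = (x - 1) * (q * \<xi> powr (q - 1))"
        using MVT2[OF 3, of "\<lambda>x. x powr q" "\<lambda>\<xi>. q * \<xi> powr (q - 1)"] d by force
      moreover have "1 / N \<le> \<xi>" using N' \<open>1 < \<xi>\<close> by linarith
      ultimately show ?thesis using xN by (intro exI[of _ \<xi>]) (auto simp: algebra_simps)
    qed
  qed
  then obtain \<xi> where \<xi>: "1 / N \<le> \<xi>" "\<xi> \<le> N" "x powr q - 1 = q * \<xi> powr (q - 1) * (x - 1)" by blast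
  have \<xi>0: "0 < \<xi>" using \<xi>(1) N0 by (meson less_le_trans zero_less_divide_1_iff)
  have "\<xi> powr (q - 1) \<le> N powr \<bar>q - 1\<bar>"
  proof (cases "0 \<le> q - 1")
    case True
    then show ?thesis using \<xi> \<xi>0 by (simp add: powr_mono2)
  next
    case False
    have "(1 / \<xi>) powr (1 - q) \<le> N powr (1 - q)"
      using False \<xi> \<xi>0 N0 by (intro powr_mono2) (auto simp: field_simps)
    moreover have "(1 / \<xi>) powr (1 - q) = \<xi> powr - (1 - q)"
      unfolding powr_minus_divide using \<xi>0 by (simp add: powr_divide)
    ultimately show ?thesis using False by simp
  qed
  moreover have "\<bar>x - 1\<bar> \<le> N\<^sup>2 / bracket k"
  proof -
    have "x - 1 = (bracket k - bracket m) / bracket m" by (simp add: x_def diff_divide_distrib)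
    then have "\<bar>x - 1\<bar> = \<bar>bracket k - bracket m\<bar> / bracket m" by (simp add: abs_divide)
    also have "\<dots> \<le> N / bracket m"
      using norm_triangle_ineq3[of k m] by (intro divide_right_mono) (auto simp: bracket_def N_def)
    also have "\<dots> \<le> N\<^sup>2 / bracket k"
      using peetre[of k m] N0 by (simp add: N_def field_simps power2_eq_square)
    finally show ?thesis .
  qed
  ultimately have "\<bar>q\<bar> * (\<xi> powr (q - 1) * \<bar>x - 1\<bar>) \<le> \<bar>q\<bar> * (N powr \<bar>q - 1\<bar> * (N\<^sup>2 / bracket k))"
    by (intro mult_left_mono mult_mono) auto
  also have "N powr \<bar>q - 1\<bar> * (N\<^sup>2 / bracket k) = N powr (2 + \<bar>q - 1\<bar>) / bracket k"
    using N0 by (simp add: powr_add powr_numeral mult_ac)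
  finally show ?thesis unfolding \<xi>(3) x_def[symmetric] N_def by (simp add: abs_mult mult_ac)
qed

section \<open>Lattice sums and Schur's test\<close>

lemma lattice_diff: "k \<in> scaled_lattice h \<Longrightarrow> m \<in> scaled_lattice h \<Longrightarrow> k - m \<in> scaled_lattice h"
proof -
  assume "k \<in> scaled_lattice h" "m \<in> scaled_lattice h"
  then obtain a b where "k = h *\<^sub>R (\<chi> j. of_int (a $ j))" "m = h *\<^sub>R (\<chi> j. of_int (b $ j))"
    unfolding scaled_lattice_def by blast
  then have "k - m = h *\<^sub>R (\<chi> j. of_int ((a - b) $ j))" by (simp add: vec_eq_iff algebra_simps)
  then show ?thesis unfolding scaled_lattice_def by blast
qed

lemma lattice_zero: "0 \<in> scaled_lattice h"
  unfolding scaled_lattice_def by (auto intro!: exI[of _ 0] simp: vec_eq_iff)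

lemma lattice_uminus: "k \<in> scaled_lattice h \<Longrightarrow> - k \<in> scaled_lattice h"
  using lattice_diff[OF lattice_zero] by fastforce

lemma lattice_add: "k \<in> scaled_lattice h \<Longrightarrow> m \<in> scaled_lattice h \<Longrightarrow> k + m \<in> scaled_lattice h"
  using lattice_diff[of k h "- m"] lattice_uminus by fastforce

lemma sum_inverse_squares_int:
  "(\<Sum>i\<in>{- int K..int K}. 1 / (1 + \<bar>real_of_int i\<bar>)\<^sup>2) \<le> 4"
proof -
  \<comment> \<open>The sharper bound makes the induction telescope: 2/(K+2)^2 is at most 2/(K+1) -
    2/(K+2).\<close>
  have "(\<Sum>i\<in>{- int K..int K}. 1 / (1 + \<bar>real_of_int i\<bar>)\<^sup>2) \<le> 4 - 2 / (real K + 1)"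
  proof (induction K)
    case (Suc K)
    have "{- int (Suc K)..int (Suc K)} = insert (- int (Suc K)) (insert (int (Suc K)) {- int K..int K})" by auto
    then have "(\<Sum>i\<in>{- int (Suc K)..int (Suc K)}. 1 / (1 + \<bar>real_of_int i\<bar>)\<^sup>2)
        = 2 / (real K + 2)\<^sup>2 + (\<Sum>i\<in>{- int K..int K}. 1 / (1 + \<bar>real_of_int i\<bar>)\<^sup>2)"
      by simp
    also have "\<dots> \<le> 2 / (real K + 2)\<^sup>2 + (4 - 2 / (real K + 1))" using Suc.IH by simp
    also have "\<dots> \<le> 4 - 2 / (real (Suc K) + 1)"
      by (simp add: divide_simps power2_eq_square) (simp add: algebra_simps)
    finally show ?case .
  qed simp
  also have "\<dots> \<le> 4" by simp
  finally show ?thesis .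
qed

text \<open>With the exponent twice the dimension the sum factorizes:
  \<open>h * (1 + \<bar>z j\<bar>)\<close> is at most the bracket for every coordinate j, so two
  powers may be spent on each coordinate, leaving a product of one-dimensional sums of at most 4 /
  h^2. Translation reduces the general k to 0.\<close>

lemma lattice_sum_bounded:
  fixes h :: real
  assumes h: "0 < h" "h \<le> 1"
  shows "\<exists>S>0. \<forall>k F. k \<in> scaled_lattice h \<longrightarrow> finite F \<longrightarrow> F \<subseteq> (scaled_lattice h :: (real^'n) set) \<longrightarrow>
    (\<Sum>m\<in>F. bracket (k - m) powr - (2 * real CARD('n))) \<le> S"
proof -
  define S where "S = (4 / h\<^sup>2) ^ CARD('n)"
  have main: "(\<Sum>m\<in>F. bracket m powr - (2 * real CARD('n))) \<le> S"
    if F: "finite F" "F \<subseteq> (scaled_lattice h :: (real^'n) set)" for F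
  proof -
    define E where "E z = (h *\<^sub>R (\<chi> j. of_int (z j)) :: real^'n)" for z :: "'n \<Rightarrow> int"
    have injE: "inj E" using h by (auto simp: inj_def E_def vec_eq_iff fun_eq_iff)
    define Z where "Z = E -` F"
    have Z: "finite Z" unfolding Z_def by (rule finite_vimageI[OF F(1) injE])
    have FE: "F = E ` Z"
    proof -
      have "k \<in> E ` Z" if k: "k \<in> F" for k
      proof -
        obtain m :: "int^'n" where "k = h *\<^sub>R (\<chi> j. of_int (m $ j))" using F(2) k unfolding scaled_lattice_def by blast
        then have "k = E (vec_nth m)" by (simp add: E_def)
        then show ?thesis using k by (auto simp: Z_def)
      qed
      then show ?thesis by (auto simp: Z_def)
    qed
    obtain K :: nat where K: "\<And>z j. z \<in> Z \<Longrightarrow> \<bar>z j\<bar> \<le> int K"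
    proof
      fix z j assume "z \<in> Z"
      have "nat \<bar>z j\<bar> \<le> (\<Sum>i\<in>UNIV. nat \<bar>z i\<bar>)" by (rule member_le_sum) auto
      also have "\<dots> \<le> (\<Sum>z\<in>Z. \<Sum>i\<in>UNIV. nat \<bar>z i\<bar>)"
        by (rule member_le_sum[where f = "\<lambda>z. \<Sum>i\<in>UNIV. nat \<bar>z i\<bar>"]) (use Z \<open>z \<in> Z\<close> in auto)
      finally show "\<bar>z j\<bar> \<le> int (\<Sum>z\<in>Z. \<Sum>i\<in>UNIV. nat \<bar>z i\<bar>)" by linarith
    qed
    have point: "bracket (E z) powr - (2 * real CARD('n)) \<le> (\<Prod>j\<in>UNIV. (1 / h\<^sup>2) * (1 / (1 + \<bar>real_of_int (z j)\<bar>)\<^sup>2))" for z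
    proof -
      have b: "h * (1 + \<bar>real_of_int (z j)\<bar>) \<le> bracket (E z)" for j
      proof -
        have "\<bar>E z $ j\<bar> = h * \<bar>real_of_int (z j)\<bar>" using h by (simp add: E_def abs_mult)
        then have "h * \<bar>real_of_int (z j)\<bar> \<le> norm (E z)" using component_le_norm_cart[of "E z" j] by simp
        moreover have "h * (1 + \<bar>real_of_int (z j)\<bar>) = h + h * \<bar>real_of_int (z j)\<bar>" by (rule distrib_left[of h 1, simplified])
        ultimately show ?thesis using h unfolding bracket_def by linarith
      qed
      have "bracket (E z) powr - (2 * real CARD('n)) = (\<Prod>j\<in>(UNIV::'n set). 1 / (bracket (E z))\<^sup>2)"
      proof -
        have "bracket (E z) powr (2 * real CARD('n)) = (bracket (E z))\<^sup>2 ^ CARD('n)"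
          using powr_realpow[of "bracket (E z)" "2 * CARD('n)"] by (simp add: power_mult)
        then show ?thesis by (simp add: powr_minus power_one_over inverse_eq_divide)
      qed
      also have "\<dots> \<le> (\<Prod>j\<in>UNIV. (1 / h\<^sup>2) * (1 / (1 + \<bar>real_of_int (z j)\<bar>)\<^sup>2))"
      proof (rule prod_mono)
        fix j :: 'n
        have "(h * (1 + \<bar>real_of_int (z j)\<bar>))\<^sup>2 \<le> (bracket (E z))\<^sup>2"
          using b[of j] h by (intro power_mono) auto
        then have "1 / (bracket (E z))\<^sup>2 \<le> 1 / (h * (1 + \<bar>real_of_int (z j)\<bar>))\<^sup>2"
          using h by (intro divide_left_mono) (auto intro!: mult_pos_pos)
        then show "0 \<le> 1 / (bracket (E z))\<^sup>2 \<and> 1 / (bracket (E z))\<^sup>2 \<le> (1 / h\<^sup>2) * (1 / (1 + \<bar>real_of_int (z j)\<bar>)\<^sup>2)"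
          by (simp add: power_mult_distrib)
      qed
      finally show ?thesis .
    qed
    have "(\<Sum>m\<in>F. bracket m powr - (2 * real CARD('n))) = (\<Sum>z\<in>Z. bracket (E z) powr - (2 * real CARD('n)))"
      unfolding FE by (subst sum.reindex) (use injE in \<open>auto intro: inj_on_subset\<close>)
    also have "\<dots> \<le> (\<Sum>z\<in>Z. \<Prod>j\<in>UNIV. (1 / h\<^sup>2) * (1 / (1 + \<bar>real_of_int (z j)\<bar>)\<^sup>2))"
      by (intro sum_mono point)
    also have "\<dots> \<le> (\<Sum>z\<in>PiE (UNIV::'n set) (\<lambda>_. {- int K..int K}). \<Prod>j\<in>UNIV. (1 / h\<^sup>2) * (1 / (1 + \<bar>real_of_int (z j)\<bar>)\<^sup>2))"
    proof (rule sum_mono2)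
      show "finite (PiE (UNIV::'n set) (\<lambda>_. {- int K..int K}))" by (intro finite_PiE) auto
      show "Z \<subseteq> PiE UNIV (\<lambda>_. {- int K..int K})"
      proof
        fix z assume "z \<in> Z"
        then have "- int K \<le> z j \<and> z j \<le> int K" for j using K[of z j] by linarith
        then show "z \<in> PiE UNIV (\<lambda>_. {- int K..int K})" by auto
      qed
    qed (auto intro!: prod_nonneg)
    also have "\<dots> = (\<Prod>j\<in>(UNIV::'n set). \<Sum>i\<in>{- int K..int K}. (1 / h\<^sup>2) * (1 / (1 + \<bar>real_of_int i\<bar>)\<^sup>2))"
      by (rule prod_sum_PiE[symmetric]) auto
    also have "\<dots> \<le> S"
    proof -
      have "(\<Sum>i\<in>{- int K..int K}. (1 / h\<^sup>2) * (1 / (1 + \<bar>real_of_int i\<bar>)\<^sup>2)) \<le> (1 / h\<^sup>2) * 4"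
        unfolding sum_distrib_left[symmetric] by (intro mult_left_mono sum_inverse_squares_int) auto
      then show ?thesis unfolding S_def by (simp add: power_mono sum_nonneg)
    qed
    finally show ?thesis .
  qed
  show ?thesis
  proof (intro exI[of _ S] conjI allI impI)
    show "0 < S" using h by (simp add: S_def)
    fix k :: "real^'n" and F assume k: "k \<in> scaled_lattice h" and F: "finite F" "F \<subseteq> (scaled_lattice h :: (real^'n) set)"
    have "(\<Sum>m\<in>F. bracket (k - m) powr - (2 * real CARD('n))) = (\<Sum>m\<in>(\<lambda>m. k - m) ` F. bracket m powr - (2 * real CARD('n)))"
      by (subst sum.reindex) (auto simp: inj_on_def)
    also have "\<dots> \<le> S" by (rule main) (use F k in \<open>auto intro: lattice_diff\<close>)
    finally show "(\<Sum>m\<in>F. bracket (k - m) powr - (2 * real CARD('n))) \<le> S" .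
  qed
qed

text \<open>Cauchy-Schwarz with b written as \<open>sqrt b * sqrt b\<close>: one factor produces the
  row sums, the other, after summing over k, the column sums.\<close>

lemma schur_test:
  fixes b :: "'a \<Rightarrow> 'a \<Rightarrow> real" and u :: "'a \<Rightarrow> real"
  assumes "finite G" "finite F" and b0: "\<And>k m. 0 \<le> b k m" and S: "0 \<le> S"
    and row: "\<And>k. k \<in> G \<Longrightarrow> (\<Sum>m\<in>F. b k m) \<le> S" and col: "\<And>m. m \<in> F \<Longrightarrow> (\<Sum>k\<in>G. b k m) \<le> S"
  shows "L2_set (\<lambda>k. \<Sum>m\<in>F. b k m * u m) G \<le> S * L2_set u F"
proof -
  have pt: "(\<Sum>m\<in>F. b k m * u m)\<^sup>2 \<le> S * (\<Sum>m\<in>F. b k m * (u m)\<^sup>2)" if "k \<in> G" for k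
  proof -
    have "(\<Sum>m\<in>F. b k m * u m)\<^sup>2 = (\<Sum>m\<in>F. sqrt (b k m) * (sqrt (b k m) * u m))\<^sup>2"
      using b0 by (simp add: mult.assoc[symmetric])
    also have "\<dots> \<le> (\<Sum>m\<in>F. (sqrt (b k m))\<^sup>2) * (\<Sum>m\<in>F. (sqrt (b k m) * u m)\<^sup>2)"
      by (rule Cauchy_Schwarz_ineq_sum)
    also have "\<dots> = (\<Sum>m\<in>F. b k m) * (\<Sum>m\<in>F. b k m * (u m)\<^sup>2)"
      using b0 by (simp add: power_mult_distrib)
    also have "\<dots> \<le> S * (\<Sum>m\<in>F. b k m * (u m)\<^sup>2)"
      by (intro mult_right_mono row that sum_nonneg) (use b0 in auto)
    finally show ?thesis .
  qed
  have "(\<Sum>k\<in>G. (\<Sum>m\<in>F. b k m * u m)\<^sup>2) \<le> (\<Sum>k\<in>G. S * (\<Sum>m\<in>F. b k m * (u m)\<^sup>2))" by (rule sum_mono[OF pt])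
  also have "\<dots> = S * (\<Sum>m\<in>F. (\<Sum>k\<in>G. b k m) * (u m)\<^sup>2)"
    unfolding sum_distrib_left[symmetric] by (subst sum.swap) (simp add: sum_distrib_right)
  also have "\<dots> \<le> S * (\<Sum>m\<in>F. S * (u m)\<^sup>2)"
    by (intro mult_left_mono[OF _ S] sum_mono mult_right_mono col) auto
  also have "\<dots> = S\<^sup>2 * (\<Sum>m\<in>F. (u m)\<^sup>2)" by (simp add: sum_distrib_left power2_eq_square mult_ac)
  finally have "sqrt (\<Sum>k\<in>G. (\<Sum>m\<in>F. b k m * u m)\<^sup>2) \<le> sqrt (S\<^sup>2 * (\<Sum>m\<in>F. (u m)\<^sup>2))" by simp
  then show ?thesis using S by (simp add: L2_set_def real_sqrt_mult)
qed

text \<open>Schur's test for the bilinear form: conjugating by the weight \<open>bracket powr (s/2)\<close> costs,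
  by Peetre's inequality, only a power of \<open>bracket (k - m)\<close>.\<close>

lemma schur_form:
  fixes h s :: real
  assumes h: "0 < h" "h \<le> 1" and d: "2 * real CARD('n) + \<bar>s\<bar> \<le> d"
  shows "\<exists>S>0. \<forall>F (u::real^'n \<Rightarrow> real). finite F \<longrightarrow> F \<subseteq> scaled_lattice h \<longrightarrow>
    (\<Sum>k\<in>F. \<Sum>m\<in>F. bracket k powr s * bracket (k - m) powr - d * (\<bar>u k\<bar> * \<bar>u m\<bar>))
      \<le> S * (\<Sum>k\<in>F. bracket k powr s * (u k)\<^sup>2)"
proof -
  obtain S where S: "S > 0" and S_row: "\<And>k F. k \<in> scaled_lattice h \<Longrightarrow> finite F \<Longrightarrow> F \<subseteq> (scaled_lattice h :: (real^'n) set) \<Longrightarrow>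
    (\<Sum>m\<in>F. bracket (k - m) powr - (2 * real CARD('n))) \<le> S"
    using lattice_sum_bounded[OF h, where 'n = 'n] by blast
  show ?thesis
  proof (intro exI[of _ S] conjI S allI impI)
    fix F :: "(real^'n) set" and u :: "real^'n \<Rightarrow> real" assume F: "finite F" "F \<subseteq> scaled_lattice h"
    define b where "b k m = bracket (k - m) powr - (2 * real CARD('n))" for k m :: "real^'n"
    define v where "v k = bracket k powr (s / 2) * \<bar>u k\<bar>" for k
    have v2: "(v k)\<^sup>2 = bracket k powr s * (u k)\<^sup>2" for k
      by (simp add: v_def power_mult_distrib powr_add[symmetric] power2_eq_square[of "_ powr _"])
    have "(\<Sum>k\<in>F. \<Sum>m\<in>F. bracket k powr s * bracket (k - m) powr - d * (\<bar>u k\<bar> * \<bar>u m\<bar>))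
        \<le> (\<Sum>k\<in>F. \<Sum>m\<in>F. v k * (b k m * v m))"
    proof (intro sum_mono)
      fix k m :: "real^'n"
      have "bracket k powr s * bracket (k - m) powr - d = bracket k powr (s / 2) * bracket k powr (s / 2) * bracket (k - m) powr - d"
        by (simp add: powr_add[symmetric])
      also have "\<dots> \<le> bracket k powr (s / 2) * (bracket m powr (s / 2) * bracket (k - m) powr \<bar>s / 2\<bar>) * bracket (k - m) powr - d"
        by (intro mult_right_mono mult_left_mono peetre_powr) auto
      also have "\<dots> = bracket k powr (s / 2) * bracket m powr (s / 2) * bracket (k - m) powr (\<bar>s / 2\<bar> - d)"
        by (simp add: powr_add[symmetric] mult.assoc)
      also have "\<dots> \<le> bracket k powr (s / 2) * bracket m powr (s / 2) * b k m"
        unfolding b_def using d by (intro mult_left_mono bracket_powr_mono) auto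
      finally have "bracket k powr s * bracket (k - m) powr - d * (\<bar>u k\<bar> * \<bar>u m\<bar>)
          \<le> bracket k powr (s / 2) * bracket m powr (s / 2) * b k m * (\<bar>u k\<bar> * \<bar>u m\<bar>)"
        by (rule mult_right_mono) simp
      then show "bracket k powr s * bracket (k - m) powr - d * (\<bar>u k\<bar> * \<bar>u m\<bar>) \<le> v k * (b k m * v m)"
        by (simp add: v_def mult_ac)
    qed
    also have "\<dots> = (\<Sum>k\<in>F. v k * (\<Sum>m\<in>F. b k m * v m))" by (simp add: sum_distrib_left)
    also have "\<dots> \<le> (\<Sum>k\<in>F. \<bar>v k\<bar> * \<bar>\<Sum>m\<in>F. b k m * v m\<bar>)"
      by (intro sum_mono) (simp add: abs_mult[symmetric])
    also have "\<dots> \<le> L2_set v F * L2_set (\<lambda>k. \<Sum>m\<in>F. b k m * v m) F" by (rule L2_set_mult_ineq)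
    also have "\<dots> \<le> L2_set v F * (S * L2_set v F)"
    proof (intro mult_left_mono schur_test F)
      show "(\<Sum>m\<in>F. b k m) \<le> S" if "k \<in> F" for k
        unfolding b_def by (rule S_row) (use that F in auto)
      show "(\<Sum>k\<in>F. b k m) \<le> S" if "m \<in> F" for m
        unfolding b_def by (subst bracket_minus_commute, rule S_row) (use that F in auto)
    qed (use S in \<open>auto simp: b_def\<close>)
    also have "\<dots> = S * (L2_set v F)\<^sup>2" by (simp add: power2_eq_square)
    also have "(L2_set v F)\<^sup>2 = (\<Sum>k\<in>F. bracket k powr s * (u k)\<^sup>2)"
      by (simp add: L2_set_def sum_nonneg v2)
    finally show "(\<Sum>k\<in>F. \<Sum>m\<in>F. bracket k powr s * bracket (k - m) powr - d * (\<bar>u k\<bar> * \<bar>u m\<bar>))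
      \<le> S * (\<Sum>k\<in>F. bracket k powr s * (u k)\<^sup>2)" .
  qed
qed

text \<open>Once x is at least C/c, the lower order term is dominated by the main one; below C/c it
  is bounded. The absolute value in the exponent covers r < 1.\<close>

lemma absorb_lower_order:
  fixes c C :: real
  assumes c: "0 < c" and C: "0 \<le> C"
  shows "\<exists>C'\<ge>0. \<forall>x\<ge>1. C * x powr (r - 1) \<le> c * x powr r + C'"
proof (intro exI[of _ "C * (C / c + 1) powr \<bar>r - 1\<bar>"] conjI allI impI)
  fix x :: real assume x: "1 \<le> x"
  show "C * x powr (r - 1) \<le> c * x powr r + C * (C / c + 1) powr \<bar>r - 1\<bar>"
  proof (cases "C \<le> c * x")
    case True
    then have "C * x powr (r - 1) \<le> c * x * x powr (r - 1)" by (rule mult_right_mono) simp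
    also have "\<dots> = c * x powr r" using x powr_add[of x 1 "r - 1"] by simp
    finally show ?thesis using C by (simp add: add_increasing2)
  next
    case False
    have "x powr (r - 1) \<le> x powr \<bar>r - 1\<bar>" using x by (intro powr_mono) auto
    also have "\<dots> \<le> (C / c + 1) powr \<bar>r - 1\<bar>"
      using False c x by (intro powr_mono2) (auto simp: field_simps)
    finally have "C * x powr (r - 1) \<le> C * (C / c + 1) powr \<bar>r - 1\<bar>" by (rule mult_left_mono[OF _ C])
    then show ?thesis using c by (simp add: add_increasing)
  qed
qed (use C in simp)

section \<open>Decaying kernels between weighted spaces\<close>

locale decaying_kernel =
  fixes h r :: real and A :: "real^'n \<Rightarrow> real^'n \<Rightarrow> complex"
  assumes h: "0 < h" "h \<le> 1"
    and decay: "\<And>d. \<exists>C>0. \<forall>k\<in>scaled_lattice h. \<forall>m\<in>scaled_lattice h.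
      cmod (A k m) \<le> C * (bracket k powr r * bracket (k - m) powr - d)"
begin

abbreviation "L \<equiv> (scaled_lattice h :: (real^'n) set)"

text \<open>Peetre moves the weight from k to m at the cost of
  \<open>bracket (k - m) powr \<bar>a + r\<bar>\<close>. The decay exponent is chosen to pay for
  this and still leave a kernel to which Schur's test applies.\<close>

lemma weighted_bound:
  "\<exists>S\<ge>0. \<forall>G F u. finite G \<longrightarrow> finite F \<longrightarrow> G \<subseteq> L \<longrightarrow> F \<subseteq> L \<longrightarrow>
     L2_set (\<lambda>k. bracket k powr a * cmod (\<Sum>m\<in>F. A k m * u m)) G
       \<le> S * L2_set (\<lambda>m. bracket m powr (a + r) * cmod (u m)) F"
proof -
  obtain S where S: "S > 0" and S_row: "\<And>k F. k \<in> scaled_lattice h \<Longrightarrow> finite F \<Longrightarrow> F \<subseteq> L \<Longrightarrow>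
    (\<Sum>m\<in>F. bracket (k - m) powr - (2 * real CARD('n))) \<le> S"
    using lattice_sum_bounded[OF h, where 'n = 'n] by blast
  obtain C where C: "C > 0" and C_dec: "\<And>k m. k \<in> L \<Longrightarrow> m \<in> L \<Longrightarrow>
      cmod (A k m) \<le> C * (bracket k powr r * bracket (k - m) powr - (2 * real CARD('n) + \<bar>a + r\<bar>))"
    using decay by blast
  show ?thesis
  proof (intro exI[of _ "C * S"] conjI allI impI)
    fix G F and u :: "real^'n \<Rightarrow> complex"
    assume fin: "finite G" "finite F" and sub: "G \<subseteq> L" "F \<subseteq> L"
    define b where "b k m = C * bracket (k - m) powr - (2 * real CARD('n))" for k m :: "real^'n"
    define v where "v m = bracket m powr (a + r) * cmod (u m)" for m
    have "L2_set (\<lambda>k. bracket k powr a * cmod (\<Sum>m\<in>F. A k m * u m)) G \<le> L2_set (\<lambda>k. \<Sum>m\<in>F. b k m * v m) G"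
    proof (rule L2_set_mono)
      fix k assume k: "k \<in> G"
      have "bracket k powr a * cmod (\<Sum>m\<in>F. A k m * u m) \<le> bracket k powr a * (\<Sum>m\<in>F. cmod (A k m * u m))"
        by (intro mult_left_mono norm_sum) simp
      also have "\<dots> = (\<Sum>m\<in>F. bracket k powr a * cmod (A k m) * cmod (u m))"
        by (simp add: sum_distrib_left norm_mult mult_ac)
      also have "\<dots> \<le> (\<Sum>m\<in>F. b k m * v m)"
      proof (rule sum_mono)
        fix m assume m: "m \<in> F"
        have "bracket k powr a * cmod (A k m)
            \<le> bracket k powr a * (C * (bracket k powr r * bracket (k - m) powr - (2 * real CARD('n) + \<bar>a + r\<bar>)))"
          by (intro mult_left_mono C_dec) (use k m sub in auto)
        also have "\<dots> = C * (bracket k powr (a + r) * bracket (k - m) powr - (2 * real CARD('n) + \<bar>a + r\<bar>))"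
          by (simp add: powr_add mult_ac)
        also have "\<dots> \<le> C * ((bracket m powr (a + r) * bracket (k - m) powr \<bar>a + r\<bar>) * bracket (k - m) powr - (2 * real CARD('n) + \<bar>a + r\<bar>))"
          using C by (intro mult_left_mono mult_right_mono peetre_powr) auto
        also have "\<dots> = b k m * bracket m powr (a + r)"
          by (simp add: b_def powr_add[symmetric] mult.assoc)
        finally have "bracket k powr a * cmod (A k m) * cmod (u m) \<le> b k m * bracket m powr (a + r) * cmod (u m)"
          by (rule mult_right_mono) simp
        then show "bracket k powr a * cmod (A k m) * cmod (u m) \<le> b k m * v m" by (simp add: v_def mult_ac)
      qed
      finally show "bracket k powr a * cmod (\<Sum>m\<in>F. A k m * u m) \<le> (\<Sum>m\<in>F. b k m * v m)" .
    qed simp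
    also have "\<dots> \<le> (C * S) * L2_set v F"
    proof (rule schur_test[OF fin])
      show "(\<Sum>m\<in>F. b k m) \<le> C * S" if "k \<in> G" for k
        unfolding b_def sum_distrib_left[symmetric]
        using C by (intro mult_left_mono S_row) (use that fin sub in auto)
      show "(\<Sum>k\<in>G. b k m) \<le> C * S" if "m \<in> F" for m
        unfolding b_def sum_distrib_left[symmetric] bracket_minus_commute[of _ m]
        using C by (intro mult_left_mono S_row) (use that fin sub in auto)
    qed (use C S in \<open>auto simp: b_def\<close>)
    finally show "L2_set (\<lambda>k. bracket k powr a * cmod (\<Sum>m\<in>F. A k m * u m)) G
       \<le> C * S * L2_set (\<lambda>m. bracket m powr (a + r) * cmod (u m)) F"
      by (simp add: v_def[abs_def])
  qed (use C S in simp)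
qed

text \<open>Conjugating the operator by the weight \<open>bracket powr q\<close> changes it by an operator of order
  \<open>r - 1\<close>, which the gain of order \<open>r\<close> in the unweighted inequality absorbs.\<close>

lemma weighted_garding:
  assumes c: "0 < c" and garding: "\<And>F u. finite F \<Longrightarrow> F \<subseteq> L \<Longrightarrow>
      (\<Sum>k\<in>F. Re (cnj (u k) * (\<Sum>m\<in>F. A k m * u m))) \<le> (\<Sum>k\<in>F. (C - c * bracket k powr r) * (cmod (u k))\<^sup>2)"
  shows "\<exists>C\<ge>0. \<forall>F u. finite F \<longrightarrow> F \<subseteq> L \<longrightarrow>
      (\<Sum>k\<in>F. (bracket k powr q)\<^sup>2 * Re (cnj (u k) * (\<Sum>m\<in>F. A k m * u m)))
        \<le> C * (\<Sum>k\<in>F. (bracket k powr q)\<^sup>2 * (cmod (u k))\<^sup>2)"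
proof -
  \<comment> \<open>e is the power of the distance lost in \<open>bracket_quotient_powr\<close>, and
    d the decay that \<open>schur_form\<close> requires at order r - 1; the kernel is used with
    decay d + e.\<close>
  define e where "e = 2 + \<bar>q - 1\<bar>"
  define d where "d = 2 * real CARD('n) + \<bar>r - 1\<bar>"
  obtain B where B: "B > 0" and B_dec: "\<And>k m. k \<in> L \<Longrightarrow> m \<in> L \<Longrightarrow>
      cmod (A k m) \<le> B * (bracket k powr r * bracket (k - m) powr - (d + e))"
    using decay by blast
  obtain S where S: "S > 0" and S_form: "\<And>F (u::real^'n \<Rightarrow> real). finite F \<Longrightarrow> F \<subseteq> L \<Longrightarrow>
    (\<Sum>k\<in>F. \<Sum>m\<in>F. bracket k powr (r - 1) * bracket (k - m) powr - d * (\<bar>u k\<bar> * \<bar>u m\<bar>))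
      \<le> S * (\<Sum>k\<in>F. bracket k powr (r - 1) * (u k)\<^sup>2)"
    using schur_form[OF h, where 'n = 'n and s = "r - 1" and d = d] unfolding d_def by blast
  obtain C' where C': "C' \<ge> 0" "\<And>x. x \<ge> 1 \<Longrightarrow> \<bar>q\<bar> * B * S * x powr (r - 1) \<le> c * x powr r + C'"
    using absorb_lower_order[OF c, of "\<bar>q\<bar> * B * S" r] B S by auto
  show ?thesis
  proof (intro exI[of _ "\<bar>C\<bar> + C'"] conjI allI impI)
    show "0 \<le> \<bar>C\<bar> + C'" using C' by simp
    fix F and u :: "real^'n \<Rightarrow> complex" assume F: "finite F" "F \<subseteq> L"
    define v where "v k = of_real (bracket k powr q) * u k" for k
    have cv: "cmod (v k) = bracket k powr q * cmod (u k)" for k by (simp add: v_def norm_mult)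
    \<comment> \<open>In terms of v, the weighted form is the unweighted one with the factor
      \<open>(bracket k / bracket m) powr q\<close>; splitting off 1 from this factor isolates the
      commutator.\<close>
    have split: "(bracket k powr q)\<^sup>2 * Re (cnj (u k) * (A k m * u m))
        = Re (cnj (v k) * (A k m * v m)) + ((bracket k / bracket m) powr q - 1) * Re (cnj (v k) * (A k m * v m))" for k m
    proof -
      have 1: "Re (cnj (v k) * (A k m * v m)) = (bracket k powr q * bracket m powr q) * Re (cnj (u k) * (A k m * u m))"
        unfolding v_def by (simp add: algebra_simps)
      have 2: "(bracket k / bracket m) powr q * (bracket k powr q * bracket m powr q) = (bracket k powr q)\<^sup>2"
        by (simp add: powr_divide less_imp_le power2_eq_square)
      have "Re (cnj (v k) * (A k m * v m)) + ((bracket k / bracket m) powr q - 1) * Re (cnj (v k) * (A k m * v m))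
          = ((bracket k / bracket m) powr q * (bracket k powr q * bracket m powr q)) * Re (cnj (u k) * (A k m * u m))"
        unfolding 1 by (simp add: left_diff_distrib)
      then show ?thesis unfolding 2 by simp
    qed
    have "(\<Sum>k\<in>F. (bracket k powr q)\<^sup>2 * Re (cnj (u k) * (\<Sum>m\<in>F. A k m * u m)))
        = (\<Sum>k\<in>F. \<Sum>m\<in>F. (bracket k powr q)\<^sup>2 * Re (cnj (u k) * (A k m * u m)))"
      by (simp only: sum_distrib_left Re_sum)
    also have "\<dots> = (\<Sum>k\<in>F. \<Sum>m\<in>F. Re (cnj (v k) * (A k m * v m)))
        + (\<Sum>k\<in>F. \<Sum>m\<in>F. ((bracket k / bracket m) powr q - 1) * Re (cnj (v k) * (A k m * v m)))"
      by (simp only: split sum.distrib)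
    also have "(\<Sum>k\<in>F. \<Sum>m\<in>F. Re (cnj (v k) * (A k m * v m))) = (\<Sum>k\<in>F. Re (cnj (v k) * (\<Sum>m\<in>F. A k m * v m)))"
      by (simp only: sum_distrib_left Re_sum)
    also have "\<dots> \<le> (\<Sum>k\<in>F. (C - c * bracket k powr r) * (cmod (v k))\<^sup>2)" by (rule garding[OF F])
    also have "(\<Sum>k\<in>F. \<Sum>m\<in>F. ((bracket k / bracket m) powr q - 1) * Re (cnj (v k) * (A k m * v m)))
        \<le> (\<Sum>k\<in>F. \<Sum>m\<in>F. \<bar>q\<bar> * B * (bracket k powr (r - 1) * bracket (k - m) powr - d * (\<bar>cmod (v k)\<bar> * \<bar>cmod (v m)\<bar>)))"
    proof (intro sum_mono)
      fix k m assume km: "k \<in> F" "m \<in> F"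
      have "((bracket k / bracket m) powr q - 1) * Re (cnj (v k) * (A k m * v m))
          \<le> \<bar>(bracket k / bracket m) powr q - 1\<bar> * \<bar>Re (cnj (v k) * (A k m * v m))\<bar>"
        by (metis abs_ge_self abs_mult)
      also have "\<dots> \<le> (\<bar>q\<bar> * (bracket (k - m) powr e / bracket k))
          * ((B * (bracket k powr r * bracket (k - m) powr - (d + e))) * (cmod (v k) * cmod (v m)))"
      proof (intro mult_mono)
        show "\<bar>(bracket k / bracket m) powr q - 1\<bar> \<le> \<bar>q\<bar> * (bracket (k - m) powr e / bracket k)"
          unfolding e_def by (rule bracket_quotient_powr)
        have "\<bar>Re (cnj (v k) * (A k m * v m))\<bar> \<le> cmod (A k m) * (cmod (v k) * cmod (v m))"
          using abs_Re_le_cmod[of "cnj (v k) * (A k m * v m)"] by (simp add: norm_mult mult_ac)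
        also have "\<dots> \<le> (B * (bracket k powr r * bracket (k - m) powr - (d + e))) * (cmod (v k) * cmod (v m))"
          by (intro mult_right_mono B_dec) (use km F in auto)
        finally show "\<bar>Re (cnj (v k) * (A k m * v m))\<bar>
          \<le> (B * (bracket k powr r * bracket (k - m) powr - (d + e))) * (cmod (v k) * cmod (v m))" .
      qed (auto intro!: mult_nonneg_nonneg divide_nonneg_nonneg simp: less_imp_le)
      also have "\<dots> = \<bar>q\<bar> * B * ((bracket k powr r / bracket k) * (bracket (k - m) powr e * bracket (k - m) powr - (d + e))
          * (cmod (v k) * cmod (v m)))"
        by simp
      also have "bracket k powr r / bracket k = bracket k powr (r - 1)"
        by (simp add: powr_diff)
      also have "bracket (k - m) powr e * bracket (k - m) powr - (d + e) = bracket (k - m) powr - d"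
        by (simp add: powr_add[symmetric])
      finally show "((bracket k / bracket m) powr q - 1) * Re (cnj (v k) * (A k m * v m))
        \<le> \<bar>q\<bar> * B * (bracket k powr (r - 1) * bracket (k - m) powr - d * (\<bar>cmod (v k)\<bar> * \<bar>cmod (v m)\<bar>))"
        by simp
    qed
    also have "\<dots> = \<bar>q\<bar> * B * (\<Sum>k\<in>F. \<Sum>m\<in>F. bracket k powr (r - 1) * bracket (k - m) powr - d * (\<bar>cmod (v k)\<bar> * \<bar>cmod (v m)\<bar>))"
      by (simp only: sum_distrib_left)
    also have "\<dots> \<le> \<bar>q\<bar> * B * (S * (\<Sum>k\<in>F. bracket k powr (r - 1) * (cmod (v k))\<^sup>2))"
      using B by (intro mult_left_mono S_form F) auto
    also have "\<dots> = (\<Sum>k\<in>F. (\<bar>q\<bar> * B * S * bracket k powr (r - 1)) * (cmod (v k))\<^sup>2)"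
      by (simp add: sum_distrib_left mult_ac)
    also have "(\<Sum>k\<in>F. (C - c * bracket k powr r) * (cmod (v k))\<^sup>2) + (\<Sum>k\<in>F. (\<bar>q\<bar> * B * S * bracket k powr (r - 1)) * (cmod (v k))\<^sup>2)
        = (\<Sum>k\<in>F. (C - c * bracket k powr r + \<bar>q\<bar> * B * S * bracket k powr (r - 1)) * (cmod (v k))\<^sup>2)"
      by (simp only: sum.distrib[symmetric] distrib_right)
    also have "\<dots> \<le> (\<Sum>k\<in>F. (\<bar>C\<bar> + C') * (cmod (v k))\<^sup>2)"
    proof (intro sum_mono mult_right_mono)
      fix k :: "real^'n"
      show "C - c * bracket k powr r + \<bar>q\<bar> * B * S * bracket k powr (r - 1) \<le> \<bar>C\<bar> + C'"
        using C'(2)[OF bracket_ge_1[of k]] by linarith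
    qed simp
    also have "\<dots> = (\<bar>C\<bar> + C') * (\<Sum>k\<in>F. (bracket k powr q)\<^sup>2 * (cmod (u k))\<^sup>2)"
      by (simp add: cv sum_distrib_left power_mult_distrib)
    finally show "(\<Sum>k\<in>F. (bracket k powr q)\<^sup>2 * Re (cnj (u k) * (\<Sum>m\<in>F. A k m * u m)))
        \<le> (\<bar>C\<bar> + C') * (\<Sum>k\<in>F. (bracket k powr q)\<^sup>2 * (cmod (u k))\<^sup>2)"
      by simp
  qed
qed

text \<open>\<open>gain\<close> is \<open>weighted_bound\<close> with a = 1, and \<open>loss\<close>
  is the case a = - (r + 1), where the exponent on the right becomes -1.\<close>

lemma parabolic_kernel:
  assumes T: "0 < T" and c: "0 < c" and garding: "\<And>F u. finite F \<Longrightarrow> F \<subseteq> L \<Longrightarrow>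
      (\<Sum>k\<in>F. Re (cnj (u k) * (\<Sum>m\<in>F. A k m * u m))) \<le> (\<Sum>k\<in>F. (C - c * bracket k powr r) * (cmod (u k))\<^sup>2)"
  shows "\<exists>S. parabolic_kernel h T (r + 1) S A"
proof -
  obtain S1 where S1: "S1 \<ge> 0" "\<And>G F u. finite G \<Longrightarrow> finite F \<Longrightarrow> G \<subseteq> L \<Longrightarrow> F \<subseteq> L \<Longrightarrow>
     L2_set (\<lambda>k. bracket k powr 1 * cmod (\<Sum>m\<in>F. A k m * u m)) G
       \<le> S1 * L2_set (\<lambda>m. bracket m powr (1 + r) * cmod (u m)) F"
    using weighted_bound[of 1] by blast
  obtain S2 where S2: "S2 \<ge> 0" "\<And>G F u. finite G \<Longrightarrow> finite F \<Longrightarrow> G \<subseteq> L \<Longrightarrow> F \<subseteq> L \<Longrightarrow>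
     L2_set (\<lambda>k. bracket k powr - (r + 1) * cmod (\<Sum>m\<in>F. A k m * u m)) G
       \<le> S2 * L2_set (\<lambda>m. bracket m powr (- (r + 1) + r) * cmod (u m)) F"
    using weighted_bound[of "- (r + 1)"] by blast
  have "parabolic_kernel h T (r + 1) (S1 + S2) A"
  proof
    show "0 < h" "0 < T" "0 \<le> S1 + S2" using h T S1 S2 by auto
    fix G F and u :: "real^'n \<Rightarrow> complex"
    assume fin: "finite G" "finite F" and sub: "G \<subseteq> L" "F \<subseteq> L"
    show "L2_set (\<lambda>k. bracket k * cmod (\<Sum>m\<in>F. A k m * u m)) G \<le> (S1 + S2) * L2_set (\<lambda>m. bracket m powr (r + 1) * cmod (u m)) F"
      using S1(2)[OF fin sub, of u] mult_right_mono[OF _ L2_set_nonneg, of S1 "S1 + S2" "\<lambda>m. bracket m powr (r + 1) * cmod (u m)" F] S2(1)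
      by (simp add: add.commute less_imp_le)
    have "- (r + 1) + r = - 1" by simp
    then have "bracket m powr (- (r + 1) + r) * cmod (u m) = cmod (u m) / bracket m" for m
      by (simp only: powr_minus_divide) (simp add: less_imp_le)
    then show "L2_set (\<lambda>k. bracket k powr - (r + 1) * cmod (\<Sum>m\<in>F. A k m * u m)) G \<le> (S1 + S2) * L2_set (\<lambda>m. cmod (u m) / bracket m) F"
      using S2(2)[OF fin sub, of u] mult_right_mono[OF _ L2_set_nonneg, of S2 "S1 + S2" "\<lambda>m. cmod (u m) / bracket m" F] S1(1)
      by simp
  next
    show "\<exists>C\<ge>0. \<forall>F u. finite F \<longrightarrow> F \<subseteq> L \<longrightarrow>
      (\<Sum>k\<in>F. (bracket k powr q)\<^sup>2 * Re (cnj (u k) * (\<Sum>m\<in>F. A k m * u m)))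
        \<le> C * (\<Sum>k\<in>F. (bracket k powr q)\<^sup>2 * (cmod (u k))\<^sup>2)" for q
      by (rule weighted_garding[OF c garding])
  qed
  then show ?thesis by blast
qed

end

section \<open>Fourier coefficients on the torus\<close>

lemma cbox_shift_split:
  fixes i :: "'n::finite"
  assumes t: "0 \<le> t" "t \<le> (1::real)"
  defines "e \<equiv> axis i 1 :: real^'n"
  shows "cbox (t *\<^sub>R e) (1 + t *\<^sub>R e) \<inter> {x. x \<bullet> e \<le> 1} = cbox (t *\<^sub>R e) 1"
    and "cbox (t *\<^sub>R e) (1 + t *\<^sub>R e) \<inter> {x. x \<bullet> e \<ge> 1} = cbox e (1 + t *\<^sub>R e)"
    and "cbox 0 1 \<inter> {x. x \<bullet> e \<le> t} = cbox 0 (1 + t *\<^sub>R e - e)"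
    and "cbox 0 1 \<inter> {x. x \<bullet> e \<ge> t} = cbox (t *\<^sub>R e) 1"
proof -
  have e: "x \<bullet> e = x $ i" "(c *\<^sub>R e) $ j = (if j = i then c else 0)" "e $ j = (if j = i then 1 else 0)" for x c j
    by (simp_all only: e_def inner_axis vector_scaleR_component) (simp_all add: axis_def)
  have box: "x \<in> cbox a b \<longleftrightarrow> a $ i \<le> x $ i \<and> x $ i \<le> b $ i \<and> (\<forall>j. j \<noteq> i \<longrightarrow> a $ j \<le> x $ j \<and> x $ j \<le> b $ j)"
    for x a b :: "real^'n"
    unfolding mem_box_cart by metis
  show "cbox (t *\<^sub>R e) (1 + t *\<^sub>R e) \<inter> {x. x \<bullet> e \<le> 1} = cbox (t *\<^sub>R e) 1"
    "cbox (t *\<^sub>R e) (1 + t *\<^sub>R e) \<inter> {x. x \<bullet> e \<ge> 1} = cbox e (1 + t *\<^sub>R e)"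
    "cbox 0 1 \<inter> {x. x \<bullet> e \<le> t} = cbox 0 (1 + t *\<^sub>R e - e)"
    "cbox 0 1 \<inter> {x. x \<bullet> e \<ge> t} = cbox (t *\<^sub>R e) 1"
    unfolding set_eq_iff Int_iff mem_Collect_eq box using t by (auto simp: e)
qed

lemma torus_periodic_axis:
  fixes f :: "real^'n \<Rightarrow> complex"
  assumes "torus_periodic f"
  shows "f (\<theta> + axis i 1) = f \<theta>"
proof -
  have "(axis i 1 :: real^'n) = (\<chi> j. of_int ((axis i 1 :: int^'n) $ j))" by (simp add: vec_eq_iff axis_def)
  then show ?thesis using assms unfolding torus_periodic_def by metis
qed

text \<open>The shifted cube is cut at the face of the original one. The piece that sticks out,
  moved back by one period, fills exactly the slab that the shift vacated.\<close>

lemma torus_integral_shift: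
  fixes f :: "real^'n \<Rightarrow> complex"
  assumes f: "continuous_on UNIV f" "torus_periodic f" and t: "0 \<le> t" "t \<le> 1"
  shows "integral (cbox 0 1) (\<lambda>\<theta>. f (\<theta> + t *\<^sub>R axis i 1)) = integral (cbox 0 1) f"
proof -
  let ?e = "axis i 1 :: real^'n"
  have B: "?e \<in> Basis" by (simp add: axis_in_Basis_iff)
  have int: "f integrable_on cbox a b" for a b
    by (intro integrable_continuous continuous_on_subset[OF f(1)]) auto
  have "integral (cbox 0 1) (\<lambda>\<theta>. f (\<theta> + t *\<^sub>R ?e)) = integral (cbox (t *\<^sub>R ?e) (1 + t *\<^sub>R ?e)) f"
    using integral_shift_cbox[of "t *\<^sub>R ?e" "t *\<^sub>R ?e" "1 + t *\<^sub>R ?e" f] by simp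
  also have "\<dots> = integral (cbox (t *\<^sub>R ?e) 1) f + integral (cbox ?e (1 + t *\<^sub>R ?e)) f"
    using integral_split[OF int B, of "t *\<^sub>R ?e" "1 + t *\<^sub>R ?e" 1] cbox_shift_split[OF t, of i] by simp
  also have "integral (cbox ?e (1 + t *\<^sub>R ?e)) f = integral (cbox 0 (1 + t *\<^sub>R ?e - ?e)) (\<lambda>x. f (x + ?e))"
    using integral_shift_cbox[of ?e ?e "1 + t *\<^sub>R ?e" f] by simp
  also have "\<dots> = integral (cbox 0 (1 + t *\<^sub>R ?e - ?e)) f" by (simp add: torus_periodic_axis[OF f(2)])
  also have "integral (cbox (t *\<^sub>R ?e) 1) f + \<dots> = integral (cbox 0 1) f"
    using integral_split[OF int B, of 0 1 t] cbox_shift_split[OF t, of i] by simp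
  finally show ?thesis .
qed

lemma partial_deriv_works:
  fixes f :: "real^'n \<Rightarrow> complex"
  assumes "\<And>\<theta>. (\<lambda>t. f (\<theta> + t *\<^sub>R axis j 1)) differentiable at 0"
  shows "((\<lambda>t. f (\<theta> + t *\<^sub>R axis j 1)) has_vector_derivative partial_deriv j f (\<theta> + t *\<^sub>R axis j 1)) (at t)"
proof -
  have "((\<lambda>s. f (\<theta> + t *\<^sub>R axis j 1 + s *\<^sub>R axis j 1)) has_vector_derivative partial_deriv j f (\<theta> + t *\<^sub>R axis j 1)) (at 0)"
    using vector_derivative_works[THEN iffD1, OF assms] by (simp add: partial_deriv_def)
  then have "((\<lambda>s. f (\<theta> + t *\<^sub>R axis j 1 + s *\<^sub>R axis j 1)) \<circ> (\<lambda>u. u - t) has_vector_derivative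
      (1 *\<^sub>R partial_deriv j f (\<theta> + t *\<^sub>R axis j 1))) (at t)"
    by (intro vector_diff_chain_at) (auto intro!: derivative_eq_intros)
  then show ?thesis by (simp add: o_def algebra_simps)
qed

lemma partial_derivI:
  fixes f :: "real^'n \<Rightarrow> complex"
  assumes "((\<lambda>t. f (\<theta> + t *\<^sub>R axis j 1)) has_vector_derivative D) (at 0)"
  shows "partial_deriv j f \<theta> = D" "(\<lambda>t. f (\<theta> + t *\<^sub>R axis j 1)) differentiable at 0"
  using assms unfolding partial_deriv_def
  by (simp_all add: vector_derivative_at differentiableI_vector)

lemma torus_periodic_partial_deriv:
  fixes f :: "real^'n \<Rightarrow> complex"
  assumes "torus_periodic f"
  shows "torus_periodic (partial_deriv j f)"
  unfolding torus_periodic_def partial_deriv_def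
proof (intro allI)
  fix m :: "int^'n" and \<theta> :: "real^'n"
  have "(\<lambda>t. f (\<theta> + (\<chi> j. of_int (m $ j)) + t *\<^sub>R axis j 1)) = (\<lambda>t. f (\<theta> + t *\<^sub>R axis j 1 + (\<chi> j. of_int (m $ j))))"
    by (simp add: algebra_simps)
  also have "\<dots> = (\<lambda>t. f (\<theta> + t *\<^sub>R axis j 1))" using assms by (simp add: torus_periodic_def)
  finally show "vector_derivative (\<lambda>t. f (\<theta> + (\<chi> j. of_int (m $ j)) + t *\<^sub>R axis j 1)) (at 0)
      = vector_derivative (\<lambda>t. f (\<theta> + t *\<^sub>R axis j 1)) (at 0)" by simp
qed

text \<open>The derivative is averaged over all shifts along the axis. For fixed \<theta> the
  average is a difference of f over a full period, hence 0; for a fixed shift the integral over the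
  cube is the original one. Exchanging the integrations compares the two, without singling out a
  coordinate of the cube.\<close>

lemma torus_integral_partial_deriv:
  fixes f :: "real^'n \<Rightarrow> complex"
  assumes "torus_periodic f"
    and d: "\<And>\<theta>. (\<lambda>t. f (\<theta> + t *\<^sub>R axis j 1)) differentiable at 0"
    and c: "continuous_on UNIV (partial_deriv j f)"
  shows "integral (cbox 0 1) (partial_deriv j f) = 0"
proof -
  let ?g = "partial_deriv j f" and ?e = "axis j 1 :: real^'n"
  have 1: "integral {0..1::real} (\<lambda>t. ?g (\<theta> + t *\<^sub>R ?e)) = 0" for \<theta>
  proof -
    have "((\<lambda>t. ?g (\<theta> + t *\<^sub>R ?e)) has_integral f (\<theta> + 1 *\<^sub>R ?e) - f (\<theta> + 0 *\<^sub>R ?e)) {0..1}"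
      by (rule fundamental_theorem_of_calculus)
        (auto intro!: has_vector_derivative_at_within partial_deriv_works[OF d])
    then show ?thesis using torus_periodic_axis[OF assms(1)] by (simp add: integral_unique)
  qed
  have "continuous_on UNIV (\<lambda>p::(real^'n) \<times> real. ?g (fst p + snd p *\<^sub>R ?e))"
    by (rule continuous_on_compose2[OF c]) (auto intro!: continuous_intros)
  then have cc: "continuous_on (cbox (0, 0) (1, 1)) (\<lambda>(\<theta>, t). ?g (\<theta> + t *\<^sub>R ?e))"
    by (auto simp: case_prod_beta' intro: continuous_on_subset)
  have "0 = integral (cbox 0 1) (\<lambda>\<theta>. integral (cbox 0 1) (\<lambda>t. ?g (\<theta> + t *\<^sub>R ?e)))"
    using 1 by simp
  also have "\<dots> = integral (cbox 0 1) (\<lambda>t. integral (cbox 0 1) (\<lambda>\<theta>. ?g (\<theta> + t *\<^sub>R ?e)))"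
    by (rule integral_swap_continuous[OF cc])
  also have "\<dots> = integral (cbox 0 (1::real)) (\<lambda>t. integral (cbox 0 1) ?g)"
    by (rule Henstock_Kurzweil_Integration.integral_cong)
      (auto intro!: torus_integral_shift c torus_periodic_partial_deriv assms(1))
  also have "\<dots> = integral (cbox 0 1) ?g" by simp
  finally show ?thesis by simp
qed

section \<open>Smooth functions\<close>

lemma smooth_continuous: "smooth f \<Longrightarrow> continuous_on UNIV f"
  unfolding smooth_def using C_diff.simps(1) by blast

lemma smooth_differentiable: "smooth f \<Longrightarrow> (\<lambda>t. f (\<theta> + t *\<^sub>R axis j 1)) differentiable at 0"
  unfolding smooth_def using C_diff.simps(2)[of 0 f] by blast

lemma smooth_partial_deriv: "smooth f \<Longrightarrow> smooth (partial_deriv j f)"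
  unfolding smooth_def using C_diff.simps(2) by blast

lemma smooth_has_partial_deriv:
  "smooth f \<Longrightarrow> ((\<lambda>t. f (\<theta> + t *\<^sub>R axis j 1)) has_vector_derivative partial_deriv j f \<theta>) (at 0)"
  using partial_deriv_works[of f j \<theta> 0, OF smooth_differentiable] by simp

lemma smooth_linear_combination:
  assumes "smooth f" "smooth g"
  shows "smooth (\<lambda>\<theta>. a * f \<theta> + b * g \<theta>)"
    and partial_deriv_linear_combination:
      "partial_deriv j (\<lambda>\<theta>. a * f \<theta> + b * g \<theta>) = (\<lambda>\<theta>. a * partial_deriv j f \<theta> + b * partial_deriv j g \<theta>)"
proof -
  have d: "((\<lambda>t. a * f (\<theta> + t *\<^sub>R axis j 1) + b * g (\<theta> + t *\<^sub>R axis j 1)) has_vector_derivative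
      a * partial_deriv j f \<theta> + b * partial_deriv j g \<theta>) (at 0)" if "smooth f" "smooth g" for f g :: "real^'a \<Rightarrow> complex" and j \<theta>
    by (intro has_vector_derivative_add has_vector_derivative_mult_right smooth_has_partial_deriv that)
  show "partial_deriv j (\<lambda>\<theta>. a * f \<theta> + b * g \<theta>) = (\<lambda>\<theta>. a * partial_deriv j f \<theta> + b * partial_deriv j g \<theta>)"
    using partial_derivI(1)[OF d[OF assms]] by blast
  have "C_diff m (\<lambda>\<theta>. a * f \<theta> + b * g \<theta>)" if "smooth f" "smooth g" for m and f g :: "real^'a \<Rightarrow> complex"
    using that
  proof (induction m arbitrary: f g)
    case 0
    show ?case unfolding C_diff.simps
      by (intro continuous_on_add continuous_on_mult continuous_on_const smooth_continuous 0)
  next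
    case (Suc m)
    have "partial_deriv j (\<lambda>\<theta>. a * f \<theta> + b * g \<theta>) = (\<lambda>\<theta>. a * partial_deriv j f \<theta> + b * partial_deriv j g \<theta>)" for j
      using partial_derivI(1)[OF d[OF Suc.prems]] by blast
    moreover have "continuous_on UNIV (\<lambda>\<theta>. a * f \<theta> + b * g \<theta>)"
      by (intro continuous_on_add continuous_on_mult continuous_on_const smooth_continuous Suc.prems)
    ultimately show ?case
      using Suc.IH[OF smooth_partial_deriv smooth_partial_deriv, OF Suc.prems] partial_derivI(2)[OF d[OF Suc.prems]]
      by simp
  qed
  then show "smooth (\<lambda>\<theta>. a * f \<theta> + b * g \<theta>)" using assms by (simp add: smooth_def)
qed

lemma smooth_const: "smooth (\<lambda>\<theta>. c)"
proof -
  have "C_diff m (\<lambda>\<theta>::real^'a. c)" for m c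
  proof (induction m arbitrary: c)
    case (Suc m)
    have "partial_deriv j (\<lambda>\<theta>::real^'a. c) = (\<lambda>\<theta>. 0)" for j by (simp add: partial_deriv_def fun_eq_iff)
    then show ?case using Suc.IH[of 0] by (simp add: differentiable_const)
  qed simp
  then show ?thesis by (simp add: smooth_def)
qed

section \<open>Characters and Fourier coefficients\<close>

lemma character_mult:
  "semiclassical_character h k \<theta> * semiclassical_character h m \<theta> = semiclassical_character h (k + m) \<theta>"
  by (simp add: semiclassical_character_def exp_add[symmetric] inner_add_left algebra_simps add_divide_distrib)

lemma character_zero [simp]: "semiclassical_character h 0 \<theta> = 1"
  by (simp add: semiclassical_character_def)

lemma character_eq_cis: "semiclassical_character h k \<theta> = cis (2 * pi * (k \<bullet> \<theta>) / h)"
  by (simp add: semiclassical_character_def cis_conv_exp field_simps)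

lemma norm_character [simp]: "cmod (semiclassical_character h k \<theta>) = 1"
  by (simp add: character_eq_cis)

lemma cnj_character: "cnj (semiclassical_character h k \<theta>) = semiclassical_character h (- k) \<theta>"
  by (simp add: character_eq_cis cis_cnj)

lemma continuous_character [continuous_intros]: "continuous_on S (semiclassical_character h k)"
  unfolding semiclassical_character_def by (intro continuous_intros)

lemma character_periodic:
  fixes k :: "real^'n"
  assumes "h \<noteq> 0" "k \<in> scaled_lattice h"
  shows "torus_periodic (semiclassical_character h k)"
  unfolding torus_periodic_def
proof (intro allI)
  fix m :: "int^'n" and \<theta> :: "real^'n"
  obtain z :: "int^'n" where z: "k = h *\<^sub>R (\<chi> j. of_int (z $ j))" using assms(2) unfolding scaled_lattice_def by blast
  have "k \<bullet> (\<chi> j. of_int (m $ j)) = h * of_int (\<Sum>j\<in>UNIV. z $ j * m $ j)"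
    by (simp add: z inner_vec_def sum_distrib_left mult.assoc)
  then have "2 * pi * (k \<bullet> (\<theta> + (\<chi> j. of_int (m $ j)))) / h = 2 * pi * (k \<bullet> \<theta>) / h + 2 * pi * of_int (\<Sum>j\<in>UNIV. z $ j * m $ j)"
    using assms(1) by (simp add: inner_add_right field_simps)
  moreover have "cis (2 * pi * of_int (\<Sum>j\<in>UNIV. z $ j * m $ j)) = 1" by (rule cis_multiple_2pi) (rule Ints_of_int)
  ultimately show "semiclassical_character h k (\<theta> + (\<chi> j. of_int (m $ j))) = semiclassical_character h k \<theta>"
    by (simp only: character_eq_cis cis_mult[symmetric]) simp
qed

lemma character_deriv:
  "((\<lambda>t. semiclassical_character h k (\<theta> + t *\<^sub>R axis j 1)) has_vector_derivative
    (2 * pi * \<i> * (k $ j / h)) * semiclassical_character h k \<theta>) (at 0)"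
proof -
  have "((\<lambda>t. exp (2 * complex_of_real pi * (\<i> / complex_of_real h) * complex_of_real (k \<bullet> (\<theta> + t *\<^sub>R axis j 1)))) has_vector_derivative
      (2 * complex_of_real pi * (\<i> / complex_of_real h) * complex_of_real (k $ j)) * exp (2 * complex_of_real pi * (\<i> / complex_of_real h) * complex_of_real (k \<bullet> (\<theta> + 0 *\<^sub>R axis j 1)))) (at 0)"
  proof (rule field_vector_diff_chain_at[of _ _ 0 exp, unfolded o_def])
    have "((\<lambda>t. k \<bullet> \<theta> + t * k $ j) has_real_derivative k $ j) (at 0)"
      by (auto intro!: derivative_eq_intros)
    then have "((\<lambda>t. k \<bullet> (\<theta> + t *\<^sub>R axis j 1)) has_real_derivative k $ j) (at 0)"
      by (simp add: inner_add_right inner_axis)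
    then have "((\<lambda>t. complex_of_real (k \<bullet> (\<theta> + t *\<^sub>R axis j 1))) has_vector_derivative complex_of_real (k $ j)) (at 0)"
      by (rule has_vector_derivative_of_real)
    then show "((\<lambda>t. 2 * complex_of_real pi * (\<i> / complex_of_real h) * complex_of_real (k \<bullet> (\<theta> + t *\<^sub>R axis j 1))) has_vector_derivative
        2 * complex_of_real pi * (\<i> / complex_of_real h) * complex_of_real (k $ j)) (at 0)"
      by (rule has_vector_derivative_mult_right)
  qed (rule DERIV_exp)
  then show ?thesis by (simp add: semiclassical_character_def field_simps)
qed

text \<open>The character carries the sign of the inverse transform, so that the coefficient of the
  symbol at k - m is the matrix entry of its quantization. In the usual convention this is the
  coefficient of index - k / h.\<close>

definition fourier_coeff :: "real \<Rightarrow> (real^'n \<Rightarrow> complex) \<Rightarrow> real^'n \<Rightarrow> complex" where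
  "fourier_coeff h f k = integral (cbox 0 1) (\<lambda>\<theta>. f \<theta> * semiclassical_character h k \<theta>)"

lemma fourier_coeff_integrable:
  assumes "continuous_on UNIV f"
  shows "(\<lambda>\<theta>. f \<theta> * semiclassical_character h k \<theta>) integrable_on cbox 0 1"
  by (intro integrable_continuous continuous_on_mult continuous_character continuous_on_subset[OF assms]) auto

lemma fourier_coeff_linear_combination:
  assumes "continuous_on UNIV f" "continuous_on UNIV g"
  shows "fourier_coeff h (\<lambda>\<theta>. a * f \<theta> + b * g \<theta>) k = a * fourier_coeff h f k + b * fourier_coeff h g k"
proof -
  have "fourier_coeff h (\<lambda>\<theta>. a * f \<theta> + b * g \<theta>) k = integral (cbox 0 1)
      (\<lambda>\<theta>. a * (f \<theta> * semiclassical_character h k \<theta>) + b * (g \<theta> * semiclassical_character h k \<theta>))"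
    unfolding fourier_coeff_def by (rule arg_cong[of _ _ "integral (cbox 0 1)"]) (simp add: fun_eq_iff algebra_simps)
  also have "\<dots> = integral (cbox 0 1) (\<lambda>\<theta>. a * (f \<theta> * semiclassical_character h k \<theta>))
      + integral (cbox 0 1) (\<lambda>\<theta>. b * (g \<theta> * semiclassical_character h k \<theta>))"
    by (intro Henstock_Kurzweil_Integration.integral_add integrable_on_mult_right fourier_coeff_integrable assms)
  finally show ?thesis by (simp add: fourier_coeff_def)
qed

lemma content_unit_cube: "measure lborel (cbox 0 (1::real^'n)) = 1"
  by (subst content_cbox_cart) (auto simp: mem_box_cart cbox_interval less_eq_vec_def)

lemma fourier_coeff_bound:
  assumes "continuous_on UNIV f" "\<And>\<theta>. cmod (f \<theta>) \<le> B"
  shows "cmod (fourier_coeff h f k) \<le> B"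
proof -
  have "0 \<le> B" using assms(2)[of 0] norm_ge_zero order_trans by blast
  then have "cmod (fourier_coeff h f k) \<le> B * measure lborel (cbox 0 (1::real^'a))"
    unfolding fourier_coeff_def
    by (intro integrable_bound fourier_coeff_integrable assms(1)) (simp_all add: norm_mult assms(2))
  then show ?thesis by (simp add: content_unit_cube)
qed

text \<open>Integration by parts: the derivative of f times the character has integral 0.\<close>

lemma fourier_coeff_partial_deriv:
  assumes f: "smooth f" "torus_periodic f" and h: "h \<noteq> 0" and k: "k \<in> scaled_lattice h"
  shows "fourier_coeff h (partial_deriv j f) k = - (2 * pi * \<i> * (k $ j / h)) * fourier_coeff h f k"
proof -
  let ?c = "2 * pi * \<i> * (k $ j / h) :: complex" and ?E = "semiclassical_character h k"
  let ?F = "\<lambda>\<theta>. f \<theta> * ?E \<theta>" and ?G = "\<lambda>\<theta>. partial_deriv j f \<theta> * ?E \<theta> + ?c * (f \<theta> * ?E \<theta>)"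
  have d: "((\<lambda>t. ?F (\<theta> + t *\<^sub>R axis j 1)) has_vector_derivative ?G \<theta>) (at 0)" for \<theta>
    using has_vector_derivative_mult[OF smooth_has_partial_deriv[OF f(1), of \<theta> j] character_deriv[of h k \<theta> j]]
    by (simp add: algebra_simps)
  have G: "partial_deriv j ?F = ?G" using partial_derivI(1)[OF d] by (simp add: fun_eq_iff)
  have per: "torus_periodic ?F"
    using f(2) character_periodic[OF h k] by (simp add: torus_periodic_def)
  have cont: "continuous_on UNIV ?G"
    by (intro continuous_intros smooth_continuous smooth_partial_deriv f)
  have "integral (cbox 0 1) ?G = 0"
    using torus_integral_partial_deriv[OF per partial_derivI(2)[OF d]] cont unfolding G by blast
  moreover have "integral (cbox 0 1) ?G = fourier_coeff h (partial_deriv j f) k + ?c * fourier_coeff h f k"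
  proof -
    have "integral (cbox 0 1) ?G = integral (cbox 0 1) (\<lambda>\<theta>. partial_deriv j f \<theta> * ?E \<theta>) + integral (cbox 0 1) (\<lambda>\<theta>. ?c * (f \<theta> * ?E \<theta>))"
      by (intro Henstock_Kurzweil_Integration.integral_add integrable_on_mult_right fourier_coeff_integrable
          smooth_continuous smooth_partial_deriv f)
    then show ?thesis unfolding fourier_coeff_def by simp
  qed
  ultimately show ?thesis by (simp add: eq_neg_iff_add_eq_0)
qed

text \<open>Orthogonality of the characters without computing an integral: the derivative of 1 is 0,
  while it multiplies the coefficient by a nonzero number if k is nonzero.\<close>

lemma fourier_coeff_one:
  assumes h: "h \<noteq> 0" and k: "k \<in> scaled_lattice h"
  shows "fourier_coeff h (\<lambda>\<theta>. 1) k = (if k = 0 then 1 else 0)"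
proof (cases "k = 0")
  case True
  then show ?thesis by (simp add: fourier_coeff_def content_unit_cube)
next
  case False
  then obtain j where j: "k $ j \<noteq> 0" by (auto simp: vec_eq_iff)
  have "partial_deriv j (\<lambda>\<theta>. 1) = (\<lambda>\<theta>::real^'a. 0)" by (simp add: partial_deriv_def fun_eq_iff)
  then have "(2 * pi * \<i> * (k $ j / h)) * fourier_coeff h (\<lambda>\<theta>. 1) k = 0"
    using fourier_coeff_partial_deriv[OF smooth_const _ h k, of 1 j]
    by (simp add: torus_periodic_def fourier_coeff_def)
  then show ?thesis using False j h by simp
qed

section \<open>Toroidal derivatives and decay of Fourier coefficients\<close>

lemma toroidal_factor:
  assumes f: "smooth f" "torus_periodic f"
  shows "smooth (toroidal_factor j l f)" "torus_periodic (toroidal_factor j l f)"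
    and "h \<noteq> 0 \<Longrightarrow> k \<in> scaled_lattice h \<Longrightarrow>
      fourier_coeff h (toroidal_factor j l f) k = - of_real (k $ j / h + real l) * fourier_coeff h f k"
proof -
  have e: "toroidal_factor j l f = (\<lambda>\<theta>. 1 / (2 * complex_of_real pi * \<i>) * partial_deriv j f \<theta> + (- of_nat l) * f \<theta>)"
    by (simp add: toroidal_factor_def fun_eq_iff)
  show "smooth (toroidal_factor j l f)" unfolding e
    by (intro smooth_linear_combination smooth_partial_deriv f)
  show "torus_periodic (toroidal_factor j l f)"
    using f(2) torus_periodic_partial_deriv[OF f(2), of j] by (simp add: torus_periodic_def toroidal_factor_def)
  assume h: "h \<noteq> 0" and k: "k \<in> scaled_lattice h"
  show "fourier_coeff h (toroidal_factor j l f) k = - of_real (k $ j / h + real l) * fourier_coeff h f k"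
    unfolding e
    by (subst fourier_coeff_linear_combination)
      (auto intro!: smooth_continuous smooth_partial_deriv f simp: fourier_coeff_partial_deriv[OF f h k] field_simps)
qed

text \<open>On the coefficient at k every factor acts as multiplication by - (z + l) with z =
  \<open>k $ j / h\<close>; the moduli of these numbers multiply.\<close>

lemma toroidal_factors:
  fixes f :: "real^'n \<Rightarrow> complex"
  assumes f: "smooth f" "torus_periodic f" and h: "h \<noteq> 0" and k: "k \<in> scaled_lattice h"
  shows "smooth (foldr (toroidal_factor j) ls f) \<and> torus_periodic (foldr (toroidal_factor j) ls f) \<and>
    cmod (fourier_coeff h (foldr (toroidal_factor j) ls f) k) = (\<Prod>l\<leftarrow>ls. \<bar>k $ j / h + real l\<bar>) * cmod (fourier_coeff h f k)"
proof (induction ls)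
  case (Cons l ls)
  then show ?case
    using toroidal_factor[where f = "foldr (toroidal_factor j) ls f" and j = j and l = l] h k
    by (simp add: norm_mult del: of_real_add)
qed (use f in simp)

lemma coords: "distinct (coords :: 'n::finite list)" "set (coords :: 'n list) = UNIV"
proof -
  have "\<exists>js :: 'n list. distinct js \<and> set js = UNIV"
    using finite_distinct_list[OF finite[of "UNIV :: 'n set"]] by blast
  from someI_ex[OF this] show "distinct (coords :: 'n list)" "set (coords :: 'n list) = UNIV"
    by (auto simp: coords_def)
qed

lemma foldr_id: "(\<And>i. i \<in> set xs \<Longrightarrow> F i = id) \<Longrightarrow> foldr F xs = id"
  by (induction xs) auto

text \<open>For multi-indices supported in one coordinate the composition along
  \<open>coords\<close> collapses to one factor. Only such multi-indices are evaluated below, so the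
  unspecified order of \<open>coords\<close> never shows.\<close>

lemma foldr_single:
  assumes "distinct xs" "j \<in> set xs" "\<And>i. i \<noteq> j \<Longrightarrow> F i = id"
  shows "foldr F xs = F j"
  using assms(1,2)
proof (induction xs)
  case (Cons x xs)
  show ?case
  proof (cases "x = j")
    case True
    have "F i = id" if "i \<in> set xs" for i by (rule assms(3)) (use that Cons.prems True in auto)
    then have "foldr F xs = id" by (rule foldr_id)
    then show ?thesis using True by simp
  next
    case False
    then show ?thesis using Cons by (auto simp: assms(3))
  qed
qed simp

lemma toroidal_deriv_0: "toroidal_deriv h (\<lambda>_. 0) f = f"
  by (simp add: toroidal_deriv_def fun_eq_iff foldr_id[of coords "\<lambda>j. foldr (toroidal_factor j) []"] id_def[symmetric])
    (simp add: foldr_id)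

lemma toroidal_deriv_single:
  "toroidal_deriv h (\<lambda>i. if i = j then M else 0) f \<theta> = of_real h ^ M * foldr (toroidal_factor j) [0..<M] f \<theta>"
proof -
  have "foldr (\<lambda>i. foldr (toroidal_factor i) [0..<if i = j then M else 0]) coords = foldr (toroidal_factor j) [0..<M]"
    by (subst foldr_single[of _ j]) (auto simp: coords fun_eq_iff)
  then show ?thesis by (simp add: toroidal_deriv_def)
qed

lemma multi_difference_0: "multi_difference h (\<lambda>_. 0) g = g"
  by (simp add: multi_difference_def foldr_id id_def[symmetric])

lemma multi_difference_single: "multi_difference h (\<lambda>i. if i = j then 1 else 0) g = difference h j g"
  unfolding multi_difference_def by (subst foldr_single[of _ j]) (auto simp: coords fun_eq_iff)

text \<open>The factors \<open>z + l\<close> may vanish when \<open>\<bar>z\<bar> < 2 M\<close>, where the trivial bound suffices.\<close>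

lemma fourier_coeff_decay_direction:
  assumes f: "smooth f" "torus_periodic f" and h: "0 < h" "h \<le> 1" and k: "k \<in> scaled_lattice h"
    and B: "\<And>\<theta>. cmod (f \<theta>) \<le> B" "\<And>\<theta>. cmod (toroidal_deriv h (\<lambda>i. if i = j then M else 0) f \<theta>) \<le> B"
  shows "\<bar>k $ j\<bar> ^ M * cmod (fourier_coeff h f k) \<le> (2 ^ M + (2 * real M) ^ M) * B"
proof -
  define z where "z = k $ j / h"
  let ?g = "foldr (toroidal_factor j) [0..<M] f"
  have B0: "0 \<le> B" using B(1)[of 0] norm_ge_zero order_trans by blast
  have h0: "h \<noteq> 0" using h by simp
  have g: "smooth ?g" "cmod (fourier_coeff h ?g k) = (\<Prod>l\<leftarrow>[0..<M]. \<bar>z + real l\<bar>) * cmod (fourier_coeff h f k)"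
    using toroidal_factors[OF f h0 k, of j "[0..<M]"] by (auto simp: z_def)
  have "cmod (?g \<theta>) \<le> B / h ^ M" for \<theta>
    using B(2)[of \<theta>] h by (simp add: toroidal_deriv_single norm_mult norm_power field_simps)
  then have 1: "(\<Prod>l\<leftarrow>[0..<M]. \<bar>z + real l\<bar>) * cmod (fourier_coeff h f k) \<le> B / h ^ M"
    using fourier_coeff_bound[OF smooth_continuous[OF g(1)], of "B / h ^ M" h k] g(2) by simp
  \<comment> \<open>The power of h built into \<open>toroidal_deriv\<close> is exactly what turns
    decay in the integer z into decay in k, with a constant free of h.\<close>
  have kz: "\<bar>k $ j\<bar> ^ M = h ^ M * \<bar>z\<bar> ^ M"
    using h by (simp add: z_def power_mult_distrib[symmetric] abs_divide)
  show ?thesis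
  proof (cases "2 * real M \<le> \<bar>z\<bar>")
    \<comment> \<open>Now every l < M is at most half of |z|, so each factor |z + l| is at least |z|
      / 2.\<close>
    case True
    have "(\<bar>z\<bar> / 2) ^ M = (\<Prod>l\<in>{0..<M}. \<bar>z\<bar> / 2)" by simp
    also have "\<dots> \<le> (\<Prod>l\<in>{0..<M}. \<bar>z + real l\<bar>)"
    proof (rule prod_mono)
      fix l assume "l \<in> {0..<M}"
      then show "0 \<le> \<bar>z\<bar> / 2 \<and> \<bar>z\<bar> / 2 \<le> \<bar>z + real l\<bar>" using True by (auto simp: abs_if)
    qed
    also have "\<dots> = (\<Prod>l\<leftarrow>[0..<M]. \<bar>z + real l\<bar>)"
      using prod.distinct_set_conv_list[of "[0..<M]" "\<lambda>l. \<bar>z + real l\<bar>"] by simp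
    finally have "(\<bar>z\<bar> / 2) ^ M * cmod (fourier_coeff h f k) \<le> B / h ^ M"
      using 1 mult_right_mono[of _ _ "cmod (fourier_coeff h f k)"] by (meson norm_ge_zero order_trans)
    then have "\<bar>k $ j\<bar> ^ M * cmod (fourier_coeff h f k) \<le> 2 ^ M * B"
      unfolding kz using h by (simp add: power_divide field_simps)
    also have "\<dots> \<le> (2 ^ M + (2 * real M) ^ M) * B" using B0 by (intro mult_right_mono) auto
    finally show ?thesis .
  next
    case False
    have "\<bar>k $ j\<bar> ^ M \<le> 1 * (2 * real M) ^ M"
      unfolding kz using h False by (intro mult_mono power_mono power_le_one) auto
    then have "\<bar>k $ j\<bar> ^ M * cmod (fourier_coeff h f k) \<le> (2 * real M) ^ M * B"
      using fourier_coeff_bound[OF smooth_continuous[OF f(1)] B(1), of h k] by (intro mult_mono) auto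
    also have "\<dots> \<le> (2 ^ M + (2 * real M) ^ M) * B" using B0 by (intro mult_right_mono) auto
    finally show ?thesis .
  qed
qed

text \<open>Derivatives are taken only in the direction j of the largest component of k, where
  \<open>bracket k\<close> is at most 2n max(1, |k_j|) in dimension n. In the constant, the summand
  1 is the trivial bound and the other two come from the direction j.\<close>

lemma fourier_coeff_decay:
  fixes f :: "real^'n \<Rightarrow> complex"
  assumes f: "smooth f" "torus_periodic f" and h: "0 < h" "h \<le> 1" and k: "k \<in> scaled_lattice h"
    and B: "\<And>\<theta>. cmod (f \<theta>) \<le> B" "\<And>j \<theta>. cmod (toroidal_deriv h (\<lambda>i. if i = j then M else 0) f \<theta>) \<le> B"
  shows "cmod (fourier_coeff h f k) \<le> (2 * real CARD('n)) ^ M * (1 + 2 ^ M + (2 * real M) ^ M) * B * bracket k powr - real M"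
proof -
  obtain j where j: "\<And>i. \<bar>k $ i\<bar> \<le> \<bar>k $ j\<bar>"
  proof -
    have "Max (range (\<lambda>i. \<bar>k $ i\<bar>)) \<in> range (\<lambda>i. \<bar>k $ i\<bar>)" by (rule Max_in) auto
    then obtain j where "Max (range (\<lambda>i. \<bar>k $ i\<bar>)) = \<bar>k $ j\<bar>" by blast
    then show ?thesis using that[of j] Max_ge[of "range (\<lambda>i. \<bar>k $ i\<bar>)"] by simp
  qed
  define x where "x = \<bar>k $ j\<bar>"
  have "norm k \<le> (\<Sum>i\<in>UNIV. \<bar>k $ i\<bar>)" by (rule norm_le_l1_cart)
  also have "\<dots> \<le> real CARD('n) * x" using sum_bounded_above[of UNIV "\<lambda>i. \<bar>k $ i\<bar>" x] j by (simp add: x_def)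
  finally have "bracket k \<le> 1 + real CARD('n) * x" by (simp add: bracket_def)
  also have "\<dots> \<le> 2 * real CARD('n) * max 1 x"
  proof -
    have "1 \<le> real CARD('n)" using zero_less_card_finite[where 'a='n] by linarith
    then have "1 \<le> real CARD('n) * max 1 x" using mult_mono[of 1 "real CARD('n)" 1 "max 1 x"] by simp
    moreover have "real CARD('n) * x \<le> real CARD('n) * max 1 x" by (intro mult_left_mono) auto
    ultimately show ?thesis unfolding mult.assoc by linarith
  qed
  finally have "bracket k ^ M \<le> (2 * real CARD('n) * max 1 x) ^ M" by (intro power_mono) (auto simp: less_imp_le)
  also have "\<dots> = (2 * real CARD('n)) ^ M * (max 1 x) ^ M" by (simp only: power_mult_distrib)
  also have "(max 1 x) ^ M \<le> 1 + x ^ M" by (cases "1 \<le> x") (auto simp: x_def max_def)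
  finally have b: "bracket k ^ M \<le> (2 * real CARD('n)) ^ M * (1 + x ^ M)" by (simp add: mult_left_mono)
  have "bracket k ^ M * cmod (fourier_coeff h f k) \<le> (2 * real CARD('n)) ^ M * (1 + x ^ M) * cmod (fourier_coeff h f k)"
    by (rule mult_right_mono[OF b]) simp
  also have "\<dots> = (2 * real CARD('n)) ^ M * (cmod (fourier_coeff h f k) + x ^ M * cmod (fourier_coeff h f k))"
    by (simp add: algebra_simps)
  also have "\<dots> \<le> (2 * real CARD('n)) ^ M * (B + (2 ^ M + (2 * real M) ^ M) * B)"
    unfolding x_def
    by (intro mult_left_mono add_mono fourier_coeff_bound fourier_coeff_decay_direction[OF f h k B(1) B(2)] smooth_continuous f B) auto
  finally have "bracket k ^ M * cmod (fourier_coeff h f k) \<le> (2 * real CARD('n)) ^ M * (1 + 2 ^ M + (2 * real M) ^ M) * B"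
    by (simp add: algebra_simps)
  then show ?thesis by (simp add: powr_minus powr_realpow field_simps)
qed

section \<open>Garding's inequality\<close>

text \<open>For a symbol f independent of k the operator is a convolution in k, that is,
  multiplication by f in the variable \<theta>; its form is the integral of f against the squared
  modulus of the trigonometric polynomial with coefficients u.\<close>

lemma fourier_form:
  fixes f :: "real^'n \<Rightarrow> complex"
  assumes G: "finite G" and f: "continuous_on UNIV f"
  shows "(\<Sum>k\<in>G. cnj (u k) * (\<Sum>m\<in>G. fourier_coeff h f (k - m) * u m)) =
    integral (cbox 0 1) (\<lambda>\<theta>. f \<theta> * of_real ((cmod (\<Sum>m\<in>G. u m * semiclassical_character h (- m) \<theta>))\<^sup>2))"
proof -
  have pt: "f \<theta> * of_real ((cmod (\<Sum>m\<in>G. u m * semiclassical_character h (- m) \<theta>))\<^sup>2)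
      = (\<Sum>k\<in>G. \<Sum>m\<in>G. cnj (u k) * u m * (f \<theta> * semiclassical_character h (k - m) \<theta>))" for \<theta>
  proof -
    have "of_real ((cmod (\<Sum>m\<in>G. u m * semiclassical_character h (- m) \<theta>))\<^sup>2)
        = (\<Sum>m\<in>G. u m * semiclassical_character h (- m) \<theta>) * (\<Sum>k\<in>G. cnj (u k) * semiclassical_character h k \<theta>)"
      unfolding complex_norm_square by (simp add: cnj_character)
    also have "\<dots> = (\<Sum>k\<in>G. \<Sum>m\<in>G. cnj (u k) * u m * semiclassical_character h (k - m) \<theta>)"
      unfolding sum_product
      by (subst sum.swap, intro sum.cong refl)
        (simp add: character_mult[of h _ \<theta> "- _", symmetric, simplified] mult_ac)
    finally show ?thesis by (simp add: sum_distrib_left mult_ac)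
  qed
  have i: "(\<lambda>\<theta>. c * (f \<theta> * semiclassical_character h k \<theta>)) integrable_on cbox 0 1" for c k
    by (intro integrable_on_mult_right fourier_coeff_integrable f)
  have "integral (cbox 0 1) (\<lambda>\<theta>. f \<theta> * of_real ((cmod (\<Sum>m\<in>G. u m * semiclassical_character h (- m) \<theta>))\<^sup>2))
      = (\<Sum>k\<in>G. \<Sum>m\<in>G. integral (cbox 0 1) (\<lambda>\<theta>. cnj (u k) * u m * (f \<theta> * semiclassical_character h (k - m) \<theta>)))"
    unfolding pt by (simp add: Henstock_Kurzweil_Integration.integral_sum Henstock_Kurzweil_Integration.integrable_sum G i)
  also have "\<dots> = (\<Sum>k\<in>G. \<Sum>m\<in>G. cnj (u k) * u m * fourier_coeff h f (k - m))"
    by (simp add: fourier_coeff_def)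
  finally show ?thesis by (simp add: sum_distrib_left mult_ac)
qed

text \<open>The form of the constant symbol 1, whose matrix is the identity.\<close>

lemma torus_parseval:
  fixes u :: "real^'n \<Rightarrow> complex"
  assumes G: "finite G" "G \<subseteq> scaled_lattice h" and h: "h \<noteq> 0"
  shows "integral (cbox 0 1) (\<lambda>\<theta>. (cmod (\<Sum>m\<in>G. u m * semiclassical_character h (- m) \<theta>))\<^sup>2) = (\<Sum>k\<in>G. (cmod (u k))\<^sup>2)"
proof -
  let ?U = "\<lambda>\<theta>. (cmod (\<Sum>m\<in>G. u m * semiclassical_character h (- m) \<theta>))\<^sup>2"
  have "continuous_on (cbox 0 1) (\<lambda>\<theta>. complex_of_real (?U \<theta>))" by (intro continuous_intros)
  from integral_linear[OF integrable_continuous[OF this] bounded_linear_Re]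
  have "integral (cbox 0 1) ?U = Re (integral (cbox 0 1) (\<lambda>\<theta>. 1 * of_real (?U \<theta>)))"
    by (simp add: o_def del: of_real_power)
  also have "\<dots> = Re (\<Sum>k\<in>G. cnj (u k) * (\<Sum>m\<in>G. fourier_coeff h (\<lambda>\<theta>. 1) (k - m) * u m))"
    unfolding fourier_form[OF G(1) continuous_on_const] by simp
  also have "\<dots> = Re (\<Sum>k\<in>G. cnj (u k) * u k)"
  proof -
    have "(\<Sum>m\<in>G. fourier_coeff h (\<lambda>\<theta>. 1) (k - m) * u m) = u k" if "k \<in> G" for k
    proof -
      have "fourier_coeff h (\<lambda>\<theta>. 1) (k - m) * u m = (if k = m then u m else 0)" if "m \<in> G" for m
        using fourier_coeff_one[OF h lattice_diff[OF subsetD[OF G(2) \<open>k \<in> G\<close>] subsetD[OF G(2) that]]] by auto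
      then show ?thesis using that G(1) by (simp cong: sum.cong)
    qed
    then show ?thesis by (simp cong: sum.cong)
  qed
  also have "\<dots> = (\<Sum>k\<in>G. (cmod (u k))\<^sup>2)"
    by (simp add: cmod_power2) (simp add: power2_eq_square)
  finally show ?thesis .
qed

text \<open>For symbols independent of k, an upper bound of the real part passes to the form without
  loss, since the square it is integrated against is nonnegative. This is the exact inequality to
  which freezing reduces the general case.\<close>

lemma fourier_form_le:
  fixes f :: "real^'n \<Rightarrow> complex"
  assumes G: "finite G" "G \<subseteq> scaled_lattice h" and h: "h \<noteq> 0" and f: "continuous_on UNIV f" and le: "\<And>\<theta>. Re (f \<theta>) \<le> c"
  shows "Re (\<Sum>k\<in>G. cnj (u k) * (\<Sum>m\<in>G. fourier_coeff h f (k - m) * u m)) \<le> c * (\<Sum>k\<in>G. (cmod (u k))\<^sup>2)"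
proof -
  let ?U = "\<lambda>\<theta>. (cmod (\<Sum>m\<in>G. u m * semiclassical_character h (- m) \<theta>))\<^sup>2"
  have cU: "continuous_on (cbox 0 1) ?U" by (intro continuous_intros)
  have cf: "continuous_on (cbox 0 1) f" by (rule continuous_on_subset[OF f]) auto
  have re: "Re (integral (cbox 0 1) (\<lambda>\<theta>. g \<theta> * of_real (?U \<theta>))) = integral (cbox 0 1) (\<lambda>\<theta>. Re (g \<theta>) * ?U \<theta>)"
    if "continuous_on (cbox 0 1) g" for g :: "real^'n \<Rightarrow> complex"
    using integral_linear[OF _ bounded_linear_Re, of "\<lambda>\<theta>. g \<theta> * of_real (?U \<theta>)" "cbox 0 1"]
      integrable_continuous[OF continuous_on_mult[OF that continuous_on_of_real[OF cU]]] by (simp add: o_def)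
  have "Re (\<Sum>k\<in>G. cnj (u k) * (\<Sum>m\<in>G. fourier_coeff h f (k - m) * u m)) = integral (cbox 0 1) (\<lambda>\<theta>. Re (f \<theta>) * ?U \<theta>)"
    unfolding fourier_form[OF G(1) f] by (rule re[OF cf])
  also have "\<dots> \<le> integral (cbox 0 1) (\<lambda>\<theta>. c * ?U \<theta>)"
    by (intro integral_le integrable_continuous continuous_on_mult continuous_on_const continuous_on_Re cf cU mult_right_mono le) auto
  also have "\<dots> = c * (\<Sum>k\<in>G. (cmod (u k))\<^sup>2)" by (simp add: torus_parseval[OF G h])
  finally show ?thesis .
qed

section \<open>Lattice cubes and their boundary\<close>

definition lattice_cube :: "real \<Rightarrow> nat \<Rightarrow> (real^'n) set" where
  "lattice_cube h K = (\<lambda>z. h *\<^sub>R (\<chi> j. of_int (z j))) ` PiE UNIV (\<lambda>_. {0..<int K})"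

text \<open>The last claim is a surface to volume estimate. The points that stay in the cube under
  the shift form a box, empty or with sides K - |y_i|, so they make up the fraction given by the
  product of the 1 - x_i, which is at least 1 minus the sum of the x_i.\<close>

lemma lattice_cube:
  assumes h: "0 < h"
  shows "finite (lattice_cube h K :: (real^'n) set)" "lattice_cube h K \<subseteq> (scaled_lattice h :: (real^'n) set)"
    and "card (lattice_cube h K :: (real^'n) set) = K ^ CARD('n)"
    and "0 < K \<Longrightarrow> j \<in> scaled_lattice h \<Longrightarrow>
      real (card {q \<in> lattice_cube h K. q + j \<notin> (lattice_cube h K :: (real^'n) set)})
        \<le> real (K ^ CARD('n)) * (real CARD('n) * norm j / (h * real K))"
proof -
  define E where "E z = (h *\<^sub>R (\<chi> j. of_int (z j)) :: real^'n)" for z :: "'n \<Rightarrow> int"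
  let ?I = "PiE (UNIV::'n set) (\<lambda>_. {0..<int K})"
  have injE: "inj E" using h by (auto simp: inj_def E_def vec_eq_iff fun_eq_iff)
  have Q: "lattice_cube h K = E ` ?I" by (simp add: lattice_cube_def E_def)
  have finI: "finite ?I" by (intro finite_PiE) auto
  then show "finite (lattice_cube h K :: (real^'n) set)" by (simp add: Q)
  show "lattice_cube h K \<subseteq> (scaled_lattice h :: (real^'n) set)"
  proof
    fix k :: "real^'n" assume "k \<in> lattice_cube h K"
    then obtain z where "k = h *\<^sub>R (\<chi> j. of_int ((\<chi> j. z j :: int^'n) $ j))" unfolding lattice_cube_def by auto
    then show "k \<in> scaled_lattice h" unfolding scaled_lattice_def by blast
  qed
  have cardE: "card (E ` X) = card X" for X by (rule card_image) (rule inj_on_subset[OF injE], simp)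
  have cardI: "card ?I = K ^ CARD('n)" by (simp add: card_PiE)
  show "card (lattice_cube h K :: (real^'n) set) = K ^ CARD('n)" by (simp add: Q cardE cardI)
  assume K: "0 < K" and "j \<in> scaled_lattice h"
  then obtain y :: "int^'n" where y: "j = E (vec_nth y)" unfolding scaled_lattice_def E_def by blast
  let ?J = "PiE (UNIV::'n set) (\<lambda>i. {max 0 (- y $ i)..<min (int K) (int K - y $ i)})"
  have add: "E z + j = E (\<lambda>i. z i + y $ i)" for z by (simp add: E_def y vec_eq_iff algebra_simps)
  have "{q \<in> lattice_cube h K. q + j \<notin> lattice_cube h K} = E ` (?I - ?J)"
  proof -
    have "{q \<in> lattice_cube h K. q + j \<notin> lattice_cube h K} = E ` {z \<in> ?I. (\<lambda>i. z i + y $ i) \<notin> ?I}"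
    proof -
      have "{q \<in> E ` ?I. q + j \<notin> E ` ?I} = E ` {z \<in> ?I. E z + j \<notin> E ` ?I}" by blast
      then show ?thesis unfolding Q add inj_image_mem_iff[OF injE] .
    qed
    also have "{z \<in> ?I. (\<lambda>i. z i + y $ i) \<notin> ?I} = ?I - ?J"
    proof -
      have m: "z \<in> PiE UNIV T \<longleftrightarrow> (\<forall>i. z i \<in> T i)" for z :: "'n \<Rightarrow> int" and T by (auto simp: PiE_iff)
      have "z i + y $ i \<in> {0..<int K} \<longleftrightarrow> z i \<in> {max 0 (- y $ i)..<min (int K) (int K - y $ i)}"
        if "z i \<in> {0..<int K}" for z i using that by auto
      then show ?thesis unfolding set_eq_iff mem_Collect_eq Diff_iff m by blast
    qed
    finally show ?thesis .
  qed
  moreover have JI: "?J \<subseteq> ?I" by (fastforce simp: PiE_def Pi_def)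
  ultimately have c: "real (card {q \<in> lattice_cube h K. q + j \<notin> (lattice_cube h K :: (real^'n) set)}) = real (K ^ CARD('n)) - real (card ?J)"
    using cardI card_mono[OF finI JI] by (simp add: cardE card_Diff_subset[OF finite_subset[OF JI finI] JI] of_nat_diff)
  \<comment> \<open>Capped at 1 because the box is empty as soon as some component of the shift
    reaches K.\<close>
  define x where "x i = min 1 (\<bar>real_of_int (y $ i)\<bar> / real K)" for i
  have "real (card ?J) = (\<Prod>i\<in>UNIV. real K * (1 - x i))"
  proof -
    have "real (card {max 0 (- y $ i)..<min (int K) (int K - y $ i)}) = real K * (1 - x i)" for i
    proof (cases "\<bar>y $ i\<bar> \<le> int K")
      case True
      then have "card {max 0 (- y $ i)..<min (int K) (int K - y $ i)} = nat (int K - \<bar>y $ i\<bar>)" by (auto simp: abs_if)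
      moreover have "x i = \<bar>real_of_int (y $ i)\<bar> / real K"
      proof -
        have "\<bar>real_of_int (y $ i)\<bar> \<le> real K" using True by linarith
        then show ?thesis using K by (simp add: x_def)
      qed
      ultimately show ?thesis using K True by (simp add: field_simps)
    next
      case False
      then have "card {max 0 (- y $ i)..<min (int K) (int K - y $ i)} = 0"
        by (cases "0 \<le> y $ i") auto
      moreover have "x i = 1"
      proof -
        have "real K \<le> \<bar>real_of_int (y $ i)\<bar>" using False by linarith
        then show ?thesis using K by (simp add: x_def min_def)
      qed
      ultimately show ?thesis by simp
    qed
    then show ?thesis by (simp add: card_PiE)
  qed
  also have "\<dots> = real (K ^ CARD('n)) * (\<Prod>i\<in>UNIV. 1 - x i)" by (simp add: prod.distrib)
  also have "\<dots> \<ge> real (K ^ CARD('n)) * (1 - (\<Sum>i\<in>UNIV. x i))"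
    by (intro mult_left_mono Weierstrass_prod_ineq) (auto simp: x_def)
  finally have "real (K ^ CARD('n)) - real (card ?J) \<le> real (K ^ CARD('n)) * (\<Sum>i\<in>UNIV. x i)"
    by (simp add: right_diff_distrib)
  also have "\<dots> \<le> real (K ^ CARD('n)) * (real CARD('n) * norm j / (h * real K))"
  proof (rule mult_left_mono)
    have "x i \<le> norm j / (h * real K)" for i
    proof -
      have "h * \<bar>real_of_int (y $ i)\<bar> \<le> norm j"
        using component_le_norm_cart[of j i] h by (simp add: y E_def abs_mult)
      then have "\<bar>real_of_int (y $ i)\<bar> / real K \<le> norm j / (h * real K)" using h K by (simp add: field_simps)
      then show ?thesis by (simp add: x_def)
    qed
    then show "(\<Sum>i\<in>UNIV. x i) \<le> real CARD('n) * norm j / (h * real K)"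
      using sum_bounded_above[of UNIV x "norm j / (h * real K)"] by simp
  qed simp
  finally show "real (card {q \<in> lattice_cube h K. q + j \<notin> (lattice_cube h K :: (real^'n) set)})
        \<le> real (K ^ CARD('n)) * (real CARD('n) * norm j / (h * real K))" unfolding c .
qed

text \<open>For a given d only finitely many derivatives enter, namely none or M in a single
  direction, so one constant serves them all, uniformly in the parameter k.\<close>

lemma fourier_coeff_family_decay:
  fixes f :: "real^'n \<Rightarrow> real^'n \<Rightarrow> complex"
  assumes h: "0 < h" "h \<le> 1" and f: "\<And>k. k \<in> scaled_lattice h \<Longrightarrow> smooth (f k) \<and> torus_periodic (f k)"
    and bound: "\<And>\<beta>. \<exists>C. \<forall>k\<in>scaled_lattice h. \<forall>\<theta>. cmod (toroidal_deriv h \<beta> (f k) \<theta>) \<le> C * bracket k powr s"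
  shows "\<exists>C>0. \<forall>k\<in>scaled_lattice h. \<forall>j\<in>scaled_lattice h.
    cmod (fourier_coeff h (f k) j) \<le> C * (bracket k powr s * bracket j powr - d)"
proof -
  \<comment> \<open>A negative d gives M = 0, and - M is still at most - d.\<close>
  define M where "M = nat \<lceil>d\<rceil>"
  obtain C where C: "\<And>\<beta> k \<theta>. k \<in> scaled_lattice h \<Longrightarrow> cmod (toroidal_deriv h \<beta> (f k) \<theta>) \<le> C \<beta> * bracket k powr s"
    using bound by metis
  define B where "B = \<bar>C (\<lambda>_. 0)\<bar> + (\<Sum>j\<in>UNIV. \<bar>C (\<lambda>i. if i = j then M else 0)\<bar>) + 1"
  have CB: "C (\<lambda>_. 0) \<le> B" "C (\<lambda>i. if i = j then M else 0) \<le> B" for j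
  proof -
    have "0 \<le> (\<Sum>j\<in>UNIV. \<bar>C (\<lambda>i. if i = j then M else 0)\<bar>)" by (simp add: sum_nonneg)
    then show "C (\<lambda>_. 0) \<le> B" unfolding B_def by linarith
    have "\<bar>C (\<lambda>i. if i = j then M else 0)\<bar> \<le> (\<Sum>j\<in>UNIV. \<bar>C (\<lambda>i. if i = j then M else 0)\<bar>)"
      by (rule member_le_sum[where f = "\<lambda>j. \<bar>C (\<lambda>i. if i = j then M else 0)\<bar>"]) auto
    then show "C (\<lambda>i. if i = j then M else 0) \<le> B" unfolding B_def by linarith
  qed
  have B0: "0 < B" unfolding B_def by (intro add_nonneg_pos add_nonneg_nonneg sum_nonneg) auto
  define D where "D = (2 * real CARD('n)) ^ M * (1 + 2 ^ M + (2 * real M) ^ M)"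
  have D0: "0 < D" unfolding D_def by (intro mult_pos_pos zero_less_power add_pos_nonneg) auto
  show ?thesis
  proof (intro exI[of _ "D * B"] conjI ballI)
    show "0 < D * B" using D0 B0 by simp
    fix k j :: "real^'n" assume k: "k \<in> scaled_lattice h" and j: "j \<in> scaled_lattice h"
    have up: "C \<beta> * bracket k powr s \<le> B * bracket k powr s" if "C \<beta> \<le> B" for \<beta>
      using that by (rule mult_right_mono) simp
    have "cmod (fourier_coeff h (f k) j) \<le> D * (B * bracket k powr s) * bracket j powr - real M"
      unfolding D_def
    proof (rule fourier_coeff_decay[OF _ _ h j])
      show "cmod (f k \<theta>) \<le> B * bracket k powr s" for \<theta>
        using C[OF k, of "\<lambda>_. 0" \<theta>] up[OF CB(1)] unfolding toroidal_deriv_0 by (rule order_trans)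
      show "cmod (toroidal_deriv h (\<lambda>i. if i = ja then M else 0) (f k) \<theta>) \<le> B * bracket k powr s" for ja \<theta>
        using C[OF k, of "\<lambda>i. if i = ja then M else 0" \<theta>] up[OF CB(2)] order_trans by blast
    qed (use f[OF k] in auto)
    also have "\<dots> \<le> D * (B * bracket k powr s) * bracket j powr - d"
    proof (intro mult_left_mono bracket_powr_mono)
      show "- real M \<le> - d" unfolding M_def by linarith
    qed (use D0 B0 in auto)
    finally show "cmod (fourier_coeff h (f k) j) \<le> D * B * (bracket k powr s * bracket j powr - d)"
      by (simp add: mult_ac)
  qed
qed

section \<open>Generation of the lattice by axis steps\<close>

lemma lattice_axis: "h *\<^sub>R axis i 1 \<in> scaled_lattice h"
proof -
  have "h *\<^sub>R axis i 1 = h *\<^sub>R (\<chi> j. of_int ((axis i 1 :: int^'a) $ j))" by (simp add: vec_eq_iff axis_def)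
  then show ?thesis unfolding scaled_lattice_def by blast
qed

text \<open>Extends information on steps along the axes, the only differences that the symbol class
  controls directly, to arbitrary shifts.\<close>

lemma lattice_induct [consumes 1, case_names zero axis minus add]:
  fixes x :: "real^'n"
  assumes x: "x \<in> scaled_lattice h" and P0: "P 0" and axis: "\<And>i. P (h *\<^sub>R axis i 1)"
    and minus: "\<And>x. x \<in> scaled_lattice h \<Longrightarrow> P x \<Longrightarrow> P (- x)"
    and add: "\<And>x y. x \<in> scaled_lattice h \<Longrightarrow> y \<in> scaled_lattice h \<Longrightarrow> P x \<Longrightarrow> P y \<Longrightarrow> P (x + y)"
  shows "P x"
proof -
  obtain z :: "int^'n" where z: "x = h *\<^sub>R (\<chi> j. of_int (z $ j))" using x unfolding scaled_lattice_def by blast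
  define Q where "Q x \<longleftrightarrow> x \<in> scaled_lattice h \<and> P x" for x
  have Q: "Q 0" "\<And>i. Q (h *\<^sub>R axis i 1)" "\<And>x. Q x \<Longrightarrow> Q (- x)" "\<And>x y. Q x \<Longrightarrow> Q y \<Longrightarrow> Q (x + y)"
    unfolding Q_def by (auto intro: P0 axis minus add lattice_zero lattice_axis lattice_uminus lattice_add)
  have nat: "Q (real n *\<^sub>R (h *\<^sub>R axis i 1))" for n i
  proof (induction n)
    case (Suc n)
    then show ?case using Q(4)[OF Q(2)[of i] Suc.IH] by (simp only: of_nat_Suc scaleR_left_distrib scaleR_one)
  qed (simp add: Q)
  have int: "Q (of_int y *\<^sub>R (h *\<^sub>R axis i 1))" for y i
  proof (cases "0 \<le> y")
    case True
    then show ?thesis using nat[of "nat y" i] by simp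
  next
    case False
    then show ?thesis using Q(3)[OF nat[of "nat (- y)" i]] by simp
  qed
  have "Q (\<Sum>i\<in>I. of_int (z $ i) *\<^sub>R (h *\<^sub>R axis i 1))" if "finite I" for I
    using that
  proof (induction I)
    case (insert i I)
    show ?case unfolding sum.insert[OF insert.hyps] by (rule Q(4)[OF int insert.IH])
  qed (simp add: Q(1))
  then have "Q (\<Sum>i\<in>UNIV. of_int (z $ i) *\<^sub>R (h *\<^sub>R axis i 1))" by simp
  moreover have "(\<Sum>i\<in>UNIV. of_int (z $ i) *\<^sub>R (h *\<^sub>R axis i 1)) = x"
    by (simp add: z vec_eq_iff axis_def if_distrib[of "\<lambda>x. _ * x"] cong: if_cong)
  ultimately show ?thesis by (simp add: Q_def)
qed

section \<open>Symbol estimates in terms of Fourier coefficients\<close>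

locale elliptic_symbol =
  fixes h r :: real and \<sigma> :: "real^'n \<Rightarrow> real^'n \<Rightarrow> complex"
  assumes h: "0 < h" "h \<le> 1" and r: "0 < r" and symbol: "\<sigma> \<in> symbol_class h r"
    and elliptic: "\<exists>C0>0. \<exists>R>0. \<forall>k\<in>scaled_lattice h. \<forall>\<theta>. R \<le> norm k \<longrightarrow>
           Im (\<sigma> k \<theta>) = 0 \<and> - Re (\<sigma> k \<theta>) \<ge> C0 * norm k powr r"
begin

definition coeff :: "real^'n \<Rightarrow> real^'n \<Rightarrow> complex" where
  "coeff k j = fourier_coeff h (\<sigma> k) j"

definition kernel :: "real^'n \<Rightarrow> real^'n \<Rightarrow> complex" where
  "kernel k m = coeff k (k - m)"

lemma h0: "h \<noteq> 0" using h by simp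

lemma symbol_smooth: "k \<in> scaled_lattice h \<Longrightarrow> smooth (\<sigma> k)" "k \<in> scaled_lattice h \<Longrightarrow> torus_periodic (\<sigma> k)"
  using symbol by (auto simp: symbol_class_def)

lemma symbol_bound:
  "\<exists>C. \<forall>k\<in> scaled_lattice h. \<forall>\<theta>. cmod (toroidal_deriv h \<beta> (\<lambda>\<theta>'. multi_difference h \<alpha> (\<lambda>k'. \<sigma> k' \<theta>') k) \<theta>)
          \<le> C * bracket k powr (r - real (\<Sum>j\<in>UNIV. \<alpha> j))"
  using symbol unfolding symbol_class_def bracket_def by blast

lemma coeff_decay:
  "\<exists>C>0. \<forall>k\<in> scaled_lattice h. \<forall>j\<in> scaled_lattice h. cmod (coeff k j) \<le> C * (bracket k powr r * bracket j powr - d)"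
  unfolding coeff_def
proof (rule fourier_coeff_family_decay[OF h])
  show "\<exists>C. \<forall>k\<in> scaled_lattice h. \<forall>\<theta>. cmod (toroidal_deriv h \<beta> (\<sigma> k) \<theta>) \<le> C * bracket k powr r" for \<beta>
    using symbol_bound[of \<beta> "\<lambda>_. 0"] by (simp add: multi_difference_0)
qed (use symbol_smooth in auto)

sublocale decaying_kernel h r kernel
proof
  show "\<exists>C>0. \<forall>k\<in> scaled_lattice h. \<forall>m\<in> scaled_lattice h. cmod (kernel k m) \<le> C * (bracket k powr r * bracket (k - m) powr - d)" for d
    using coeff_decay[of d] unfolding kernel_def by (meson lattice_diff)
qed (use h in auto)

text \<open>The Fourier coefficient of \<open>difference\<close> is bounded by the symbol class at
  order r - 1; multiplying back by h, which is at most 1, does not enlarge the constant.\<close>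

lemma coeff_difference_axis:
  "\<exists>C>0. \<forall>k\<in>L. \<forall>j\<in>L. cmod (coeff (k + h *\<^sub>R axis i 1) j - coeff k j) \<le> C * (bracket k powr (r - 1) * bracket j powr - d)"
proof -
  let ?f = "\<lambda>k \<theta>. difference h i (\<lambda>k'. \<sigma> k' \<theta>) k"
  have f: "?f k = (\<lambda>\<theta>. (1 / h) * \<sigma> (k + h *\<^sub>R axis i 1) \<theta> + (- 1 / h) * \<sigma> k \<theta>)" for k
    using h by (simp add: difference_def fun_eq_iff field_simps)
  have k': "k + h *\<^sub>R axis i 1 \<in> L" if "k \<in> L" for k by (rule lattice_add[OF that lattice_axis])
  have "\<exists>C>0. \<forall>k\<in>L. \<forall>j\<in>L. cmod (fourier_coeff h (?f k) j) \<le> C * (bracket k powr (r - 1) * bracket j powr - d)"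
  proof (rule fourier_coeff_family_decay[OF h])
    show "\<exists>C. \<forall>k\<in>L. \<forall>\<theta>. cmod (toroidal_deriv h \<beta> (?f k) \<theta>) \<le> C * bracket k powr (r - 1)" for \<beta>
      using symbol_bound[of \<beta> "\<lambda>j. if j = i then 1 else 0"] by (simp only: multi_difference_single) simp
    fix k assume k: "k \<in> L"
    show "smooth (?f k) \<and> torus_periodic (?f k)"
    proof
      show "smooth (?f k)" unfolding f by (intro smooth_linear_combination symbol_smooth k k')
      show "torus_periodic (?f k)"
        unfolding f using symbol_smooth(2)[OF k] symbol_smooth(2)[OF k'[OF k]] by (simp add: torus_periodic_def)
    qed
  qed
  then obtain C where C: "C > 0" "\<And>k j. k \<in> L \<Longrightarrow> j \<in> L \<Longrightarrow>
      cmod (fourier_coeff h (?f k) j) \<le> C * (bracket k powr (r - 1) * bracket j powr - d)" by blast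
  show ?thesis
  proof (intro exI[of _ C] conjI C(1) ballI)
    fix k j :: "real^'n" assume k: "k \<in> L" and j: "j \<in> L"
    have "fourier_coeff h (?f k) j = (1 / h) * coeff (k + h *\<^sub>R axis i 1) j + (- 1 / h) * coeff k j"
      unfolding f coeff_def
      by (rule fourier_coeff_linear_combination) (intro smooth_continuous symbol_smooth k k')+
    then have "coeff (k + h *\<^sub>R axis i 1) j - coeff k j = h * fourier_coeff h (?f k) j"
      using h by (simp add: field_simps)
    then have "cmod (coeff (k + h *\<^sub>R axis i 1) j - coeff k j) = h * cmod (fourier_coeff h (?f k) j)"
      using h by (simp add: norm_mult)
    also have "\<dots> \<le> 1 * (C * (bracket k powr (r - 1) * bracket j powr - d))"
      by (intro mult_mono C k j) (use h in auto)
    finally show "cmod (coeff (k + h *\<^sub>R axis i 1) j - coeff k j) \<le> C * (bracket k powr (r - 1) * bracket j powr - d)" by simp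
  qed
qed

text \<open>Differences along a sum of shifts telescope, and Peetre moves the weight from the
  intermediate point back to k. The constant grows with x; only the finitely many shifts in a fixed
  cube will be used.\<close>

lemma coeff_difference:
  assumes "x \<in> L"
  shows "\<exists>C\<ge>0. \<forall>k\<in>L. \<forall>j\<in>L. cmod (coeff (k + x) j - coeff k j) \<le> C * (bracket k powr (r - 1) * bracket j powr - d)"
  using assms
proof (induct x rule: lattice_induct)
  case zero
  show ?case by (intro exI[of _ 0]) simp
next
  case (axis i)
  then show ?case using coeff_difference_axis[of i d] less_imp_le by blast
next
  case (minus x)
  then obtain C where C: "C \<ge> 0" "\<And>k j. k \<in> L \<Longrightarrow> j \<in> L \<Longrightarrow>
      cmod (coeff (k + x) j - coeff k j) \<le> C * (bracket k powr (r - 1) * bracket j powr - d)" by blast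
  show ?case
  proof (intro exI[of _ "C * bracket x powr \<bar>r - 1\<bar>"] conjI ballI)
    show "0 \<le> C * bracket x powr \<bar>r - 1\<bar>" using C(1) by simp
    fix k j :: "real^'n" assume k: "k \<in> L" and j: "j \<in> L"
    have "cmod (coeff (k + - x) j - coeff k j) = cmod (coeff (k - x + x) j - coeff (k - x) j)" by (simp add: norm_minus_commute)
    also have "\<dots> \<le> C * (bracket (k - x) powr (r - 1) * bracket j powr - d)"
      by (intro C lattice_diff k minus(1) j)
    also have "\<dots> \<le> C * ((bracket k powr (r - 1) * bracket x powr \<bar>r - 1\<bar>) * bracket j powr - d)"
      using peetre_powr[of "k - x" "r - 1" k] C(1) by (intro mult_left_mono mult_right_mono) (auto simp: bracket_def)
    finally show "cmod (coeff (k + - x) j - coeff k j) \<le> C * bracket x powr \<bar>r - 1\<bar> * (bracket k powr (r - 1) * bracket j powr - d)"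
      by (simp add: mult_ac)
  qed
next
  case (add x y)
  obtain C where C: "C \<ge> 0" "\<And>k j. k \<in> L \<Longrightarrow> j \<in> L \<Longrightarrow>
      cmod (coeff (k + x) j - coeff k j) \<le> C * (bracket k powr (r - 1) * bracket j powr - d)" using add(3) by blast
  obtain C' where C': "C' \<ge> 0" "\<And>k j. k \<in> L \<Longrightarrow> j \<in> L \<Longrightarrow>
      cmod (coeff (k + y) j - coeff k j) \<le> C' * (bracket k powr (r - 1) * bracket j powr - d)" using add(4) by blast
  show ?case
  proof (intro exI[of _ "C' * bracket x powr \<bar>r - 1\<bar> + C"] conjI ballI)
    show "0 \<le> C' * bracket x powr \<bar>r - 1\<bar> + C" using C(1) C'(1) by simp
    fix k j :: "real^'n" assume k: "k \<in> L" and j: "j \<in> L"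
    have "cmod (coeff (k + (x + y)) j - coeff k j)
        \<le> cmod (coeff (k + x + y) j - coeff (k + x) j) + cmod (coeff (k + x) j - coeff k j)"
      using norm_triangle_ineq[of "coeff (k + x + y) j - coeff (k + x) j" "coeff (k + x) j - coeff k j"]
      by (simp add: add.assoc)
    also have "cmod (coeff (k + x + y) j - coeff (k + x) j) \<le> C' * (bracket (k + x) powr (r - 1) * bracket j powr - d)"
      by (intro C' lattice_add k add(1) j)
    also have "\<dots> \<le> C' * ((bracket k powr (r - 1) * bracket x powr \<bar>r - 1\<bar>) * bracket j powr - d)"
      using peetre_powr[of "k + x" "r - 1" k] C'(1) by (intro mult_left_mono mult_right_mono) (auto simp: bracket_def)
    also have "cmod (coeff (k + x) j - coeff k j) \<le> C * (bracket k powr (r - 1) * bracket j powr - d)"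
      by (intro C k j)
    finally show "cmod (coeff (k + (x + y)) j - coeff k j) \<le> (C' * bracket x powr \<bar>r - 1\<bar> + C) * (bracket k powr (r - 1) * bracket j powr - d)"
      by (simp add: algebra_simps)
  qed
qed

text \<open>For |k| at least R, \<open>bracket k\<close> is at most (1 + 1/R) |k|, which fixes c. On
  the remaining ball the symbol and the weight are bounded, and C makes up for both.\<close>

lemma symbol_upper_bound:
  "\<exists>c>0. \<exists>C\<ge>0. \<forall>k\<in>L. \<forall>\<theta>. Re (\<sigma> k \<theta>) \<le> C - c * bracket k powr r"
proof -
  obtain C0 R where C0: "C0 > 0" and R: "R > 0" and ell: "\<And>k \<theta>. k \<in> L \<Longrightarrow> R \<le> norm k \<Longrightarrow> - Re (\<sigma> k \<theta>) \<ge> C0 * norm k powr r"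
    using elliptic by blast
  obtain B where B: "\<And>k \<theta>. k \<in> L \<Longrightarrow> cmod (\<sigma> k \<theta>) \<le> B * bracket k powr r"
    using symbol_bound[of "\<lambda>_. 0" "\<lambda>_. 0"] by (auto simp: multi_difference_0 toroidal_deriv_0)
  define c where "c = C0 * (1 + 1 / R) powr - r"
  have "0 < 1 + 1 / R" using R by (simp add: add_pos_pos)
  then have R2: "1 + 1 / R \<noteq> 0" by linarith
  have c: "c > 0" unfolding c_def using C0 R2 by (intro mult_pos_pos) simp_all
  define C where "C = (\<bar>B\<bar> + c) * (1 + R) powr r"
  have C: "C \<ge> 0" using c by (simp add: C_def)
  have "Re (\<sigma> k \<theta>) \<le> C - c * bracket k powr r" if k: "k \<in> L" for k \<theta>
  proof (cases "R \<le> norm k")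
    case True
    have "bracket k \<le> (1 + 1 / R) * norm k" using True R by (simp add: bracket_def field_simps)
    then have "bracket k powr r \<le> ((1 + 1 / R) * norm k) powr r" using r by (intro powr_mono2) (auto simp: less_imp_le)
    also have "\<dots> = (1 + 1 / R) powr r * norm k powr r" using R by (simp add: powr_mult)
    finally have "c * bracket k powr r \<le> c * ((1 + 1 / R) powr r * norm k powr r)" using c by (intro mult_left_mono) auto
    also have "\<dots> = C0 * norm k powr r"
    proof -
      have "(1 + 1 / R) powr - r * (1 + 1 / R) powr r = 1"
        unfolding powr_add[symmetric] using R2 by simp
      then show ?thesis by (simp add: c_def mult_ac)
    qed
    finally show ?thesis using ell[OF k True, of \<theta>] C by linarith
  next
    case False
    have "bracket k powr r \<le> (1 + R) powr r" using False r by (intro powr_mono2) (auto simp: bracket_def)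
    then have "(\<bar>B\<bar> + c) * bracket k powr r \<le> C" using c by (auto simp: C_def intro: mult_left_mono)
    moreover have "Re (\<sigma> k \<theta>) \<le> \<bar>B\<bar> * bracket k powr r"
    proof -
      have "Re (\<sigma> k \<theta>) \<le> cmod (\<sigma> k \<theta>)" by (rule complex_Re_le_cmod)
      also have "\<dots> \<le> B * bracket k powr r" by (rule B[OF k])
      also have "\<dots> \<le> \<bar>B\<bar> * bracket k powr r" by (intro mult_right_mono) auto
      finally show ?thesis .
    qed
    ultimately show ?thesis by (simp add: algebra_simps)
  qed
  then show ?thesis using c C by blast
qed

text \<open>Garding's inequality by freezing: the symbol is replaced on each translate \<open>p + Q\<close> of a large
  cube by its value at \<open>p\<close>, where the form is an integral of \<open>Re (\<sigma> p)\<close> against a square, and the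
  result is averaged over \<open>p\<close>. The pairs \<open>(k, m)\<close> separated by the boundary of the cubes contribute an
  error of order \<open>r\<close> with small constant, the freezing one of order \<open>r - 1\<close>.\<close>

lemma garding_inequality:
  "\<exists>c>0. \<exists>C. \<forall>F u. finite F \<longrightarrow> F \<subseteq> L \<longrightarrow>
      (\<Sum>k\<in>F. Re (cnj (u k) * (\<Sum>m\<in>F. kernel k m * u m))) \<le> (\<Sum>k\<in>F. (C - c * bracket k powr r) * (cmod (u k))\<^sup>2)"
proof -
  obtain c C1 where c: "c > 0" and C1: "C1 \<ge> 0" and up: "\<And>k \<theta>. k \<in> L \<Longrightarrow> Re (\<sigma> k \<theta>) \<le> C1 - c * bracket k powr r"
    using symbol_upper_bound by blast
  \<comment> \<open>Large enough for \<open>schur_form\<close> at the orders r and r - 1. The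
    coefficients are taken with decay d + 1, since the fraction of cubes separating k from m grows
    like |k - m|.\<close>
  define d where "d = 2 * real CARD('n) + \<bar>r\<bar> + \<bar>r - 1\<bar>"
  obtain B where B: "B > 0" "\<And>k j. k \<in> L \<Longrightarrow> j \<in> L \<Longrightarrow> cmod (coeff k j) \<le> B * (bracket k powr r * bracket j powr - (d + 1))"
    using coeff_decay by blast
  obtain S where S: "S > 0" "\<And>F (u::real^'n \<Rightarrow> real). finite F \<Longrightarrow> F \<subseteq> L \<Longrightarrow>
    (\<Sum>k\<in>F. \<Sum>m\<in>F. bracket k powr r * bracket (k - m) powr - d * (\<bar>u k\<bar> * \<bar>u m\<bar>)) \<le> S * (\<Sum>k\<in>F. bracket k powr r * (u k)\<^sup>2)"
    using schur_form[OF h, where 'n = 'n and s = r and d = d] by (auto simp: d_def)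
  obtain S' where S': "S' > 0" "\<And>F (u::real^'n \<Rightarrow> real). finite F \<Longrightarrow> F \<subseteq> L \<Longrightarrow>
    (\<Sum>k\<in>F. \<Sum>m\<in>F. bracket k powr (r - 1) * bracket (k - m) powr - d * (\<bar>u k\<bar> * \<bar>u m\<bar>)) \<le> S' * (\<Sum>k\<in>F. bracket k powr (r - 1) * (u k)\<^sup>2)"
    using schur_form[OF h, where 'n = 'n and s = "r - 1" and d = d] by (auto simp: d_def)
  \<comment> \<open>The side of the cubes makes the boundary error at most a third of the
    ellipticity constant. Freezing has an error that grows with K, but it is of lower order, so K is
    fixed first.\<close>
  obtain K :: nat where K: "K > 0" "B * real CARD('n) * S / (h * real K) \<le> c / 3"
  proof -
    obtain K :: nat where K: "3 * B * real CARD('n) * S / (h * c) + 1 \<le> real K" using real_arch_simple by blast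
    have "0 \<le> 3 * B * real CARD('n) * S / (h * c)" using B S h c by simp
    then have K0: "K > 0" using K by (cases K) auto
    have "3 * B * real CARD('n) * S / (h * c) \<le> real K" using K by simp
    then have "B * real CARD('n) * S / (h * real K) \<le> c / 3" using K0 h c by (simp add: field_simps)
    then show ?thesis using that K0 by blast
  qed
  define Q where "Q = (lattice_cube h K :: (real^'n) set)"
  define V where "V = real (K ^ CARD('n))"
  have Q: "finite Q" "Q \<subseteq> L" "real (card Q) = V" and Q_boundary: "\<And>j. j \<in> L \<Longrightarrow>
      real (card {q \<in> Q. q + j \<notin> Q}) \<le> V * (real CARD('n) * norm j / (h * real K))"
    using lattice_cube[OF h(1), where 'n = 'n and K = K] K(1) by (auto simp: Q_def V_def)
  have V: "V > 0" using K(1) by (simp add: V_def)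
  have "\<forall>q\<in>Q. \<exists>E\<ge>0. \<forall>k\<in>L. \<forall>j\<in>L. cmod (coeff (k + - q) j - coeff k j) \<le> E * (bracket k powr (r - 1) * bracket j powr - d)"
    using coeff_difference lattice_uminus Q(2) by blast
  then obtain E where E: "\<And>q. q \<in> Q \<Longrightarrow> E q \<ge> 0" "\<And>q k j. q \<in> Q \<Longrightarrow> k \<in> L \<Longrightarrow> j \<in> L \<Longrightarrow>
      cmod (coeff (k + - q) j - coeff k j) \<le> E q * (bracket k powr (r - 1) * bracket j powr - d)" by metis
  define E1 where "E1 = (\<Sum>q\<in>Q. E q)"
  have E1: "E1 \<ge> 0" "\<And>q. q \<in> Q \<Longrightarrow> E q \<le> E1"
    unfolding E1_def using E(1) Q(1) by (auto intro: sum_nonneg member_le_sum)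
  \<comment> \<open>The constant of \<open>bracket_quotient_powr\<close> for the exponent - r, made
    uniform over the cube.\<close>
  define E2 where "E2 = (\<Sum>q\<in>Q. r * bracket q powr (2 + \<bar>- r - 1\<bar>))"
  have E2: "\<And>q. q \<in> Q \<Longrightarrow> r * bracket q powr (2 + \<bar>- r - 1\<bar>) \<le> E2" and E2_nonneg: "E2 \<ge> 0"
  proof -
    show "E2 \<ge> 0" unfolding E2_def using r by (simp add: sum_nonneg)
    show "r * bracket q powr (2 + \<bar>- r - 1\<bar>) \<le> E2" if "q \<in> Q" for q
      unfolding E2_def
      by (rule member_le_sum[where f = "\<lambda>q. r * bracket q powr (2 + \<bar>- r - 1\<bar>)", OF that]) (use r Q(1) in auto)
  qed
  have lower: "bracket (k - q) powr r \<ge> bracket k powr r - E2 * bracket k powr (r - 1)" if "q \<in> Q" for k q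
  proof -
    have "\<bar>(bracket k / bracket (k - q)) powr - r - 1\<bar> \<le> \<bar>- r\<bar> * (bracket q powr (2 + \<bar>- r - 1\<bar>) / bracket k)"
      using bracket_quotient_powr[of k "k - q" "- r"] by simp
    also have "\<dots> \<le> E2 / bracket k" using E2[OF that] r by (simp add: divide_right_mono less_imp_le)
    finally have "1 - E2 / bracket k \<le> (bracket k / bracket (k - q)) powr - r" by linarith
    also have "\<dots> = bracket (k - q) powr r / bracket k powr r"
      by (simp add: powr_divide less_imp_le powr_minus field_simps)
    finally have "bracket k powr r * (1 - E2 / bracket k) \<le> bracket k powr r * (bracket (k - q) powr r / bracket k powr r)"
      by (rule mult_left_mono) simp
    moreover have "bracket k powr r / bracket k = bracket k powr (r - 1)" by (simp add: powr_diff)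
    ultimately show ?thesis by (simp add: right_diff_distrib) (metis mult.commute times_divide_eq_left)
  qed
  obtain C' where C': "C' \<ge> 0" "\<And>x. x \<ge> 1 \<Longrightarrow> (c * E2 + E1 * S') * x powr (r - 1) \<le> c / 3 * x powr r + C'"
    using absorb_lower_order[of "c / 3" "c * E2 + E1 * S'" r] c E1 E2_nonneg S' by auto
  show ?thesis
  proof (rule exI[of _ "c / 3"], intro exI[of _ "C1 + C'"] conjI allI impI)
    show "0 < c / 3" using c by simp
    fix F and u :: "real^'n \<Rightarrow> complex" assume F: "finite F" "F \<subseteq> L"
    \<comment> \<open>All p whose translate of Q meets F. Every k in F lies in exactly V of these
      translates, one for each point of Q.\<close>
    define P where "P = (\<lambda>(k, q). k - q) ` (F \<times> Q)"
    have P: "finite P" "P \<subseteq> L" using F Q by (auto simp: P_def intro: lattice_diff)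
    have Pk: "{p \<in> P. k - p \<in> Q} = (\<lambda>q. k - q) ` Q" if "k \<in> F" for k
      using that by (force simp: P_def image_iff)
    have inj: "inj_on (\<lambda>q. k - q) X" for k :: "real^'n" and X by (auto simp: inj_on_def)
    have sumP: "(\<Sum>p\<in>P. if k - p \<in> Q then g p else 0) = (\<Sum>q\<in>Q. g (k - q))" if "k \<in> F" for k and g :: "real^'n \<Rightarrow> 'z::comm_monoid_add"
    proof -
      have "(\<Sum>p\<in>P. if k - p \<in> Q then g p else 0) = (\<Sum>p\<in>{p \<in> P. k - p \<in> Q}. g p)"
        using P(1) by (simp add: sum.inter_filter)
      also have "\<dots> = (\<Sum>q\<in>Q. g (k - q))" unfolding Pk[OF that] by (simp add: sum.reindex[OF inj])
      finally show ?thesis .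
    qed
    define X where "X k m = cnj (u k) * u m" for k m
    have frozen: "Re (\<Sum>k\<in>{k\<in>F. k - p \<in> Q}. \<Sum>m\<in>{m\<in>F. m - p \<in> Q}. X k m * coeff p (k - m))
        \<le> (\<Sum>k\<in>{k\<in>F. k - p \<in> Q}. (C1 - c * bracket p powr r) * (cmod (u k))\<^sup>2)" if p: "p \<in> P" for p
    proof -
      have "p \<in> L" using p P by blast
      then have "Re (\<Sum>k\<in>{k\<in>F. k - p \<in> Q}. cnj (u k) * (\<Sum>m\<in>{k\<in>F. k - p \<in> Q}. fourier_coeff h (\<sigma> p) (k - m) * u m))
          \<le> (C1 - c * bracket p powr r) * (\<Sum>k\<in>{k\<in>F. k - p \<in> Q}. (cmod (u k))\<^sup>2)"
        by (intro fourier_form_le h0 smooth_continuous symbol_smooth up) (use F in auto)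
      then show ?thesis by (simp add: X_def coeff_def sum_distrib_left mult_ac)
    qed
    define J where "J k m = (\<Sum>q\<in>Q. if q + (m - k) \<in> Q then coeff (k - q) (k - m) else 0)" for k m
    \<comment> \<open>Double counting: the sum over pairs and their common translates becomes a sum
      over translates of the forms restricted to them, to which \<open>frozen\<close>
      applies.\<close>
    have "(\<Sum>k\<in>F. \<Sum>m\<in>F. X k m * J k m)
        = (\<Sum>k\<in>F. \<Sum>m\<in>F. \<Sum>p\<in>P. if k - p \<in> Q then if m - p \<in> Q then X k m * coeff p (k - m) else 0 else 0)"
    proof (intro sum.cong refl)
      fix k m assume "k \<in> F"
      show "X k m * J k m = (\<Sum>p\<in>P. if k - p \<in> Q then if m - p \<in> Q then X k m * coeff p (k - m) else 0 else 0)"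
        unfolding sumP[OF \<open>k \<in> F\<close>] J_def sum_distrib_left
        by (intro sum.cong refl) (simp add: algebra_simps)
    qed
    also have "\<dots> = (\<Sum>k\<in>F. \<Sum>p\<in>P. \<Sum>m\<in>F. if k - p \<in> Q then if m - p \<in> Q then X k m * coeff p (k - m) else 0 else 0)"
      by (rule sum.cong[OF refl]) (rule sum.swap)
    also have "\<dots> = (\<Sum>p\<in>P. \<Sum>k\<in>F. \<Sum>m\<in>F. if k - p \<in> Q then if m - p \<in> Q then X k m * coeff p (k - m) else 0 else 0)"
      by (rule sum.swap)
    also have "\<dots> = (\<Sum>p\<in>P. \<Sum>k\<in>{k\<in>F. k - p \<in> Q}. \<Sum>m\<in>{m\<in>F. m - p \<in> Q}. X k m * coeff p (k - m))"
    proof (rule sum.cong[OF refl])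
      fix p
      have "(\<Sum>m\<in>F. if k - p \<in> Q then if m - p \<in> Q then X k m * coeff p (k - m) else 0 else 0)
          = (if k - p \<in> Q then \<Sum>m\<in>{m\<in>F. m - p \<in> Q}. X k m * coeff p (k - m) else 0)" for k
        unfolding sum.inter_filter[OF F(1)] by simp
      then show "(\<Sum>k\<in>F. \<Sum>m\<in>F. if k - p \<in> Q then if m - p \<in> Q then X k m * coeff p (k - m) else 0 else 0)
          = (\<Sum>k\<in>{k\<in>F. k - p \<in> Q}. \<Sum>m\<in>{m\<in>F. m - p \<in> Q}. X k m * coeff p (k - m))"
        by (simp only: sum.inter_filter[OF F(1), of "\<lambda>k. \<Sum>m\<in>{m\<in>F. m - p \<in> Q}. X k m * coeff p (k - m)"])
    qed
    finally have swapped: "(\<Sum>k\<in>F. \<Sum>m\<in>F. X k m * J k m)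
        = (\<Sum>p\<in>P. \<Sum>k\<in>{k\<in>F. k - p \<in> Q}. \<Sum>m\<in>{m\<in>F. m - p \<in> Q}. X k m * coeff p (k - m))" .
    have "Re (\<Sum>k\<in>F. \<Sum>m\<in>F. X k m * J k m)
        = (\<Sum>p\<in>P. Re (\<Sum>k\<in>{k\<in>F. k - p \<in> Q}. \<Sum>m\<in>{m\<in>F. m - p \<in> Q}. X k m * coeff p (k - m)))"
      unfolding swapped by (rule Re_sum)
    also have "\<dots> \<le> (\<Sum>p\<in>P. \<Sum>k\<in>{k\<in>F. k - p \<in> Q}. (C1 - c * bracket p powr r) * (cmod (u k))\<^sup>2)"
      by (rule sum_mono[OF frozen])
    also have "\<dots> = (\<Sum>k\<in>F. \<Sum>p\<in>P. if k - p \<in> Q then (C1 - c * bracket p powr r) * (cmod (u k))\<^sup>2 else 0)"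
      unfolding sum.inter_filter[OF F(1)] by (rule sum.swap)
    also have "\<dots> = (\<Sum>k\<in>F. \<Sum>q\<in>Q. (C1 - c * bracket (k - q) powr r) * (cmod (u k))\<^sup>2)"
      by (intro sum.cong refl sumP)
    also have "\<dots> \<le> (\<Sum>k\<in>F. \<Sum>q\<in>Q. (C1 - c * (bracket k powr r - E2 * bracket k powr (r - 1))) * (cmod (u k))\<^sup>2)"
      using c by (intro sum_mono mult_right_mono diff_left_mono mult_left_mono lower) auto
    also have "\<dots> = V * (\<Sum>k\<in>F. (C1 - c * (bracket k powr r - E2 * bracket k powr (r - 1))) * (cmod (u k))\<^sup>2)"
      by (simp add: Q(3) sum_distrib_left)
    finally have main: "Re (\<Sum>k\<in>F. \<Sum>m\<in>F. X k m * J k m)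
        \<le> V * (\<Sum>k\<in>F. (C1 - c * (bracket k powr r - E2 * bracket k powr (r - 1))) * (cmod (u k))\<^sup>2)" .
    have err: "cmod (V * coeff k (k - m) - J k m)
        \<le> V * (E1 * (bracket k powr (r - 1) * bracket (k - m) powr - d)
          + B * real CARD('n) / (h * real K) * (bracket k powr r * bracket (k - m) powr - d))"
      if "k \<in> F" "m \<in> F" for k m
    proof -
      have kL: "k \<in> L" "k - m \<in> L" "m - k \<in> L" using that F by (auto intro: lattice_diff)
      define \<eta> where "\<eta> = E1 * (bracket k powr (r - 1) * bracket (k - m) powr - d)"
      have \<eta>0: "0 \<le> \<eta>" using E1 by (simp add: \<eta>_def)
      have "of_real V * coeff k (k - m) - J k m = (\<Sum>q\<in>Q. coeff k (k - m) - (if q + (m - k) \<in> Q then coeff (k - q) (k - m) else 0))"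
      proof -
        have "complex_of_real V = of_nat (card Q)" using Q(3) by (metis of_real_of_nat_eq)
        then show ?thesis by (simp add: J_def sum_subtractf)
      qed
      then have "cmod (V * coeff k (k - m) - J k m)
          \<le> (\<Sum>q\<in>Q. cmod (coeff k (k - m) - (if q + (m - k) \<in> Q then coeff (k - q) (k - m) else 0)))"
        by (simp only: norm_sum)
      \<comment> \<open>A translate containing both points contributes a freezing error, one
        containing only k loses the entry altogether; the latter are counted by
        \<open>Q_boundary\<close>.\<close>
      also have "\<dots> \<le> (\<Sum>q\<in>Q. \<eta> + (if q + (m - k) \<notin> Q then cmod (coeff k (k - m)) else 0))"
      proof (rule sum_mono)
        fix q assume q: "q \<in> Q"
        have "cmod (coeff k (k - m) - coeff (k - q) (k - m)) \<le> E q * (bracket k powr (r - 1) * bracket (k - m) powr - d)"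
          using E(2)[OF q kL(1,2)] by (simp add: norm_minus_commute)
        also have "\<dots> \<le> \<eta>" unfolding \<eta>_def by (intro mult_right_mono E1(2) q) simp
        finally show "cmod (coeff k (k - m) - (if q + (m - k) \<in> Q then coeff (k - q) (k - m) else 0))
            \<le> \<eta> + (if q + (m - k) \<notin> Q then cmod (coeff k (k - m)) else 0)"
          using \<eta>0 by auto
      qed
      also have "\<dots> = V * \<eta> + real (card {q \<in> Q. q + (m - k) \<notin> Q}) * cmod (coeff k (k - m))"
        using Q by (simp add: sum.distrib sum.inter_filter[symmetric])
      also have "\<dots> \<le> V * \<eta> + V * (real CARD('n) * norm (m - k) / (h * real K)) * (B * (bracket k powr r * bracket (k - m) powr - (d + 1)))"
        by (intro add_left_mono mult_mono Q_boundary B kL) (use V h in auto)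
      also have "\<dots> = V * \<eta> + V * (B * real CARD('n) / (h * real K)) * (bracket k powr r * (norm (m - k) * bracket (k - m) powr - (d + 1)))"
        by (simp add: mult_ac)
      also have "\<dots> \<le> V * \<eta> + V * (B * real CARD('n) / (h * real K)) * (bracket k powr r * bracket (k - m) powr - d)"
      proof (intro add_left_mono mult_left_mono)
        have "norm (m - k) * bracket (k - m) powr - (d + 1) \<le> bracket (k - m) * bracket (k - m) powr - (d + 1)"
          by (intro mult_right_mono) (auto simp: bracket_def norm_minus_commute)
        also have "\<dots> = bracket (k - m) powr - d"
          using powr_add[of "bracket (k - m)" 1 "- (d + 1)"] by (simp add: less_imp_le)
        finally show "norm (m - k) * bracket (k - m) powr - (d + 1) \<le> bracket (k - m) powr - d" .
      qed (use V B h in auto)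
      finally show ?thesis by (simp add: \<eta>_def distrib_left mult_ac)
    qed
    define b where "b = B * real CARD('n) / (h * real K)"
    have b0: "0 \<le> b" using B h by (simp add: b_def)
    have "Re (\<Sum>k\<in>F. \<Sum>m\<in>F. X k m * (V * coeff k (k - m) - J k m))
        \<le> (\<Sum>k\<in>F. \<Sum>m\<in>F. cmod (X k m) * cmod (V * coeff k (k - m) - J k m))"
      by (rule order_trans[OF complex_Re_le_cmod], rule order_trans[OF norm_sum], intro sum_mono,
          rule order_trans[OF norm_sum]) (simp add: norm_mult)
    also have "\<dots> \<le> (\<Sum>k\<in>F. \<Sum>m\<in>F. V * (E1 * (bracket k powr (r - 1) * bracket (k - m) powr - d * (\<bar>cmod (u k)\<bar> * \<bar>cmod (u m)\<bar>))
        + b * (bracket k powr r * bracket (k - m) powr - d * (\<bar>cmod (u k)\<bar> * \<bar>cmod (u m)\<bar>))))"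
    proof (intro sum_mono)
      fix k m assume km: "k \<in> F" "m \<in> F"
      have "cmod (X k m) * cmod (V * coeff k (k - m) - J k m) \<le> (cmod (u k) * cmod (u m)) *
          (V * (E1 * (bracket k powr (r - 1) * bracket (k - m) powr - d) + b * (bracket k powr r * bracket (k - m) powr - d)))"
        using err[OF km] by (intro mult_mono) (auto simp: X_def norm_mult b_def)
      then show "cmod (X k m) * cmod (V * coeff k (k - m) - J k m) \<le> V * (E1 * (bracket k powr (r - 1) * bracket (k - m) powr - d * (\<bar>cmod (u k)\<bar> * \<bar>cmod (u m)\<bar>))
        + b * (bracket k powr r * bracket (k - m) powr - d * (\<bar>cmod (u k)\<bar> * \<bar>cmod (u m)\<bar>)))"
        by (simp add: algebra_simps)
    qed
    also have "\<dots> = V * (E1 * (\<Sum>k\<in>F. \<Sum>m\<in>F. bracket k powr (r - 1) * bracket (k - m) powr - d * (\<bar>cmod (u k)\<bar> * \<bar>cmod (u m)\<bar>))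
        + b * (\<Sum>k\<in>F. \<Sum>m\<in>F. bracket k powr r * bracket (k - m) powr - d * (\<bar>cmod (u k)\<bar> * \<bar>cmod (u m)\<bar>)))"
      by (simp only: sum_distrib_left[symmetric] sum.distrib)
    also have "\<dots> \<le> V * (E1 * (S' * (\<Sum>k\<in>F. bracket k powr (r - 1) * (cmod (u k))\<^sup>2)) + b * (S * (\<Sum>k\<in>F. bracket k powr r * (cmod (u k))\<^sup>2)))"
      using V E1 b0 by (intro mult_left_mono add_mono S(2) S'(2) F) auto
    finally have error: "Re (\<Sum>k\<in>F. \<Sum>m\<in>F. X k m * (V * coeff k (k - m) - J k m))
        \<le> V * (E1 * (S' * (\<Sum>k\<in>F. bracket k powr (r - 1) * (cmod (u k))\<^sup>2)) + b * (S * (\<Sum>k\<in>F. bracket k powr r * (cmod (u k))\<^sup>2)))" .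
    have "V * (\<Sum>k\<in>F. Re (cnj (u k) * (\<Sum>m\<in>F. kernel k m * u m))) = Re (\<Sum>k\<in>F. \<Sum>m\<in>F. X k m * (V * coeff k (k - m)))"
    proof -
      have "(\<Sum>k\<in>F. \<Sum>m\<in>F. X k m * (V * coeff k (k - m))) = of_real V * (\<Sum>k\<in>F. cnj (u k) * (\<Sum>m\<in>F. kernel k m * u m))"
        by (simp add: X_def kernel_def sum_distrib_left mult_ac)
      then show ?thesis by simp
    qed
    also have "\<dots> = Re (\<Sum>k\<in>F. \<Sum>m\<in>F. X k m * (V * coeff k (k - m) - J k m)) + Re (\<Sum>k\<in>F. \<Sum>m\<in>F. X k m * J k m)"
      by (simp add: right_diff_distrib sum_subtractf)
    also have "\<dots> \<le> V * (E1 * (S' * (\<Sum>k\<in>F. bracket k powr (r - 1) * (cmod (u k))\<^sup>2)) + b * (S * (\<Sum>k\<in>F. bracket k powr r * (cmod (u k))\<^sup>2)))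
        + V * (\<Sum>k\<in>F. (C1 - c * (bracket k powr r - E2 * bracket k powr (r - 1))) * (cmod (u k))\<^sup>2)"
      by (rule add_mono[OF error main])
    also have "\<dots> = V * (\<Sum>k\<in>F. (E1 * S' * bracket k powr (r - 1) + b * S * bracket k powr r
        + (C1 - c * (bracket k powr r - E2 * bracket k powr (r - 1)))) * (cmod (u k))\<^sup>2)"
      by (simp add: sum_distrib_left distrib_right distrib_left sum.distrib mult_ac)
    also have "\<dots> \<le> V * (\<Sum>k\<in>F. (C1 + C' - c / 3 * bracket k powr r) * (cmod (u k))\<^sup>2)"
    proof (rule mult_left_mono[OF _ less_imp_le[OF V]], intro sum_mono mult_right_mono)
      fix k :: "real^'n"
      have "b * S \<le> c / 3" using K(2) by (simp add: b_def)
      then have "b * S * bracket k powr r \<le> c / 3 * bracket k powr r" by (rule mult_right_mono) simp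
      then show "E1 * S' * bracket k powr (r - 1) + b * S * bracket k powr r
        + (C1 - c * (bracket k powr r - E2 * bracket k powr (r - 1))) \<le> C1 + C' - c / 3 * bracket k powr r"
        using C'(2)[OF bracket_ge_1[of k]] unfolding distrib_right right_diff_distrib mult.assoc by linarith
    qed simp
    finally show "(\<Sum>k\<in>F. Re (cnj (u k) * (\<Sum>m\<in>F. kernel k m * u m))) \<le> (\<Sum>k\<in>F. (C1 + C' - c / 3 * bracket k powr r) * (cmod (u k))\<^sup>2)"
      using V by simp
  qed
qed

lemma parabolic: "0 < T \<Longrightarrow> \<exists>S. parabolic_kernel h T (r + 1) S kernel"
proof -
  assume T: "0 < T"
  obtain c C where c: "c > 0" and g: "\<And>F u. finite F \<Longrightarrow> F \<subseteq> L \<Longrightarrow>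
      (\<Sum>k\<in>F. Re (cnj (u k) * (\<Sum>m\<in>F. kernel k m * u m))) \<le> (\<Sum>k\<in>F. (C - c * bracket k powr r) * (cmod (u k))\<^sup>2)"
    using garding_inequality by blast
  show ?thesis by (rule parabolic_kernel[OF T c g])
qed

end

section \<open>The Fourier transform of square summable functions\<close>

lemma torus_integral_continuous:
  fixes g :: "real^'n \<Rightarrow> 'b::euclidean_space"
  assumes "continuous_on UNIV g"
  shows "integrable torus_measure g" "integral\<^sup>L torus_measure g = integral (cbox 0 1) g"
proof -
  have "set_integrable lebesgue (cbox 0 1) g"
    by (rule absolutely_integrable_continuous[OF continuous_on_subset[OF assms]]) simp
  then show "integrable torus_measure g" "integral\<^sup>L torus_measure g = integral (cbox 0 1) g"
    using set_lebesgue_integral_eq_integral(2)[of "cbox 0 1" g]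
    by (simp_all add: torus_measure_def set_integrable_lebesgue_on)
qed

lemma emeasure_torus: "emeasure (torus_measure :: (real^'n) measure) (space (torus_measure :: (real^'n) measure)) = 1"
proof -
  have "emeasure (torus_measure :: (real^'n) measure) (space (torus_measure :: (real^'n) measure)) = emeasure lborel (cbox 0 (1::real^'n))"
    by (simp add: torus_measure_def emeasure_restrict_space)
  also have "\<dots> = ennreal (measure lborel (cbox 0 (1::real^'n)))"
    by (rule emeasure_eq_ennreal_measure) (simp add: emeasure_lborel_cbox_eq)
  finally show ?thesis by (simp add: content_unit_cube)
qed

text \<open>Cauchy-Schwarz against the constant 1 on a probability space.\<close>

lemma torus_L1_le_L2:
  fixes x :: "real^'n \<Rightarrow> complex"
  assumes x: "x \<in> borel_measurable torus_measure" and \<epsilon>: "0 < \<epsilon>"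
    and le: "(\<integral>\<^sup>+\<theta>. ennreal ((cmod (x \<theta>))\<^sup>2) \<partial>torus_measure) < ennreal (\<epsilon>\<^sup>2)"
  shows "integrable torus_measure x" "(LINT \<theta>|torus_measure. cmod (x \<theta>)) < \<epsilon>"
proof -
  define N where "N = (\<integral>\<^sup>+\<theta>. ennreal (cmod (x \<theta>)) \<partial>torus_measure)"
  have "(\<integral>\<^sup>+\<theta>. ennreal (cmod (x \<theta>)) * 1 \<partial>torus_measure)\<^sup>2
      \<le> (\<integral>\<^sup>+\<theta>. (ennreal (cmod (x \<theta>)))\<^sup>2 \<partial>torus_measure) * (\<integral>\<^sup>+\<theta>. 1\<^sup>2 \<partial>(torus_measure :: (real^'n) measure))"
    by (rule Cauchy_Schwarz_nn_integral) (use x in auto)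
  then have "N\<^sup>2 \<le> (\<integral>\<^sup>+\<theta>. ennreal ((cmod (x \<theta>))\<^sup>2) \<partial>torus_measure)"
    by (simp add: N_def emeasure_torus ennreal_power)
  then have N2: "N\<^sup>2 < (ennreal \<epsilon>)\<^sup>2" using le \<epsilon> by (simp add: ennreal_power)
  have N: "N < ennreal \<epsilon>"
  proof (rule ccontr)
    assume "\<not> N < ennreal \<epsilon>"
    then have "(ennreal \<epsilon>)\<^sup>2 \<le> N\<^sup>2" by (intro power_mono) auto
    then show False using N2 by simp
  qed
  show i: "integrable torus_measure x"
    by (rule integrableI_bounded[OF x]) (use N in \<open>auto simp: N_def intro: less_trans[OF _ ennreal_less_top]\<close>)
  have "N = ennreal (LINT \<theta>|torus_measure. cmod (x \<theta>))"
    unfolding N_def by (rule nn_integral_eq_integral) (use i in auto)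
  then show "(LINT \<theta>|torus_measure. cmod (x \<theta>)) < \<epsilon>" using N \<epsilon> by (simp add: ennreal_less_iff)
qed

section \<open>Partial Fourier sums and their limit\<close>

definition fourier_sum :: "real \<Rightarrow> (real^'n \<Rightarrow> complex) \<Rightarrow> (real^'n) set \<Rightarrow> real^'n \<Rightarrow> complex" where
  "fourier_sum h f A \<theta> = (\<Sum>k\<in>A. semiclassical_character h (- k) \<theta> * f k)"

lemma continuous_fourier_sum: "continuous_on S (fourier_sum h f A)"
  unfolding fourier_sum_def by (intro continuous_intros)

lemma measurable_fourier_sum: "fourier_sum h f A \<in> borel_measurable torus_measure"
  by (rule borel_measurable_integrable[OF torus_integral_continuous(1)[OF continuous_fourier_sum]])

lemma nn_integral_fourier_sum:
  assumes "finite G" "G \<subseteq> scaled_lattice h" "h \<noteq> 0"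
  shows "(\<integral>\<^sup>+\<theta>. ennreal ((cmod (fourier_sum h f G \<theta>))\<^sup>2) \<partial>torus_measure) = ennreal (\<Sum>k\<in>G. (cmod (f k))\<^sup>2)"
proof -
  have c: "continuous_on UNIV (\<lambda>\<theta>. (cmod (fourier_sum h f G \<theta>))\<^sup>2)"
    by (intro continuous_intros continuous_fourier_sum)
  have "(\<integral>\<^sup>+\<theta>. ennreal ((cmod (fourier_sum h f G \<theta>))\<^sup>2) \<partial>torus_measure)
      = ennreal (LINT \<theta>|torus_measure. (cmod (fourier_sum h f G \<theta>))\<^sup>2)"
    by (rule nn_integral_eq_integral[OF torus_integral_continuous(1)[OF c]]) simp
  also have "(LINT \<theta>|torus_measure. (cmod (fourier_sum h f G \<theta>))\<^sup>2) = (\<Sum>k\<in>G. (cmod (f k))\<^sup>2)"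
    unfolding torus_integral_continuous(2)[OF c] unfolding fourier_sum_def
    using torus_parseval[OF assms, of f] by (simp add: mult.commute)
  finally show ?thesis .
qed

lemma fourier_sum_diff:
  assumes "finite B" "A \<subseteq> B"
  shows "fourier_sum h f B \<theta> - fourier_sum h f A \<theta> = fourier_sum h f (B - A) \<theta>"
  unfolding fourier_sum_def by (rule sum_diff[OF assms, symmetric])

text \<open>Riesz-Fischer: a subsequence of the partial sums over balls converges almost everywhere, and
  Fatou's lemma bounds the distance of the limit to every partial sum by the tail of \<open>f\<close>.\<close>

lemma semiclassical_fourier_exists:
  fixes f :: "real^'n \<Rightarrow> complex"
  assumes h: "0 < h" and f: "f \<in> ell2 h"
  shows "\<exists>F. is_semiclassical_fourier h f F"
proof -
  let ?M = "torus_measure :: (real^'n) measure" and ?L = "scaled_lattice h :: (real^'n) set"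
  let ?q = "\<lambda>k. (cmod (f k))\<^sup>2"
  have h0: "h \<noteq> 0" using h by simp
  define A where "A j = {k \<in> ?L. norm k \<le> real j}" for j :: nat
  have A: "finite (A j)" "A j \<subseteq> ?L" "i \<le> j \<Longrightarrow> A i \<subseteq> A j" for i j
    using finite_lattice_ball[OF h] by (auto simp: A_def)
  have Aun: "?L \<subseteq> (\<Union>j. A j)" using real_arch_simple by (auto simp: A_def)
  \<comment> \<open>For finite B inside the lattice this is the squared norm of f off B.\<close>
  define tail where "tail B = (ell2_norm h f)\<^sup>2 - sum ?q B" for B
  have sum_le: "sum ?q (B - C) \<le> tail C" if "finite B" "B \<subseteq> ?L" "finite C" "C \<subseteq> ?L" for B C
  proof -
    have "sum ?q (B - C \<union> C) = sum ?q (B - C) + sum ?q C"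
      by (rule sum.union_disjoint) (use that in auto)
    then have "sum ?q (B - C) + sum ?q C = sum ?q (B \<union> C)" by simp
    also have "\<dots> \<le> (ell2_norm h f)\<^sup>2"
      unfolding ell2_norm_power2 by (rule finite_sum_le_infsum) (use f that in \<open>auto simp: ell2_def\<close>)
    finally show ?thesis by (simp add: tail_def)
  qed
  have has: "(?q has_sum (ell2_norm h f)\<^sup>2) ?L"
    unfolding ell2_norm_power2 using f by (simp add: ell2_def has_sum_infsum)
  have tail_lim: "(tail \<longlongrightarrow> 0) (finite_subsets_at_top ?L)"
  proof -
    have "((\<lambda>B. (ell2_norm h f)\<^sup>2 - sum ?q B) \<longlongrightarrow> (ell2_norm h f)\<^sup>2 - (ell2_norm h f)\<^sup>2) (finite_subsets_at_top ?L)"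
      using has unfolding has_sum_def by (intro tendsto_intros)
    then show ?thesis by (simp add: tail_def[abs_def])
  qed
  have tailA: "(\<lambda>j. tail (A j)) \<longlonglongrightarrow> 0"
  proof -
    have "(\<lambda>j. (ell2_norm h (\<lambda>k. if k \<in> A j then 0 else f k))\<^sup>2) \<longlonglongrightarrow> 0\<^sup>2"
      by (intro tendsto_intros ell2_tail_tendsto f A Aun)
    then show ?thesis unfolding ell2_tail_power2[OF f A(1,2)] tail_def by simp
  qed
  define s where "s j = fourier_sum h f (A j)" for j
  have int_s: "integrable ?M (s j)" for j
    unfolding s_def by (rule torus_integral_continuous(1)[OF continuous_fourier_sum])
  have L2: "(\<integral>\<^sup>+\<theta>. ennreal ((cmod (fourier_sum h f B \<theta> - fourier_sum h f C \<theta>))\<^sup>2) \<partial>?M) \<le> ennreal (tail C)"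
    if "finite B" "B \<subseteq> ?L" "finite C" "C \<subseteq> B" for B C
  proof -
    have sub: "B - C \<subseteq> ?L" "C \<subseteq> ?L" using that by auto
    show ?thesis
      unfolding fourier_sum_diff[OF that(1,4)] nn_integral_fourier_sum[OF finite_Diff[OF that(1)] sub(1) h0]
      by (rule ennreal_leI[OF sum_le[OF that(1-3) sub(2)]])
  qed
  have cauchy: "\<exists>N. \<forall>i\<ge>N. \<forall>j\<ge>N. (LINT \<theta>|?M. norm (s i \<theta> - s j \<theta>)) < e" if e: "0 < e" for e
  proof -
    have "\<forall>\<^sub>F j in sequentially. tail (A j) < e\<^sup>2"
      using tailA by (rule order_tendstoD(2)) (use e in simp)
    then obtain N where N: "\<And>j. j \<ge> N \<Longrightarrow> tail (A j) < e\<^sup>2" by (auto simp: eventually_sequentially)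
    have less: "(LINT \<theta>|?M. norm (s i \<theta> - s j \<theta>)) < e" if "N \<le> j" "j \<le> i" for i j
    proof (rule torus_L1_le_L2(2)[OF _ e])
      show "(\<lambda>\<theta>. s i \<theta> - s j \<theta>) \<in> borel_measurable ?M" using int_s by simp
      have "(\<integral>\<^sup>+\<theta>. ennreal ((cmod (s i \<theta> - s j \<theta>))\<^sup>2) \<partial>?M) \<le> ennreal (tail (A j))"
        unfolding s_def by (intro L2 A that)
      also have "\<dots> < ennreal (e\<^sup>2)" using N[OF that(1)] e by (intro ennreal_lessI) auto
      finally show "(\<integral>\<^sup>+\<theta>. ennreal ((cmod (s i \<theta> - s j \<theta>))\<^sup>2) \<partial>?M) < ennreal (e\<^sup>2)" .
    qed
    show ?thesis
    proof (intro exI allI impI)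
      fix i j assume "N \<le> i" "N \<le> j"
      then show "(LINT \<theta>|?M. norm (s i \<theta> - s j \<theta>)) < e"
        using less[of j i] less[of i j] by (cases "j \<le> i") (auto simp: norm_minus_commute)
    qed
  qed
  \<comment> \<open>The L^2 Cauchy property enters through L^1, where almost everywhere convergent
    subsequences are available.\<close>
  obtain \<rho> where \<rho>: "strict_mono \<rho>" and ae: "AE \<theta> in ?M. Cauchy (\<lambda>i. s (\<rho> i) \<theta>)"
  proof (rule cauchy_L1_AE_cauchy_subseq[of ?M s])
    show "integrable ?M (s j)" for j by (rule int_s)
    show "\<exists>N. \<forall>i\<ge>N. \<forall>j\<ge>N. (LINT \<theta>|?M. norm (s i \<theta> - s j \<theta>)) < e" if "0 < e" for e
      by (rule cauchy[OF that])
  qed (erule (1) that)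
  define F where "F \<theta> = lim (\<lambda>i. s (\<rho> i) \<theta>)" for \<theta>
  have Fm: "F \<in> borel_measurable ?M"
    unfolding F_def using int_s by (intro borel_measurable_lim_metric) auto
  have Flim: "AE \<theta> in ?M. (\<lambda>i. s (\<rho> i) \<theta>) \<longlonglongrightarrow> F \<theta>"
    using ae by eventually_elim (simp add: F_def Cauchy_convergent_iff convergent_LIMSEQ_iff)
  have dist: "(\<integral>\<^sup>+\<theta>. ennreal ((cmod (F \<theta> - fourier_sum h f C \<theta>))\<^sup>2) \<partial>?M) \<le> ennreal (tail C)"
    if C: "finite C" "C \<subseteq> ?L" for C
  proof -
    obtain N where N: "C \<subseteq> A N"
    proof -
      obtain N :: nat where "(\<Sum>k\<in>C. norm k) \<le> real N" using real_arch_simple by blast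
      moreover have "norm k \<le> (\<Sum>k\<in>C. norm k)" if "k \<in> C" for k by (rule member_le_sum) (use C that in auto)
      ultimately show ?thesis using that[of N] C(2) by (fastforce simp: A_def)
    qed
    let ?d = "\<lambda>i \<theta>. ennreal ((cmod (s (\<rho> i) \<theta> - fourier_sum h f C \<theta>))\<^sup>2)"
    have dm: "?d i \<in> borel_measurable ?M" for i
      using int_s[of "\<rho> i"] measurable_fourier_sum[of h f C] by measurable
    have "(\<integral>\<^sup>+\<theta>. ennreal ((cmod (F \<theta> - fourier_sum h f C \<theta>))\<^sup>2) \<partial>?M) = (\<integral>\<^sup>+\<theta>. liminf (\<lambda>i. ?d i \<theta>) \<partial>?M)"
    proof (rule nn_integral_cong_AE)
      show "AE \<theta> in ?M. ennreal ((cmod (F \<theta> - fourier_sum h f C \<theta>))\<^sup>2) = liminf (\<lambda>i. ?d i \<theta>)"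
        using Flim
      proof eventually_elim
        case (elim \<theta>)
        have "(\<lambda>i. ?d i \<theta>) \<longlonglongrightarrow> ennreal ((cmod (F \<theta> - fourier_sum h f C \<theta>))\<^sup>2)"
          by (intro tendsto_ennrealI tendsto_intros elim)
        then show ?case by (rule lim_imp_Liminf[OF sequentially_bot, symmetric])
      qed
    qed
    also have "\<dots> \<le> liminf (\<lambda>i. \<integral>\<^sup>+\<theta>. ?d i \<theta> \<partial>?M)" by (rule nn_integral_liminf[OF dm])
    also have "\<dots> \<le> liminf (\<lambda>i. ennreal (tail C))"
    proof (rule Liminf_mono)
      show "\<forall>\<^sub>F i in sequentially. (\<integral>\<^sup>+\<theta>. ?d i \<theta> \<partial>?M) \<le> ennreal (tail C)"
        using eventually_ge_at_top[of N]
      proof eventually_elim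
        case (elim i)
        have "C \<subseteq> A (\<rho> i)" using N A(3)[of N "\<rho> i"] elim seq_suble[OF \<rho>, of i] by auto
        then show ?case unfolding s_def by (intro L2 A C)
      qed
    qed
    also have "\<dots> = ennreal (tail C)" by (simp add: Liminf_const)
    finally show ?thesis .
  qed
  have "is_semiclassical_fourier h f F"
    unfolding is_semiclassical_fourier_def
  proof (intro conjI Fm)
    show "((\<lambda>A. \<integral>\<^sup>+\<theta>. ennreal ((cmod (F \<theta> - (\<Sum>k\<in>A. semiclassical_character h (- k) \<theta> * f k)))\<^sup>2) \<partial>?M) \<longlongrightarrow> 0)
        (finite_subsets_at_top ?L)"
    proof (rule tendsto_sandwich[of "\<lambda>_. 0" _ _ "\<lambda>C. ennreal (tail C)"])
      show "((\<lambda>C. ennreal (tail C)) \<longlongrightarrow> 0) (finite_subsets_at_top ?L)"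
        using tendsto_ennrealI[OF tail_lim] by simp
      show "\<forall>\<^sub>F C in finite_subsets_at_top ?L. (\<integral>\<^sup>+\<theta>. ennreal ((cmod (F \<theta> - (\<Sum>k\<in>C. semiclassical_character h (- k) \<theta> * f k)))\<^sup>2) \<partial>?M) \<le> ennreal (tail C)"
        by (rule eventually_finite_subsets_at_top_weakI) (use dist in \<open>simp add: fourier_sum_def\<close>)
    qed auto
  qed
  then show ?thesis by blast
qed

text \<open>The transform is a chosen representative, of which only the defining L^2 convergence is
  used. As c is bounded on the cube and the torus has finite measure, integration against c is
  continuous for this convergence.\<close>

lemma semiclassical_fourier_pairing:
  fixes f c :: "real^'n \<Rightarrow> complex"
  assumes h: "0 < h" and f: "f \<in> ell2 h" and c: "continuous_on UNIV c"
  shows "((\<lambda>A. LINT \<theta>|torus_measure. c \<theta> * fourier_sum h f A \<theta>) \<longlongrightarrow>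
      (LINT \<theta>|torus_measure. c \<theta> * semiclassical_fourier h f \<theta>)) (finite_subsets_at_top (scaled_lattice h))"
proof -
  let ?M = "torus_measure :: (real^'n) measure" and ?L = "scaled_lattice h :: (real^'n) set"
  define F where "F = semiclassical_fourier h f"
  have "is_semiclassical_fourier h f F"
    unfolding F_def semiclassical_fourier_def using someI_ex[OF semiclassical_fourier_exists[OF h f]] .
  then have Fm: "F \<in> borel_measurable ?M"
    and lim: "((\<lambda>A. \<integral>\<^sup>+\<theta>. ennreal ((cmod (F \<theta> - fourier_sum h f A \<theta>))\<^sup>2) \<partial>?M) \<longlongrightarrow> 0) (finite_subsets_at_top ?L)"
    by (auto simp: is_semiclassical_fourier_def fourier_sum_def)
  have "bounded (c ` cbox 0 1)"
    by (intro compact_imp_bounded compact_continuous_image continuous_on_subset[OF c] compact_cbox) auto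
  then obtain B where B: "B > 0" "\<And>\<theta>. \<theta> \<in> cbox 0 1 \<Longrightarrow> cmod (c \<theta>) \<le> B" unfolding bounded_pos by auto
  have sp: "AE \<theta> in ?M. cmod (c \<theta>) \<le> B"
    using AE_space[of ?M] by eventually_elim (use B(2) in \<open>simp add: torus_measure_def\<close>)
  have cm: "c \<in> borel_measurable ?M" using torus_integral_continuous(1)[OF c] by simp
  have mult: "integrable ?M (\<lambda>\<theta>. c \<theta> * x \<theta>)" "cmod (LINT \<theta>|?M. c \<theta> * x \<theta>) \<le> B * (LINT \<theta>|?M. cmod (x \<theta>))"
    if x: "integrable ?M x" for x
  proof -
    have b: "AE \<theta> in ?M. cmod (c \<theta> * x \<theta>) \<le> B * cmod (x \<theta>)"
      using sp by eventually_elim (simp add: norm_mult mult_right_mono)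
    show i: "integrable ?M (\<lambda>\<theta>. c \<theta> * x \<theta>)"
      by (rule Bochner_Integration.integrable_bound[of _ "\<lambda>\<theta>. B * cmod (x \<theta>)"])
        (use x cm b B(1) in auto)
    have "cmod (LINT \<theta>|?M. c \<theta> * x \<theta>) \<le> (LINT \<theta>|?M. cmod (c \<theta> * x \<theta>))" by (rule integral_norm_bound)
    also have "\<dots> \<le> (LINT \<theta>|?M. B * cmod (x \<theta>))"
      by (rule integral_mono_AE) (use i x b in auto)
    finally show "cmod (LINT \<theta>|?M. c \<theta> * x \<theta>) \<le> B * (LINT \<theta>|?M. cmod (x \<theta>))" by simp
  qed
  have int_sum: "integrable ?M (fourier_sum h f A)" for A
    by (rule torus_integral_continuous(1)[OF continuous_fourier_sum])
  show ?thesis unfolding F_def[symmetric]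
  proof (rule tendstoI)
    fix e :: real assume e: "0 < e"
    define \<epsilon> where "\<epsilon> = e / B"
    have \<epsilon>: "0 < \<epsilon>" using e B by (simp add: \<epsilon>_def)
    have "\<forall>\<^sub>F A in finite_subsets_at_top ?L. (\<integral>\<^sup>+\<theta>. ennreal ((cmod (F \<theta> - fourier_sum h f A \<theta>))\<^sup>2) \<partial>?M) < ennreal (\<epsilon>\<^sup>2)"
      using lim by (rule order_tendstoD(2)) (use \<epsilon> in simp)
    then show "\<forall>\<^sub>F A in finite_subsets_at_top ?L. dist (LINT \<theta>|?M. c \<theta> * fourier_sum h f A \<theta>) (LINT \<theta>|?M. c \<theta> * F \<theta>) < e"
    proof eventually_elim
      case (elim A)
      let ?x = "\<lambda>\<theta>. F \<theta> - fourier_sum h f A \<theta>"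
      have xm: "?x \<in> borel_measurable ?M" using Fm measurable_fourier_sum by (rule borel_measurable_diff)
      note x = torus_L1_le_L2[OF xm \<epsilon> elim]
      have Fi: "integrable ?M F" using Bochner_Integration.integrable_add[OF x(1) int_sum[of A]] by simp
      have "(LINT \<theta>|?M. c \<theta> * F \<theta>) - (LINT \<theta>|?M. c \<theta> * fourier_sum h f A \<theta>) = (LINT \<theta>|?M. c \<theta> * ?x \<theta>)"
        using Bochner_Integration.integral_diff[OF mult(1)[OF Fi] mult(1)[OF int_sum[of A]]] by (simp add: right_diff_distrib)
      then have "dist (LINT \<theta>|?M. c \<theta> * fourier_sum h f A \<theta>) (LINT \<theta>|?M. c \<theta> * F \<theta>) = cmod (LINT \<theta>|?M. c \<theta> * ?x \<theta>)"
        by (simp add: dist_norm norm_minus_commute)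
      also have "\<dots> \<le> B * (LINT \<theta>|?M. cmod (?x \<theta>))" by (rule mult(2)[OF x(1)])
      also have "\<dots> < B * \<epsilon>" using x(2) B by (intro mult_strict_left_mono)
      also have "\<dots> = e" using B by (simp add: \<epsilon>_def)
      finally show ?case .
    qed
  qed
qed

text \<open>For finite partial sums of the transform the integral is a finite kernel sum.
  Convergence along the finite subsets of the lattice is exactly unconditional summability, so the
  pairing lemma yields the infinite sum.\<close>

lemma (in elliptic_symbol) Op_eq_kernel:
  assumes f: "f \<in> ell2 h" and k: "k \<in> L"
  shows "Op h \<sigma> f k = (\<Sum>\<^sub>\<infinity>m\<in>L. kernel k m * f m)"
proof -
  let ?c = "\<lambda>\<theta>. semiclassical_character h k \<theta> * \<sigma> k \<theta>"
  have c: "continuous_on UNIV ?c" by (intro continuous_intros smooth_continuous symbol_smooth k)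
  have "(LINT \<theta>|torus_measure. ?c \<theta> * fourier_sum h f A \<theta>) = (\<Sum>m\<in>A. kernel k m * f m)" for A
  proof -
    have "(LINT \<theta>|torus_measure. ?c \<theta> * fourier_sum h f A \<theta>)
        = (LINT \<theta>|torus_measure. (\<Sum>m\<in>A. \<sigma> k \<theta> * semiclassical_character h (k - m) \<theta> * f m))"
      by (simp add: fourier_sum_def sum_distrib_left character_mult[of h k _ "- _", symmetric, simplified] mult_ac)
    also have "\<dots> = (\<Sum>m\<in>A. (LINT \<theta>|torus_measure. \<sigma> k \<theta> * semiclassical_character h (k - m) \<theta> * f m))"
      by (rule Bochner_Integration.integral_sum, rule torus_integral_continuous(1))
        (intro continuous_intros smooth_continuous symbol_smooth k)
    also have "\<dots> = (\<Sum>m\<in>A. kernel k m * f m)"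
    proof (intro sum.cong refl)
      fix m
      have "continuous_on UNIV (\<lambda>\<theta>. \<sigma> k \<theta> * semiclassical_character h (k - m) \<theta>)"
        by (intro continuous_intros smooth_continuous symbol_smooth k)
      then show "(LINT \<theta>|torus_measure. \<sigma> k \<theta> * semiclassical_character h (k - m) \<theta> * f m) = kernel k m * f m"
        by (simp add: torus_integral_continuous kernel_def coeff_def fourier_coeff_def)
    qed
    finally show ?thesis .
  qed
  then have "((\<lambda>A. \<Sum>m\<in>A. kernel k m * f m) \<longlongrightarrow> Op h \<sigma> f k) (finite_subsets_at_top L)"
    using semiclassical_fourier_pairing[OF h(1) f c] by (simp add: Op_def)
  then have "((\<lambda>m. kernel k m * f m) has_sum Op h \<sigma> f k) L" by (simp add: has_sum_def)
  then show ?thesis by (simp add: infsumI)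
qed

text \<open>The quantization and the kernel operator are identified only on ell2 and at lattice
  points; solutions evaluate them nowhere else.\<close>

lemma cauchy_solution_cong:
  assumes "\<And>f k. f \<in> ell2 h \<Longrightarrow> k \<in> scaled_lattice h \<Longrightarrow> D f k = D' f k"
  shows "cauchy_solution h T D w0 g w \<longleftrightarrow> cauchy_solution h T D' w0 g w"
proof -
  have "set_integrable lebesgue {0..t} (\<lambda>s. D (w s) k + g s k) = set_integrable lebesgue {0..t} (\<lambda>s. D' (w s) k + g s k)"
    "(LINT s:{0..t}|lebesgue. D (w s) k + g s k) = (LINT s:{0..t}|lebesgue. D' (w s) k + g s k)"
    if "continuous_ell2 h T w" "t \<in> {0..T}" "k \<in> scaled_lattice h" for t k
  proof -
    have "D (w s) k = D' (w s) k" if "s \<in> {0..t}" for s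
      using assms \<open>continuous_ell2 h T w\<close> \<open>t \<in> {0..T}\<close> \<open>k \<in> scaled_lattice h\<close> that by (auto simp: continuous_ell2_def)
    note eq = this
    show "set_integrable lebesgue {0..t} (\<lambda>s. D (w s) k + g s k) = set_integrable lebesgue {0..t} (\<lambda>s. D' (w s) k + g s k)"
      by (rule set_integrable_cong) (use eq in auto)
    show "(LINT s:{0..t}|lebesgue. D (w s) k + g s k) = (LINT s:{0..t}|lebesgue. D' (w s) k + g s k)"
      by (rule set_lebesgue_integral_cong) (use eq in auto)
  qed
  then show ?thesis unfolding cauchy_solution_def by (intro conj_cong ball_cong refl) simp_all
qed

theorem theorem6p14:
  fixes h r T :: real
    and \<sigma> :: "real^'n \<Rightarrow> real^'n \<Rightarrow> complex"
    and D :: "(real^'n \<Rightarrow> complex) \<Rightarrow> real^'n \<Rightarrow> complex"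
  assumes "0 < h" and "h \<le> 1" and "0 < r" and "0 < T"
    and "\<sigma> \<in> symbol_class h r"
    and "D = Op h \<sigma>"
    and "\<exists>C0>0. \<exists>R>0. \<forall>k\<in>scaled_lattice h. \<forall>\<theta>. R \<le> norm k \<longrightarrow>
           Im (\<sigma> k \<theta>) = 0 \<and> - Re (\<sigma> k \<theta>) \<ge> C0 * norm k powr r"
  shows "\<exists>C>0. \<forall>w0 g. w0 \<in> ell2 h \<and> L1_ell2 h T g \<longrightarrow>
           (\<exists>w. cauchy_solution h T D w0 g w \<and>
                (\<forall>w'. cauchy_solution h T D w0 g w' \<longrightarrow> (\<forall>t\<in>{0..T}. w' t = w t)) \<and>
                (\<forall>t\<in>{0..T}. ennreal ((ell2_norm h (w t))\<^sup>2)
                   \<le> ennreal C * (ennreal ((ell2_norm h w0)\<^sup>2)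
                       + (\<integral>\<^sup>+s\<in>{0..t}. ennreal ((ell2_norm h (g s))\<^sup>2) \<partial>lebesgue))))"
proof -
  have elliptic: "elliptic_symbol h r \<sigma>"
    using assms(1-3,5,7) by (rule elliptic_symbol.intro)
  let ?A = "elliptic_symbol.kernel h \<sigma>"
  obtain S where S: "parabolic_kernel h T (r + 1) S ?A"
    using elliptic_symbol.parabolic[OF elliptic assms(4)] by blast
  have D: "D f k = parabolic_kernel.act h ?A f k" if "f \<in> ell2 h" "k \<in> scaled_lattice h" for f k
    unfolding assms(6) parabolic_kernel.act_def[OF S]
    by (rule elliptic_symbol.Op_eq_kernel[OF elliptic that])
  have "cauchy_solution h T D w0 g w \<longleftrightarrow> cauchy_solution h T (parabolic_kernel.act h ?A) w0 g w" for w0 g w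
    by (rule cauchy_solution_cong[OF D])
  then show ?thesis using parabolic_kernel.well_posed[OF S] by (simp only:)
qed

end
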